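(* Let $G$ be a bipartite graph with positive integer edge weights, without isolated nodes, with total edge weight $W$, and let $M$ be a maximum weight matching of $G$. The procedure Compute-All-Cavity$(G,M)$, which constructs the unfolded graph $\phi(G)$ and the matching $\phi(M)$, determines $\rho(u^i)$ for every node $u^i$ of $\phi(G)$, and outputs for every node $u$ of $G$ the value $\mathrm{mwm}(G)-\sum_{1\le i\le\beta}\rho(u^i)$ (where $u^1,\ldots,u^\beta$ are the copies of $u$ in $\phi(G)$), correctly computes $\mathrm{mwm}(G-\{u\})$ for all nodes $u$ of $G$ in $O(W)$ time.
   Context: $\mathrm{mwm}(H)$ is the maximum total weight of a matching of $H$. The unfolded graph $\phi(G)$: for each node $u$ of $G$, $\phi(G)$ has nodes $u^1,\ldots,u^\alpha$, where $\alpha$ is the weight of the heaviest edge of $G$ incident to $u$; for each edge $uv$ of $G$ with weight $\beta=w(u,v)$, $\phi(G)$ has edges $u^1v^\beta,u^2v^{\beta-1},\ldots,u^\beta v^1$. For a matching $M$ of $G$, $\phi(M)=\bigcup_{uv\in M}\{u^1v^{w(u,v)},\ldots,u^{w(u,v)}v^1\}$. A path in $\phi(G)$ is alternating for $\phi(M)$ if its edges alternate between being in $\phi(M)$ and not in $\phi(M)$, and, whenever its first (respectively last) node is matched by $\phi(M)$, the path contains that node's matched edge as its first (respectively last) edge. Its length is its number of edges; a length-zero alternating path consists of a single node unmatched by $\phi(M)$. For a node $u^i$ of $\phi(G)$, $\rho(u^i)=0$ if there is an even-length alternating path for $\phi(M)$ starting from $u^i$, and $\rho(u^i)=1$ otherwise.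 *)

theory Defs
  imports "HOL-Library.Landau_Symbols"
begin

section \<open>Weighted graphs and matchings\<close>

record 'a graph =
  verts :: "'a set"
  edges :: "'a set set"

record 'a wgraph = "'a graph" +
  weight :: "'a set \<Rightarrow> nat"

definition bipartite :: "('a, 'b) graph_scheme \<Rightarrow> bool" where
  "bipartite G \<longleftrightarrow> finite (verts G) \<and>
     (\<exists>X Y. verts G = X \<union> Y \<and> X \<inter> Y = {} \<and>
        (\<forall>e\<in>edges G. \<exists>x\<in>X. \<exists>y\<in>Y. e = {x, y}))"

definition positive_weights :: "'a wgraph \<Rightarrow> bool" where
  "positive_weights G \<longleftrightarrow> (\<forall>e\<in>edges G. weight G e > 0)"

definition no_isolated :: "('a, 'b) graph_scheme \<Rightarrow> bool" where
  "no_isolated G \<longleftrightarrow> (\<forall>u\<in>verts G. \<exists>e\<in>edges G. u \<in> e)"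

definition total_weight :: "'a wgraph \<Rightarrow> nat" where
  "total_weight G = sum (weight G) (edges G)"

definition matching :: "('a, 'b) graph_scheme \<Rightarrow> 'a set set \<Rightarrow> bool" where
  "matching G M \<longleftrightarrow> M \<subseteq> edges G \<and> (\<forall>e\<in>M. \<forall>f\<in>M. e \<noteq> f \<longrightarrow> e \<inter> f = {})"

definition mwm :: "'a wgraph \<Rightarrow> nat" where
  "mwm G = Max {sum (weight G) M | M. matching G M}"

definition max_weight_matching :: "'a wgraph \<Rightarrow> 'a set set \<Rightarrow> bool" where
  "max_weight_matching G M \<longleftrightarrow> matching G M \<and> sum (weight G) M = mwm G"

definition delete_vertex :: "'a wgraph \<Rightarrow> 'a \<Rightarrow> 'a wgraph" where
  "delete_vertex G u = \<lparr>verts = verts G - {u}, edges = {e \<in> edges G. u \<notin> e}, weight = weight G\<rparr>"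


section \<open>The unfolded graph\<close>

text \<open>The pair \<open>(u, i)\<close>, with \<open>i\<close> starting from 1, is the node \<open>u\<^sup>i\<close>.\<close>

definition heaviest :: "'a wgraph \<Rightarrow> 'a \<Rightarrow> nat" where
  "heaviest G u = Max {weight G e | e. e \<in> edges G \<and> u \<in> e}"

definition unfold_edges :: "'a wgraph \<Rightarrow> 'a set set \<Rightarrow> ('a \<times> nat) set set" where
  "unfold_edges G F =
     {{(u, i), (v, weight G {u, v} + 1 - i)} | u v i.
        {u, v} \<in> F \<and> 1 \<le> i \<and> i \<le> weight G {u, v}}"

definition unfolded :: "'a wgraph \<Rightarrow> ('a \<times> nat) graph" where
  "unfolded G =
     \<lparr>verts = {(u, i). u \<in> verts G \<and> 1 \<le> i \<and> i \<le> heaviest G u},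
      edges = unfold_edges G (edges G)\<rparr>"

definition matched_by :: "'a set set \<Rightarrow> 'a \<Rightarrow> bool" where
  "matched_by N x \<longleftrightarrow> x \<in> \<Union>N"

definition graph_path :: "('a, 'b) graph_scheme \<Rightarrow> 'a list \<Rightarrow> bool" where
  "graph_path H p \<longleftrightarrow> p \<noteq> [] \<and> distinct p \<and> set p \<subseteq> verts H \<and>
     (\<forall>i. i + 1 < length p \<longrightarrow> {p ! i, p ! (i + 1)} \<in> edges H)"

definition path_length :: "'a list \<Rightarrow> nat" where
  "path_length p = length p - 1"

definition alternating_path :: "('a, 'b) graph_scheme \<Rightarrow> 'a set set \<Rightarrow> 'a list \<Rightarrow> bool" where
  "alternating_path H N p \<longleftrightarrow> graph_path H p \<and>
     (\<forall>i. i + 2 < length p \<longrightarrow>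
        ({p ! i, p ! (i + 1)} \<in> N \<longleftrightarrow> {p ! (i + 1), p ! (i + 2)} \<notin> N)) \<and>
     (matched_by N (hd p) \<longrightarrow> length p \<ge> 2 \<and> {p ! 0, p ! 1} \<in> N) \<and>
     (matched_by N (last p) \<longrightarrow>
        length p \<ge> 2 \<and> {p ! (length p - 2), p ! (length p - 1)} \<in> N)"

definition rho :: "'a wgraph \<Rightarrow> 'a set set \<Rightarrow> 'a \<times> nat \<Rightarrow> nat" where
  "rho G M x =
     (if \<exists>p. alternating_path (unfolded G) (unfold_edges G M) p \<and> hd p = x \<and> even (path_length p)
      then 0 else 1)"


section \<open>A unit-cost random access machine\<close>

text \<open>
  Programs have finitely many registers and finitely many arrays over the natural numbers. Every
  constant, register or array access, addition, (truncated) subtraction, comparison and every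
  assignment or test takes one unit of time. There is no multiplication, so no single step can
  produce a large number.
\<close>

datatype reg = NumNodes | NumEdges | NumCopies | NumHalves
  | NodeIdx | EdgeIdx | CopyIdx | CopyA | CopyB
  | QHead | QTail | Cur | Half | Partner | Total | Loss

datatype arr = EndA | EndB | Wt | InM
  | Alpha | Offset | Target | Next | First | Mate | Rho | Queue | Cavity

datatype aexp =
    Lit nat
  | Reg reg
  | Load arr aexp  (\<open>_\<lbrakk>_\<rbrakk>\<close> [1000, 0] 1000)
  | Plus aexp aexp  (infixl \<open>\<boxplus>\<close> 65)
  | Minus aexp aexp  (infixl \<open>\<boxminus>\<close> 65)

datatype bexp =
    Less aexp aexp  (infix \<open>\<prec>\<close> 50)
  | Equal aexp aexp  (infix \<open>\<doteq>\<close> 50)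

datatype com =
    SKIP
  | Assign reg aexp  (\<open>(_ ::= _)\<close> [1000, 61] 61)
  | Store arr aexp aexp  (\<open>(_\<lblot>_\<rblot> ::= _)\<close> [1000, 0, 61] 61)
  | Seq com com  (infixr \<open>;;\<close> 60)
  | Cond bexp com com  (\<open>(IF _/ THEN _/ ELSE _)\<close> [0, 0, 61] 61)
  | While bexp com  (\<open>(WHILE _/ DO _)\<close> [0, 61] 61)

record state =
  regs :: "reg \<Rightarrow> nat"
  arrs :: "arr \<Rightarrow> nat \<Rightarrow> nat"

fun aval :: "aexp \<Rightarrow> state \<Rightarrow> nat" where
  "aval (Lit k) s = k"
| "aval (Reg r) s = regs s r"
| "aval (Load a e) s = arrs s a (aval e s)"
| "aval (Plus e f) s = aval e s + aval f s"
| "aval (Minus e f) s = aval e s - aval f s"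

fun bval :: "bexp \<Rightarrow> state \<Rightarrow> bool" where
  "bval (Less e f) s \<longleftrightarrow> aval e s < aval f s"
| "bval (Equal e f) s \<longleftrightarrow> aval e s = aval f s"

fun acost :: "aexp \<Rightarrow> nat" where
  "acost (Lit k) = 1"
| "acost (Reg r) = 1"
| "acost (Load a e) = acost e + 1"
| "acost (Plus e f) = acost e + acost f + 1"
| "acost (Minus e f) = acost e + acost f + 1"

fun bcost :: "bexp \<Rightarrow> nat" where
  "bcost (Less e f) = acost e + acost f + 1"
| "bcost (Equal e f) = acost e + acost f + 1"

definition set_reg :: "reg \<Rightarrow> nat \<Rightarrow> state \<Rightarrow> state" where
  "set_reg r k s = s\<lparr>regs := (regs s)(r := k)\<rparr>"

definition set_arr :: "arr \<Rightarrow> nat \<Rightarrow> nat \<Rightarrow> state \<Rightarrow> state" where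
  "set_arr a i k s = s\<lparr>arrs := (arrs s)(a := (arrs s a)(i := k))\<rparr>"

text \<open>\<open>exec c s t s'\<close>: started in \<open>s\<close>, the program \<open>c\<close> halts in state \<open>s'\<close> after time \<open>t\<close>.\<close>

inductive exec :: "com \<Rightarrow> state \<Rightarrow> nat \<Rightarrow> state \<Rightarrow> bool" where
  Skip: "exec SKIP s 1 s"
| Assign: "exec (Assign r e) s (acost e + 1) (set_reg r (aval e s) s)"
| Store: "exec (Store a e f) s (acost e + acost f + 1) (set_arr a (aval e s) (aval f s) s)"
| Seq: "exec c s t s' \<Longrightarrow> exec d s' t' s'' \<Longrightarrow> exec (Seq c d) s (t + t') s''"
| CondTrue: "bval b s \<Longrightarrow> exec c s t s' \<Longrightarrow> exec (Cond b c d) s (bcost b + t + 1) s'"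
| CondFalse: "\<not> bval b s \<Longrightarrow> exec d s t s' \<Longrightarrow> exec (Cond b c d) s (bcost b + t + 1) s'"
| WhileFalse: "\<not> bval b s \<Longrightarrow> exec (While b c) s (bcost b + 1) s"
| WhileTrue: "bval b s \<Longrightarrow> exec c s t s' \<Longrightarrow> exec (While b c) s' t' s'' \<Longrightarrow>
    exec (While b c) s (bcost b + t + t' + 1) s''"

inductive_cases exec_SkipE: "exec SKIP s t s'"
inductive_cases exec_AssignE: "exec (Assign r e) s t s'"
inductive_cases exec_StoreE: "exec (Store a e f) s t s'"
inductive_cases exec_SeqE: "exec (Seq c d) s t s'"
inductive_cases exec_CondE: "exec (Cond b c d) s t s'"
inductive_cases exec_WhileE: "exec (While b c) s t s'"

lemma exec_deterministic:
  assumes "exec c s t s'" and "exec c s t' s''"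
  shows "t = t' \<and> s' = s''"
  using assms
proof (induction arbitrary: t' s'' rule: exec.induct)
  case (Seq c s t s1 d u s2)
  from Seq.prems obtain t1 s1' t2 where t': "t' = t1 + t2"
      and 1: "exec c s t1 s1'" and 2: "exec d s1' t2 s''"
    by (rule exec_SeqE)
  from Seq.IH(1)[OF 1] Seq.IH(2)[of t2 s''] 2 t' show ?case by simp
next
  case (CondTrue b s c t s1 d)
  from CondTrue.prems show ?case
  proof (rule exec_CondE)
    fix t1
    assume t': "t' = Suc (bcost b + t1)" and 1: "exec c s t1 s''"
    from CondTrue.IH[OF 1] t' show ?thesis by simp
  qed (use CondTrue.hyps in simp_all)
next
  case (CondFalse b s d t s1 c)
  from CondFalse.prems show ?case
  proof (rule exec_CondE)
    fix t1
    assume t': "t' = Suc (bcost b + t1)" and 1: "exec d s t1 s''"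
    from CondFalse.IH[OF 1] t' show ?thesis by simp
  qed (use CondFalse.hyps in simp_all)
next
  case (WhileFalse b s c)
  from WhileFalse.prems show ?case
    by (rule exec_WhileE) (use WhileFalse.hyps in simp_all)
next
  case (WhileTrue b s c t s1 u s2)
  from WhileTrue.prems show ?case
  proof (rule exec_WhileE)
    fix t1 s1' t2
    assume t': "t' = Suc (bcost b + t1 + t2)"
      and 1: "exec c s t1 s1'" and 2: "exec (While b c) s1' t2 s''"
    from WhileTrue.IH(1)[OF 1] WhileTrue.IH(2)[of t2 s''] 2 t' show ?thesis by simp
  qed (use WhileTrue.hyps in simp)
qed (auto elim: exec_SkipE exec_AssignE exec_StoreE)

definition For :: "reg \<Rightarrow> aexp \<Rightarrow> com \<Rightarrow> com"  (\<open>(FOR _/ BELOW _/ DO _)\<close> [1000, 0, 61] 61) where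
  "FOR r BELOW e DO c = (r ::= Lit 0 ;; WHILE Reg r \<prec> e DO (c ;; r ::= Reg r \<boxplus> Lit 1))"


section \<open>The procedure Compute-All-Cavity\<close>

text \<open>
  Input: nodes are \<open>0, \<dots>, NumNodes - 1\<close>; edge \<open>k < NumEdges\<close> joins the nodes \<open>EndA[k]\<close> and
  \<open>EndB[k]\<close>, has weight \<open>Wt[k]\<close>, and belongs to the given matching iff \<open>InM[k] = 1\<close>. The numbering
  \<open>nd\<close> relates node numbers to the nodes of \<open>G\<close>. Nothing is assumed about the other registers and
  arrays.
\<close>

definition input :: "state \<Rightarrow> (nat \<Rightarrow> 'a) \<Rightarrow> 'a wgraph \<Rightarrow> 'a set set \<Rightarrow> bool" where
  "input s nd G M \<longleftrightarrow>
     bij_betw nd {..<regs s NumNodes} (verts G) \<and>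
     bij_betw (\<lambda>k. {nd (arrs s EndA k), nd (arrs s EndB k)}) {..<regs s NumEdges} (edges G) \<and>
     (\<forall>k < regs s NumEdges.
        arrs s EndA k < regs s NumNodes \<and> arrs s EndB k < regs s NumNodes \<and>
        arrs s Wt k = weight G {nd (arrs s EndA k), nd (arrs s EndB k)} \<and>
        arrs s InM k = (if {nd (arrs s EndA k), nd (arrs s EndB k)} \<in> M then 1 else 0))"

text \<open>\<open>Alpha[u]\<close> is the number of copies of \<open>u\<close>.\<close>

definition count_copies :: com where
  "count_copies =
     FOR NodeIdx BELOW Reg NumNodes DO Alpha\<lblot>Reg NodeIdx\<rblot> ::= Lit 0 ;;
     FOR EdgeIdx BELOW Reg NumEdges DO (
       IF Alpha\<lbrakk>EndA\<lbrakk>Reg EdgeIdx\<rbrakk>\<rbrakk> \<prec> Wt\<lbrakk>Reg EdgeIdx\<rbrakk>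
         THEN Alpha\<lblot>EndA\<lbrakk>Reg EdgeIdx\<rbrakk>\<rblot> ::= Wt\<lbrakk>Reg EdgeIdx\<rbrakk> ELSE SKIP ;;
       IF Alpha\<lbrakk>EndB\<lbrakk>Reg EdgeIdx\<rbrakk>\<rbrakk> \<prec> Wt\<lbrakk>Reg EdgeIdx\<rbrakk>
         THEN Alpha\<lblot>EndB\<lbrakk>Reg EdgeIdx\<rbrakk>\<rblot> ::= Wt\<lbrakk>Reg EdgeIdx\<rbrakk> ELSE SKIP)"

text \<open>The copies of \<open>u\<close> are numbered \<open>Offset[u], \<dots>, Offset[u] + Alpha[u] - 1\<close>.\<close>

definition number_copies :: com where
  "number_copies =
     NumCopies ::= Lit 0 ;;
     FOR NodeIdx BELOW Reg NumNodes DO (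
       Offset\<lblot>Reg NodeIdx\<rblot> ::= Reg NumCopies ;;
       NumCopies ::= Reg NumCopies \<boxplus> Alpha\<lbrakk>Reg NodeIdx\<rbrakk>)"

text \<open>
  The \<open>p\<close>-th edge of the unfolded graph is stored as the two half-edges \<open>2p\<close> and \<open>2p + 1\<close>, whose
  targets are its two ends. The half-edges leaving a node \<open>x\<close> form a linked list given by \<open>First[x]\<close>
  and \<open>Next\<close>. In \<open>First\<close> and \<open>Next\<close> the half-edge \<open>h\<close>, and in \<open>Mate\<close> the node \<open>x\<close>, is
  represented by its successor, and 0 stands for absence.
\<close>

definition add_half_edge :: "reg \<Rightarrow> reg \<Rightarrow> com" where
  "add_half_edge x y =
     Target\<lblot>Reg NumHalves\<rblot> ::= Reg y ;;
     Next\<lblot>Reg NumHalves\<rblot> ::= First\<lbrakk>Reg x\<rbrakk> ;;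
     NumHalves ::= Reg NumHalves \<boxplus> Lit 1 ;;
     First\<lblot>Reg x\<rblot> ::= Reg NumHalves"

definition construct_unfolded :: com where
  "construct_unfolded =
     count_copies ;;
     number_copies ;;
     FOR CopyIdx BELOW Reg NumCopies DO (
       First\<lblot>Reg CopyIdx\<rblot> ::= Lit 0 ;;
       Mate\<lblot>Reg CopyIdx\<rblot> ::= Lit 0) ;;
     NumHalves ::= Lit 0 ;;
     FOR EdgeIdx BELOW Reg NumEdges DO (
       FOR CopyIdx BELOW Wt\<lbrakk>Reg EdgeIdx\<rbrakk> DO (
         CopyA ::= Offset\<lbrakk>EndA\<lbrakk>Reg EdgeIdx\<rbrakk>\<rbrakk> \<boxplus> Reg CopyIdx ;;
         CopyB ::= Offset\<lbrakk>EndB\<lbrakk>Reg EdgeIdx\<rbrakk>\<rbrakk> \<boxplus> (Wt\<lbrakk>Reg EdgeIdx\<rbrakk> \<boxminus> Reg CopyIdx \<boxminus> Lit 1) ;;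
         add_half_edge CopyA CopyB ;;
         add_half_edge CopyB CopyA ;;
         IF InM\<lbrakk>Reg EdgeIdx\<rbrakk> \<doteq> Lit 1 THEN (
           Mate\<lblot>Reg CopyA\<rblot> ::= Reg CopyB \<boxplus> Lit 1 ;;
           Mate\<lblot>Reg CopyB\<rblot> ::= Reg CopyA \<boxplus> Lit 1)
         ELSE SKIP))"

text \<open>
  Breadth-first search from the unmatched nodes, going in each round from \<open>x\<close> to a neighbour \<open>y\<close>
  of \<open>x\<close> and on to the node matched with \<open>y\<close>.
\<close>

definition determine_rho :: com where
  "determine_rho =
     QHead ::= Lit 0 ;;
     QTail ::= Lit 0 ;;
     FOR CopyIdx BELOW Reg NumCopies DO (
       IF Mate\<lbrakk>Reg CopyIdx\<rbrakk> \<doteq> Lit 0 THEN (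
         Rho\<lblot>Reg CopyIdx\<rblot> ::= Lit 0 ;;
         Queue\<lblot>Reg QTail\<rblot> ::= Reg CopyIdx ;;
         QTail ::= Reg QTail \<boxplus> Lit 1)
       ELSE Rho\<lblot>Reg CopyIdx\<rblot> ::= Lit 1) ;;
     WHILE Reg QHead \<prec> Reg QTail DO (
       Cur ::= Queue\<lbrakk>Reg QHead\<rbrakk> ;;
       QHead ::= Reg QHead \<boxplus> Lit 1 ;;
       Half ::= First\<lbrakk>Reg Cur\<rbrakk> ;;
       WHILE Lit 0 \<prec> Reg Half DO (
         Partner ::= Mate\<lbrakk>Target\<lbrakk>Reg Half \<boxminus> Lit 1\<rbrakk>\<rbrakk> ;;
         IF Lit 0 \<prec> Reg Partner THEN
           IF Rho\<lbrakk>Reg Partner \<boxminus> Lit 1\<rbrakk> \<doteq> Lit 1 THEN (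
             Rho\<lblot>Reg Partner \<boxminus> Lit 1\<rblot> ::= Lit 0 ;;
             Queue\<lblot>Reg QTail\<rblot> ::= Reg Partner \<boxminus> Lit 1 ;;
             QTail ::= Reg QTail \<boxplus> Lit 1)
           ELSE SKIP
         ELSE SKIP ;;
         Half ::= Next\<lbrakk>Reg Half \<boxminus> Lit 1\<rbrakk>))"

text \<open>\<open>Total\<close> becomes the weight of the given matching, which is \<open>mwm G\<close> if it is maximum.\<close>

definition output_cavities :: com where
  "output_cavities =
     Total ::= Lit 0 ;;
     FOR EdgeIdx BELOW Reg NumEdges DO (
       IF InM\<lbrakk>Reg EdgeIdx\<rbrakk> \<doteq> Lit 1 THEN Total ::= Reg Total \<boxplus> Wt\<lbrakk>Reg EdgeIdx\<rbrakk> ELSE SKIP) ;;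
     FOR NodeIdx BELOW Reg NumNodes DO (
       Loss ::= Lit 0 ;;
       FOR CopyIdx BELOW Alpha\<lbrakk>Reg NodeIdx\<rbrakk> DO
         Loss ::= Reg Loss \<boxplus> Rho\<lbrakk>Offset\<lbrakk>Reg NodeIdx\<rbrakk> \<boxplus> Reg CopyIdx\<rbrakk> ;;
       Cavity\<lblot>Reg NodeIdx\<rblot> ::= Reg Total \<boxminus> Reg Loss)"

definition compute_all_cavity :: com where
  "compute_all_cavity = construct_unfolded ;; determine_rho ;; output_cavities"

text \<open>
  The memory holds the unfolded graph and the unfolded matching. The function \<open>cp\<close> maps the numbers
  of the nodes of the unfolded graph to these nodes.
\<close>

definition holds_unfolded ::
    "state \<Rightarrow> (nat \<Rightarrow> 'a) \<Rightarrow> (nat \<Rightarrow> 'a \<times> nat) \<Rightarrow> 'a wgraph \<Rightarrow> 'a set set \<Rightarrow> bool" where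
  "holds_unfolded s nd cp G M \<longleftrightarrow>
     bij_betw cp {..<regs s NumCopies} (verts (unfolded G)) \<and>
     (\<forall>j < regs s NumNodes. arrs s Alpha j = heaviest G (nd j) \<and>
        (\<forall>i < arrs s Alpha j. arrs s Offset j + i < regs s NumCopies \<and>
           cp (arrs s Offset j + i) = (nd j, i + 1))) \<and>
     regs s NumHalves = 2 * card (edges (unfolded G)) \<and>
     (\<forall>h < regs s NumHalves. arrs s Target h < regs s NumCopies) \<and>
     bij_betw (\<lambda>p. {cp (arrs s Target (2 * p)), cp (arrs s Target (2 * p + 1))})
       {..<card (edges (unfolded G))} (edges (unfolded G)) \<and>
     (\<forall>x < regs s NumCopies. arrs s Mate x \<le> regs s NumCopies) \<and>
     unfold_edges G M =
       {{cp x, cp (arrs s Mate x - 1)} | x. x < regs s NumCopies \<and> arrs s Mate x > 0}"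

end

theory Submission
  imports Defs
begin

text \<open>
  By Egervary's theorem the maximum weight of a matching is the minimum of \<open>\<Sum>v. \<pi> v\<close> over the
  potentials \<open>\<pi>\<close> with \<open>w(u, v) \<le> \<pi> u + \<pi> v\<close> on all edges. Adding a pendant edge of weight
  \<open>mwm G - mwm (G - u)\<close> at \<open>u\<close> leaves that maximum unchanged, so some optimal potential is at least
  \<open>mwm G - mwm (G - u)\<close> at \<open>u\<close>. An optimal potential \<open>\<pi>\<close> turns into the vertex cover
  \<open>{v\<^sup>i | i \<le> \<pi> v}\<close> of the unfolded graph, which has the size of the unfolded matching; by
  complementary slackness no node on the even side of an alternating path from an unmatched node
  lies in it, hence \<open>\<pi> u\<close> is at most the sum of the \<open>\<rho>(u\<^sup>i)\<close>. Conversely the alternating search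
  from the side of \<open>u\<close> yields, as in Koenig's theorem, an optimal potential whose value at \<open>u\<close> is
  that sum, and its restriction bounds the matchings of \<open>G - u\<close>.

  The running time is linear because each copy enters the queue at most once, each half-edge is
  inspected at most once, and nodes, edges, copies and half-edges number at most \<open>2 W\<close> each.
\<close>

section \<open>Egervary's theorem\<close>

text \<open>Maximality of \<open>M\<close> says nothing directly about augmenting paths in the
  unfolded graph: augmenting along one yields a matching there that need not be the unfolding of any
  matching of \<open>G\<close>. So the absence of such paths is certified by a potential, and
  Egervary's theorem has to come before the analysis of the search.

  The values of \<open>rho\<close> on both sides together are not a minimum cover: if every copy is
  matched, they are all 1 and add up to twice the size of the unfolded matching. Hence they serve as
  a potential on the side of \<open>u\<close> only, while the other side counts the copies whose
  mates are reached; nodes of the other side are treated by exchanging the sides. One run of the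
  search suffices for both because a search step never changes the side.

  Alternating paths are simple, whereas a search follows walks. Bipartiteness closes this gap: when
  a walk returns to a node of the path built so far, it does so at a position where the path can be
  cut.\<close>

definition pmatching :: "('a \<times> 'b) set \<Rightarrow> bool" where
  "pmatching M \<longleftrightarrow> inj_on fst M \<and> inj_on snd M"

definition pcover :: "('a \<times> 'b) set \<Rightarrow> ('a \<times> 'b \<Rightarrow> nat) \<Rightarrow> ('a \<Rightarrow> nat) \<Rightarrow> ('b \<Rightarrow> nat) \<Rightarrow> bool" where
  "pcover E w c d \<longleftrightarrow> (\<forall>(x, y)\<in>E. w (x, y) \<le> c x + d y)"

lemma pmatching_fst: "pmatching M \<Longrightarrow> (x, y) \<in> M \<Longrightarrow> (x, y') \<in> M \<Longrightarrow> y = y'"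
  by (force simp: pmatching_def inj_on_def)

lemma pmatching_snd: "pmatching M \<Longrightarrow> (x, y) \<in> M \<Longrightarrow> (x', y) \<in> M \<Longrightarrow> x = x'"
  by (force simp: pmatching_def inj_on_def)

lemma pmatchingI:
  assumes "\<And>x y y'. (x, y) \<in> M \<Longrightarrow> (x, y') \<in> M \<Longrightarrow> y = y'"
    and "\<And>x x' y. (x, y) \<in> M \<Longrightarrow> (x', y) \<in> M \<Longrightarrow> x = x'"
  shows "pmatching M"
  using assms by (auto simp: pmatching_def inj_on_def)

lemma pmatching_subset: "pmatching M \<Longrightarrow> N \<subseteq> M \<Longrightarrow> pmatching N"
  by (auto simp: pmatching_def intro: inj_on_subset)

lemma pmatching_sum:
  "pmatching M \<Longrightarrow> (\<Sum>(x, y)\<in>M. c x + d y) = sum c (fst ` M) + sum d (snd ` M)"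
  by (simp add: pmatching_def sum.reindex sum.distrib case_prod_beta)

lemma weak_duality:
  assumes "finite E" "M \<subseteq> E" "pmatching M" "pcover E w c d"
  shows "sum w M \<le> sum c (fst ` M) + sum d (snd ` M)"
proof -
  have "sum w M \<le> (\<Sum>(x, y)\<in>M. c x + d y)"
    using assms by (intro sum_mono) (auto simp: pcover_def)
  then show ?thesis using assms(3) by (simp add: pmatching_sum)
qed

text \<open>The left ends of the path that leaves \<open>u\<close> by its \<open>M2\<close> edge and
  then uses edges of \<open>M1\<close> and \<open>M2\<close> in turn.\<close>

inductive_set swap_set for M1 M2 u where
  start: "u \<in> swap_set M1 M2 u"
| step: "x \<in> swap_set M1 M2 u \<Longrightarrow> (x, y) \<in> M2 \<Longrightarrow> (x', y) \<in> M1 \<Longrightarrow> x' \<in> swap_set M1 M2 u"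

text \<open>Exchanging the two matchings on the component of \<open>u\<close> in
  \<open>M1 \<union> M2\<close> produces a matching \<open>N2\<close> that still weighs
  \<open>K\<close> but misses \<open>u\<close> as well as \<open>v\<close>. The edge between them
  can be added to it, so its weight must be zero.\<close>

lemma exchange:
  fixes w :: "'a \<times> 'b \<Rightarrow> nat"
  assumes fin: "finite E"
    and M1: "M1 \<subseteq> E" "pmatching M1" "sum w M1 = K" "u \<notin> fst ` M1"
    and M2: "M2 \<subseteq> E" "pmatching M2" "sum w M2 = K" "v \<notin> snd ` M2"
    and max: "\<And>M. M \<subseteq> E \<Longrightarrow> pmatching M \<Longrightarrow> sum w M \<le> K"
    and uv: "(u, v) \<in> E"
  shows "w (u, v) = 0"
proof -
  define R where "R = swap_set M1 M2 u"
  define N1 where "N1 = {p\<in>M2. fst p \<in> R} \<union> {p\<in>M1. fst p \<notin> R}"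
  define N2 where "N2 = {p\<in>M1. fst p \<in> R} \<union> {p\<in>M2. fst p \<notin> R}"
  have finM: "finite M1" "finite M2" using fin M1 M2 finite_subset by blast+
  have uR: "u \<in> R" by (simp add: R_def swap_set.start)
  have closed: "x' \<in> R" if "x \<in> R" "(x, y) \<in> M2" "(x', y) \<in> M1" for x x' y
    using that unfolding R_def by (rule swap_set.step)
  \<comment> \<open>As \<open>M1\<close> misses \<open>u\<close>, a node of \<open>R\<close> with an
    \<open>M1\<close> edge was entered through that edge; hence the right end of every
    \<open>M1\<close> edge at \<open>R\<close> also has an \<open>M2\<close> edge from
    \<open>R\<close>.\<close>
  have prev: "\<exists>x\<in>R. (x, y) \<in> M2" if "x' \<in> R" "(x', y) \<in> M1" for x' y
    using that(1)[unfolded R_def]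
  proof cases
    case start
    then show ?thesis using that M1(4) by force
  next
    case (step x y')
    then show ?thesis using pmatching_fst[OF M1(2) that(2)] by (auto simp: R_def)
  qed
  note unique = pmatching_fst[OF M1(2)] pmatching_fst[OF M2(2)]
    pmatching_snd[OF M1(2)] pmatching_snd[OF M2(2)]
  have "pmatching N1"
  proof (rule pmatchingI)
    show "y = y'" if "(x, y) \<in> N1" "(x, y') \<in> N1" for x y y'
      using that unique(1,2)[of x y y'] by (auto simp: N1_def)
    show "x = x'" if "(x, y) \<in> N1" "(x', y) \<in> N1" for x x' y
      using that unique(3,4)[of x y x'] closed[of x y x'] closed[of x' y x] by (auto simp: N1_def)
  qed
  moreover have N2: "pmatching N2"
  proof (rule pmatchingI)
    show "y = y'" if "(x, y) \<in> N2" "(x, y') \<in> N2" for x y y'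
      using that unique(1,2)[of x y y'] by (auto simp: N2_def)
    have *: "x \<in> R" if "x' \<in> R" "(x', y) \<in> M1" "(x, y) \<in> M2" for x x' y
      using prev[OF that(1,2)] unique(4)[OF _ that(3)] by auto
    show "x = x'" if "(x, y) \<in> N2" "(x', y) \<in> N2" for x x' y
      using that unique(3,4)[of x y x'] *[of x y x'] *[of x' y x] by (auto simp: N2_def)
  qed
  moreover have sub: "N1 \<subseteq> E" "N2 \<subseteq> E" using M1 M2 by (auto simp: N1_def N2_def)
  moreover have "sum w N1 + sum w N2 = sum w M1 + sum w M2"
  proof -
    have split: "sum w M = sum w {p\<in>M. fst p \<in> R} + sum w {p\<in>M. fst p \<notin> R}" if "finite M" for M
      using that by (subst sum.union_disjoint[symmetric]) (auto intro!: sum.cong)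
    have "sum w N1 = sum w {p\<in>M2. fst p \<in> R} + sum w {p\<in>M1. fst p \<notin> R}"
      unfolding N1_def using finM by (subst sum.union_disjoint) auto
    moreover have "sum w N2 = sum w {p\<in>M1. fst p \<in> R} + sum w {p\<in>M2. fst p \<notin> R}"
      unfolding N2_def using finM by (subst sum.union_disjoint) auto
    ultimately show ?thesis using split[OF finM(1)] split[OF finM(2)] by linarith
  qed
  \<comment> \<open>\<open>N1\<close> weighs at most \<open>K\<close>, so at least \<open>K\<close>
    of the common total \<open>2 * K\<close> is left for \<open>N2\<close>.\<close>
  ultimately have K: "sum w N2 \<ge> K" using max[of N1] M1(3) M2(3) by simp
  have u: "u \<notin> fst ` N2" using M1(4) uR by (auto simp: N2_def)
  \<comment> \<open>An edge of \<open>N2\<close> at \<open>v\<close> would come from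
    \<open>M1\<close> and start in \<open>R\<close>; by \<open>prev\<close>, \<open>M2\<close> would
    then meet \<open>v\<close> too.\<close>
  have v: "v \<notin> snd ` N2" using M2(4) prev[of _ v] by (fastforce simp: N2_def image_iff)
  have "pmatching (insert (u, v) N2)"
    using N2 u v by (auto simp: pmatching_def image_iff)
  then have "sum w (insert (u, v) N2) \<le> K" using uv sub by (intro max) auto
  moreover have "finite N2" using sub fin finite_subset by blast
  moreover have "(u, v) \<notin> N2" using u by force
  ultimately show ?thesis using K by simp
qed

text \<open>Induction on the total weight. For an edge \<open>(u, v)\<close> of positive weight,
  \<open>exchange\<close> forbids that one matching of weight \<open>K\<close> avoids
  \<open>u\<close> and another avoids \<open>v\<close>, so one of the two ends is met by all of
  them. Lowering the weights at that end by 1 lowers the bound by 1, and raising the potential of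
  that end by 1 makes up for it. As \<open>K\<close> is only an upper bound, it need not be shown to
  be attained for the lowered weights.\<close>

lemma egervary:
  fixes w :: "'a \<times> 'b \<Rightarrow> nat"
  assumes fin: "finite E" and max: "\<And>M. M \<subseteq> E \<Longrightarrow> pmatching M \<Longrightarrow> sum w M \<le> K"
  shows "\<exists>c d. pcover E w c d \<and> sum c (fst ` E) + sum d (snd ` E) \<le> K"
  using max
proof (induction "sum w E" arbitrary: w K rule: less_induct)
  case less
  show ?case
  proof (cases "\<exists>p\<in>E. w p > 0")
    case False
    then show ?thesis by (intro exI[of _ "\<lambda>_. 0"]) (auto simp: pcover_def)
  next
    case True
    then obtain u v where uv: "(u, v) \<in> E" "w (u, v) > 0" by auto
    have K: "K > 0" using less.prems[of "{(u, v)}"] uv by (auto simp: pmatching_def)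
    \<comment> \<open>Truncation keeps edges of weight 0 at 0. So a matching gets lighter only if it
      has an edge of positive weight at the chosen end, which is why positivity is part of the case
      distinction below.\<close>
    define lower where "lower A p = w p - (if A p then 1 else 0)" for A :: "'a \<times> 'b \<Rightarrow> bool" and p
    have smaller: "sum (lower A) E < sum w E" if "A (u, v)" for A
      using fin uv that by (intro sum_strict_mono_ex1) (auto simp: lower_def intro!: bexI[of _ "(u, v)"])
    \<comment> \<open>A matching of weight \<open>K\<close> loses at least 1 by assumption; any
      other one weighs at most \<open>K - 1\<close> already.\<close>
    have lower_max: "sum (lower A) M \<le> K - 1"
      if "\<And>M. M \<subseteq> E \<Longrightarrow> pmatching M \<Longrightarrow> sum w M = K \<Longrightarrow> \<exists>p\<in>M. w p > 0 \<and> A p"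
        and "M \<subseteq> E" "pmatching M" for A M
    proof (cases "sum w M = K")
      case True
      with that obtain p where p: "p \<in> M" "w p > 0" "A p" by blast
      have "sum (lower A) M < sum w M"
        using p finite_subset[OF that(2) fin]
        by (intro sum_strict_mono_ex1) (auto simp: lower_def intro!: bexI[of _ p])
      with True show ?thesis by simp
    next
      case False
      have "sum (lower A) M \<le> sum w M" by (intro sum_mono) (simp add: lower_def)
      with less.prems[of M] that False show ?thesis by simp
    qed
    consider
        (left) "\<And>M. M \<subseteq> E \<Longrightarrow> pmatching M \<Longrightarrow> sum w M = K \<Longrightarrow> \<exists>p\<in>M. w p > 0 \<and> fst p = u"
      | (right) "\<And>M. M \<subseteq> E \<Longrightarrow> pmatching M \<Longrightarrow> sum w M = K \<Longrightarrow> \<exists>p\<in>M. w p > 0 \<and> snd p = v"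
    proof (rule ccontr)
      assume "\<not> thesis"
      then obtain M1 M2 where
          M1: "M1 \<subseteq> E" "pmatching M1" "sum w M1 = K" "\<not> (\<exists>p\<in>M1. w p > 0 \<and> fst p = u)"
        and M2: "M2 \<subseteq> E" "pmatching M2" "sum w M2 = K" "\<not> (\<exists>p\<in>M2. w p > 0 \<and> snd p = v)"
        using left right by metis
      \<comment> \<open>Dropping the edges of weight 0 keeps the weight and turns "no positive edge
        at this node" into "no edge at this node", as \<open>exchange\<close> demands.\<close>
      have pos: "sum w {p\<in>M. w p > 0} = sum w M" if "M \<subseteq> E" for M
        using finite_subset[OF that fin] by (intro sum.mono_neutral_left) auto
      have "w (u, v) = 0"
      proof (rule exchange[OF fin _ _ _ _ _ _ _ _ less.prems uv(1),
            where ?M1.0 = "{p\<in>M1. w p > 0}" and ?M2.0 = "{p\<in>M2. w p > 0}"])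
      qed (use M1 M2 pos in \<open>auto intro: pmatching_subset\<close>)
      with uv show False by simp
    qed
    then show ?thesis
    proof cases
      case left
      obtain c d where cd: "pcover E (lower (\<lambda>p. fst p = u)) c d"
          "sum c (fst ` E) + sum d (snd ` E) \<le> K - 1"
        using less.hyps[OF smaller[of "\<lambda>p. fst p = u"] lower_max[of "\<lambda>p. fst p = u"]] left by auto
      have "sum (c(u := c u + 1)) (fst ` E) = sum (\<lambda>x. c x + (if x = u then 1 else 0)) (fst ` E)"
        by (intro sum.cong) auto
      also have "\<dots> = sum c (fst ` E) + 1"
        using fin uv(1) by (force simp: sum.distrib)
      finally have "sum (c(u := c u + 1)) (fst ` E) = sum c (fst ` E) + 1" .
      moreover have "pcover E w (c(u := c u + 1)) d"
        using cd(1) by (fastforce simp: pcover_def lower_def)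
      ultimately show ?thesis using cd(2) K by (intro exI[of _ "c(u := c u + 1)"] exI[of _ d]) simp
    next
      case right
      obtain c d where cd: "pcover E (lower (\<lambda>p. snd p = v)) c d"
          "sum c (fst ` E) + sum d (snd ` E) \<le> K - 1"
        using less.hyps[OF smaller[of "\<lambda>p. snd p = v"] lower_max[of "\<lambda>p. snd p = v"]] right by auto
      have "sum (d(v := d v + 1)) (snd ` E) = sum (\<lambda>x. d x + (if x = v then 1 else 0)) (snd ` E)"
        by (intro sum.cong) auto
      also have "\<dots> = sum d (snd ` E) + 1"
        using fin uv(1) by (force simp: sum.distrib)
      finally have "sum (d(v := d v + 1)) (snd ` E) = sum d (snd ` E) + 1" .
      moreover have "pcover E w c (d(v := d v + 1))"
        using cd(1) by (fastforce simp: pcover_def lower_def)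
      ultimately show ?thesis using cd(2) K by (intro exI[of _ c] exI[of _ "d(v := d v + 1)"]) simp
    qed
  qed
qed

text \<open>Egervary's theorem for the graph with an additional pendant edge of weight \<open>k\<close> at \<open>u\<close>: its
  maximum matching weight is still \<open>K\<close>, so the pendant node has potential 0.\<close>

lemma egervary_cavity:
  fixes w :: "'a \<times> 'b \<Rightarrow> nat"
  assumes fin: "finite E" and max: "\<And>M. M \<subseteq> E \<Longrightarrow> pmatching M \<Longrightarrow> sum w M \<le> K"
    and cav: "\<And>M. M \<subseteq> E \<Longrightarrow> pmatching M \<Longrightarrow> u \<notin> fst ` M \<Longrightarrow> sum w M + k \<le> K"
    and M0: "M0 \<subseteq> E" "pmatching M0" "sum w M0 = K" and u: "u \<in> fst ` E"
  shows "\<exists>c d. pcover E w c d \<and> sum c (fst ` E) + sum d (snd ` E) \<le> K \<and> k \<le> c u"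
proof -
  \<comment> \<open>\<open>Some\<close> embeds the old right nodes, and \<open>None\<close> is the
    far end of the pendant edge.\<close>
  define F where "F = apsnd Some ` E"
  define E' where "E' = insert (u, None) F"
  define w' where "w' = (\<lambda>(x, y). case y of None \<Rightarrow> k | Some y \<Rightarrow> w (x, y))"
  have w'_Some: "sum w' (apsnd Some ` A) = sum w A" for A
    by (subst sum.reindex) (auto simp: inj_on_def w'_def intro!: sum.cong)
  have max': "sum w' M \<le> K" if M: "M \<subseteq> E'" "pmatching M" for M
  proof -
    define A where "A = apsnd Some -` M"
    have AE: "A \<subseteq> E" using M(1) by (auto simp: A_def E'_def F_def apsnd_def map_prod_def)
    have A: "pmatching A"
      by (rule pmatchingI) (auto simp: A_def dest: pmatching_fst[OF M(2)] pmatching_snd[OF M(2)])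
    have "finite A" using AE fin finite_subset by blast
    show ?thesis
    proof (cases "(u, None) \<in> M")
      case True
      have "M = insert (u, None) (apsnd Some ` A)"
        using M(1) True by (auto simp: E'_def F_def A_def image_iff)
      moreover have "(u, None) \<notin> apsnd Some ` A" by auto
      moreover have "u \<notin> fst ` A" using pmatching_fst[OF M(2) True] by (force simp: A_def)
      ultimately show ?thesis
        using cav[OF AE A] w'_Some \<open>finite A\<close> by (simp add: w'_def)
    next
      case False
      then have "M = apsnd Some ` A" using M(1) by (auto simp: E'_def F_def A_def image_iff)
      then show ?thesis using max[OF AE A] w'_Some by simp
    qed
  qed
  obtain c d where cd: "pcover E' w' c d" "sum c (fst ` E') + sum d (snd ` E') \<le> K"
    using egervary[of E' w' K] max' fin by (auto simp: E'_def F_def)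
  have fst: "fst ` E' = fst ` E" using u by (auto simp: E'_def F_def image_image)
  have "snd ` E' = insert None (Some ` snd ` E)" by (auto simp: E'_def F_def image_image)
  then have snd: "sum d (snd ` E') = d None + sum (d \<circ> Some) (snd ` E)"
    using fin by (simp add: sum.reindex)
  have cov: "pcover E w c (d \<circ> Some)"
    using cd(1) by (force simp: pcover_def E'_def F_def w'_def)
  \<comment> \<open>\<open>M0\<close> weighs \<open>K\<close> without the pendant edge, so by weak
    duality the old nodes use up the whole value of the cover and nothing remains for
    \<open>None\<close>.\<close>
  have "K \<le> sum c (fst ` M0) + sum (d \<circ> Some) (snd ` M0)"
    using weak_duality[OF fin M0(1,2) cov] M0(3) by simp
  also have "\<dots> \<le> sum c (fst ` E) + sum (d \<circ> Some) (snd ` E)"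
    using fin M0(1) by (intro add_mono sum_mono2) auto
  finally have "d None = 0" using cd(2) fst snd by simp
  moreover have "k \<le> c u + d None" using cd(1) by (auto simp: pcover_def E'_def w'_def)
  ultimately show ?thesis using cov cd(2) fst snd by (intro exI[of _ c] exI[of _ "d \<circ> Some"]) simp
qed


section \<open>Alternating paths and reachability\<close>

text \<open>Reachability by walks in double steps, without any demand of simplicity. If the first
  edge of a double step is itself matched, the second one leads back to \<open>x\<close>, so such a
  step adds nothing.\<close>

inductive reach :: "('a, 'b) graph_scheme \<Rightarrow> 'a set set \<Rightarrow> 'a \<Rightarrow> bool" for H N where
  unmatched: "x \<in> verts H \<Longrightarrow> \<not> matched_by N x \<Longrightarrow> reach H N x"
| step: "reach H N x \<Longrightarrow> {x, y} \<in> edges H \<Longrightarrow> {y, z} \<in> N \<Longrightarrow> reach H N z"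

text \<open>The lists grow at the head and end in the unmatched node, so that the head is the node
  whose \<open>rho\<close> is in question.\<close>

inductive alt_list :: "('a, 'b) graph_scheme \<Rightarrow> 'a set set \<Rightarrow> 'a list \<Rightarrow> bool" for H N where
  single: "x \<in> verts H \<Longrightarrow> \<not> matched_by N x \<Longrightarrow> alt_list H N [x]"
| extend: "alt_list H N p \<Longrightarrow> {y, hd p} \<in> edges H \<Longrightarrow> {z, y} \<in> N \<Longrightarrow> z \<notin> set p \<Longrightarrow> y \<notin> set p \<Longrightarrow>
    alt_list H N (z # y # p)"

locale bicoloured =
  fixes H :: "('a, 'b) graph_scheme" and N :: "'a set set" and col :: "'a \<Rightarrow> bool"
  assumes N_edges: "N \<subseteq> edges H"
    and edges_verts: "e \<in> edges H \<Longrightarrow> e \<subseteq> verts H"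
    and N_unique: "{x, y} \<in> N \<Longrightarrow> {x, z} \<in> N \<Longrightarrow> y = z"
    and col: "{x, y} \<in> edges H \<Longrightarrow> col x \<noteq> col y"
begin

lemma alt_list_props:
  assumes "alt_list H N p"
  shows "p \<noteq> [] \<and> odd (length p) \<and> distinct p \<and> set p \<subseteq> verts H \<and> \<not> matched_by N (last p) \<and>
    (\<forall>i. i + 1 < length p \<longrightarrow> {p ! i, p ! (i + 1)} \<in> edges H \<and> ({p ! i, p ! (i + 1)} \<in> N \<longleftrightarrow> even i))"
  using assms
proof induction
  case (extend p y z)
  have zy: "{z, y} \<in> edges H" using extend N_edges by blast
  have ne: "z \<noteq> y" using col[OF zy] by blast
  have hd: "p \<noteq> []" "p ! 0 = hd p" "hd p \<in> set p" using extend.IH by (auto simp: hd_conv_nth)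
  have notN: "{y, hd p} \<notin> N"
    using N_unique[of y "hd p" z] extend.hyps hd by (metis insert_commute)
  have "{(z # y # p) ! i, (z # y # p) ! (i + 1)} \<in> edges H \<and>
      ({(z # y # p) ! i, (z # y # p) ! (i + 1)} \<in> N \<longleftrightarrow> even i)"
    if "i + 1 < length (z # y # p)" for i
  proof -
    consider "i = 0" | "i = 1" | i' where "i = Suc (Suc i')" by (metis One_nat_def not0_implies_Suc)
    then show ?thesis
      using that zy notN hd extend by cases auto
  qed
  then show ?case using extend ne hd edges_verts[OF zy] by auto
qed simp

lemma alt_list_alternating:
  assumes "alt_list H N p"
  shows "alternating_path H N p \<and> even (path_length p)"
proof -
  note props = alt_list_props[OF assms]
  have "length p \<ge> 2 \<and> {p ! 0, p ! 1} \<in> N" if "matched_by N (hd p)"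
  proof -
    have "length p \<noteq> 1" using that props by (auto simp: length_Suc_conv)
    moreover have "length p \<noteq> 0" using props by simp
    ultimately have "length p \<ge> 2" by linarith
    with props show ?thesis by auto
  qed
  moreover have "even (path_length p)" using props by (simp add: path_length_def)
  moreover have "{p ! i, p ! (i + 1)} \<in> N \<longleftrightarrow> {p ! (i + 1), p ! (i + 2)} \<notin> N" if "i + 2 < length p" for i
  proof -
    have "\<And>i. i + 1 < length p \<Longrightarrow> {p ! i, p ! (i + 1)} \<in> N \<longleftrightarrow> even i" using props by blast
    from this[of i] this[of "i + 1"] that show ?thesis by simp
  qed
  ultimately show ?thesis using props by (simp add: alternating_path_def graph_path_def)
qed

text \<open>Colours alternate along the list, so a node with the colour of the head is at an even
  position, and the rest of the list from there is again of this form.\<close>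

lemma alt_list_suffix:
  "alt_list H N p \<Longrightarrow> x \<in> set p \<Longrightarrow> col x = col (hd p) \<Longrightarrow> \<exists>q. alt_list H N q \<and> hd q = x"
proof (induction rule: alt_list.induct)
  case (single z)
  then show ?case by (intro exI[of _ "[z]"]) (auto intro: alt_list.single)
next
  case (extend p y z)
  have *: "col y \<noteq> col (hd p)" "col y \<noteq> col z"
    using col extend.hyps N_edges by blast+
  show ?case
  proof (cases "x = z")
    case True
    then show ?thesis using alt_list.extend[OF extend.hyps] by (metis list.sel(1))
  qed (use extend * in auto)
qed

text \<open>A node coloured unlike the head is at an odd position, where its predecessor is its
  mate.\<close>

lemma alt_list_mate:
  "alt_list H N p \<Longrightarrow> y \<in> set p \<Longrightarrow> col y \<noteq> col (hd p) \<Longrightarrow> {z, y} \<in> N \<Longrightarrow> z \<in> set p"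
proof (induction rule: alt_list.induct)
  case (extend p y' z')
  have *: "col y' \<noteq> col (hd p)" "col y' \<noteq> col z'"
    using col extend.hyps N_edges by blast+
  show ?case
  proof (cases "y = y'")
    case True
    then show ?thesis using N_unique[of y z z'] extend by (simp add: insert_commute)
  qed (use extend * in auto)
qed auto

text \<open>A walk is made simple step by step. If \<open>z\<close> is already on the list, it has
  the colour of the head and the list can be cut there; otherwise \<open>y\<close> is not on the
  list either, since its mate \<open>z\<close> would be. This is where bipartiteness matters: with
  odd cycles the cut could be at the wrong parity.\<close>

lemma reach_alt_list:
  "reach H N x \<Longrightarrow> \<exists>p. alt_list H N p \<and> hd p = x"
proof (induction rule: reach.induct)
  case (unmatched x)
  then show ?case by (intro exI[of _ "[x]"]) (auto intro: alt_list.single)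
next
  case (step x y z)
  then obtain p where p: "alt_list H N p" "hd p = x" by blast
  have colours: "col x \<noteq> col y" "col y \<noteq> col z" using col step.hyps N_edges by blast+
  show ?case
  proof (cases "z \<in> set p")
    case True
    then show ?thesis using alt_list_suffix[OF p(1)] colours p(2) by blast
  next
    case False
    then have "y \<notin> set p"
      using alt_list_mate[OF p(1), of y z] colours p(2) step.hyps by (auto simp: insert_commute)
    then have "alt_list H N (z # y # p)"
      using False p step.hyps by (intro alt_list.extend) (auto simp: insert_commute)
    then show ?thesis by (metis list.sel(1))
  qed
qed

text \<open>The path is traversed backwards: its far end is unmatched, and every two edges form one
  step of \<open>reach\<close>.\<close>

lemma alternating_reach:
  assumes p: "alternating_path H N p" and even: "even (path_length p)"
  shows "reach H N (hd p)"
proof (cases "matched_by N (hd p)")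
  case False
  then show ?thesis using p by (auto intro!: reach.unmatched simp: alternating_path_def graph_path_def)
next
  case True
  define m where "m = path_length p div 2"
  have first: "length p \<ge> 2" "{p ! 0, p ! 1} \<in> N" using p True by (auto simp: alternating_path_def)
  have len: "length p = 2 * m + 1" using even first(1) by (auto simp: m_def path_length_def elim!: evenE)
  have edge: "{p ! i, p ! (i + 1)} \<in> edges H" if "i + 1 < length p" for i
    using p that by (auto simp: alternating_path_def graph_path_def)
  have N: "{p ! i, p ! (i + 1)} \<in> N \<longleftrightarrow> even i" if "i + 1 < length p" for i
    using that
  proof (induction i)
    case (Suc i)
    have "i + 2 < length p" using Suc.prems by simp
    then have "{p ! i, p ! (i + 1)} \<in> N \<longleftrightarrow> {p ! (i + 1), p ! (i + 2)} \<notin> N"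
      using p unfolding alternating_path_def by blast
    with Suc show ?case by simp
  qed (use first in simp)
  \<comment> \<open>Matched edges have even indices, but the last edge of a path of even length has
    the odd index \<open>length p - 2\<close>.\<close>
  have "\<not> matched_by N (last p)"
  proof
    assume "matched_by N (last p)"
    then have "{p ! (length p - 2), p ! (length p - 1)} \<in> N"
      using p by (simp add: alternating_path_def)
    moreover have "length p - 1 = length p - 2 + 1" using first(1) by simp
    ultimately have "{p ! (length p - 2), p ! (length p - 2 + 1)} \<in> N" by metis
    then have "even (length p - 2)" using N[of "length p - 2"] first(1) by simp
    then show False using len first(1) by simp
  qed
  then have last: "reach H N (p ! (2 * m))"
    using p len by (intro reach.unmatched)
      (auto simp: alternating_path_def graph_path_def last_conv_nth)
  have "reach H N (p ! (2 * (m - k)))" if "k \<le> m" for k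
    using that
  proof (induction k)
    case 0
    then show ?case using last by simp
  next
    case (Suc k)
    define i where "i = 2 * (m - Suc k)"
    have i: "2 * (m - k) = i + 2" "i + 2 < length p" "even i" using Suc.prems len by (auto simp: i_def)
    have "reach H N (p ! (i + 2))" using Suc i by simp
    moreover have "{p ! (i + 2), p ! (i + 1)} \<in> edges H"
      using edge[of "i + 1"] i by (simp add: insert_commute)
    moreover have "{p ! (i + 1), p ! i} \<in> N" using N[of i] i by (simp add: insert_commute)
    ultimately show ?case unfolding i_def[symmetric] by (rule reach.step)
  qed
  from this[of m] show ?thesis using p by (simp add: alternating_path_def graph_path_def hd_conv_nth)
qed

lemma reach_iff_alternating:
  "(\<exists>p. alternating_path H N p \<and> hd p = x \<and> even (path_length p)) \<longleftrightarrow> reach H N x"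
  using alternating_reach alt_list_alternating reach_alt_list by metis

end


section \<open>Unfolding\<close>

text \<open>The symmetric condition on \<open>i + j\<close> removes both the truncated subtraction
  and the orientation of the edge \<open>{u, v}\<close>.\<close>

lemma unfold_edges_iff:
  "{(u, i), (v, j)} \<in> unfold_edges G F \<longleftrightarrow>
    {u, v} \<in> F \<and> 1 \<le> i \<and> 1 \<le> j \<and> i + j = weight G {u, v} + 1"
proof
  assume "{(u, i), (v, j)} \<in> unfold_edges G F"
  then obtain u' v' i' where "{(u, i), (v, j)} = {(u', i'), (v', weight G {u', v'} + 1 - i')}"
      "{u', v'} \<in> F" "1 \<le> i'" "i' \<le> weight G {u', v'}"
    unfolding unfold_edges_def by blast
  then show "{u, v} \<in> F \<and> 1 \<le> i \<and> 1 \<le> j \<and> i + j = weight G {u, v} + 1"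
    by (auto simp: doubleton_eq_iff insert_commute)
next
  assume *: "{u, v} \<in> F \<and> 1 \<le> i \<and> 1 \<le> j \<and> i + j = weight G {u, v} + 1"
  then have "j = weight G {u, v} + 1 - i" "i \<le> weight G {u, v}" by auto
  with * show "{(u, i), (v, j)} \<in> unfold_edges G F" unfolding unfold_edges_def by blast
qed

lemma unfold_edgesE:
  assumes "e \<in> unfold_edges G F"
  obtains u i v j where "e = {(u, i), (v, j)}" "{u, v} \<in> F" "1 \<le> i" "1 \<le> j" "i + j = weight G {u, v} + 1"
proof -
  obtain u v i where "e = {(u, i), (v, weight G {u, v} + 1 - i)}" "{u, v} \<in> F" "1 \<le> i" "i \<le> weight G {u, v}"
    using assms unfolding unfold_edges_def by blast
  then show ?thesis by (intro that[of u i v "weight G {u, v} + 1 - i"]) auto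
qed

lemma mwm_ge:
  assumes "finite (edges G)" "matching G M"
  shows "sum (weight G) M \<le> mwm G"
proof -
  have "{sum (weight G) M | M. matching G M} \<subseteq> sum (weight G) ` Pow (edges G)"
    by (auto simp: matching_def)
  then have "finite {sum (weight G) M | M. matching G M}"
    using assms(1) by (elim finite_subset) simp
  then show ?thesis unfolding mwm_def using assms(2) by (intro Max_ge) auto
qed

lemma mwm_attained:
  assumes "finite (edges G)"
  shows "\<exists>M. matching G M \<and> sum (weight G) M = mwm G"
proof -
  have "{sum (weight G) M | M. matching G M} \<subseteq> sum (weight G) ` Pow (edges G)"
    by (auto simp: matching_def)
  then have "finite {sum (weight G) M | M. matching G M}"
    using assms(1) by (elim finite_subset) simp
  moreover have "matching G {}" by (simp add: matching_def)
  then have "{sum (weight G) M | M. matching G M} \<noteq> {}" by blast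
  ultimately have "mwm G \<in> {sum (weight G) M | M. matching G M}"
    unfolding mwm_def by (rule Max_in)
  then show ?thesis by auto
qed

lemma matching_delete_vertex:
  "matching (delete_vertex G u) M \<longleftrightarrow> matching G M \<and> (\<forall>e\<in>M. u \<notin> e)"
  by (auto simp: matching_def delete_vertex_def)

section \<open>A bipartite graph with a maximum weight matching, and its potentials\<close>

locale bipartite_matching =
  fixes G :: "'a wgraph" and M :: "'a set set" and X Y :: "'a set"
  assumes finite_verts: "finite (verts G)"
    and verts: "verts G = X \<union> Y" and disjoint: "X \<inter> Y = {}"
    and bip: "e \<in> edges G \<Longrightarrow> \<exists>x\<in>X. \<exists>y\<in>Y. e = {x, y}"
    and pos: "positive_weights G" and no_iso: "no_isolated G"
    and mw: "max_weight_matching G M"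
begin

abbreviation H where "H \<equiv> unfolded G"
abbreviation N where "N \<equiv> unfold_edges G M"

text \<open>The two inequalities for cavities are proved for nodes of \<open>X\<close> only. Since
  \<open>rho\<close>, \<open>heaviest\<close> and \<open>mwm\<close> do not mention the sides, this
  transfers them to \<open>Y\<close> unchanged.\<close>

lemma swap: "bipartite_matching G M Y X"
proof
  show "\<exists>x\<in>Y. \<exists>y\<in>X. e = {x, y}" if "e \<in> edges G" for e
    using bip[OF that] by (auto simp: insert_commute)
qed (use finite_verts verts disjoint pos no_iso mw in auto)

lemma M_edges: "M \<subseteq> edges G" and matching: "matching G M" and sum_M: "sum (weight G) M = mwm G"
  using mw by (auto simp: max_weight_matching_def matching_def)

lemma edge_verts: "{u, v} \<in> edges G \<Longrightarrow> u \<in> verts G \<and> v \<in> verts G"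
  using bip verts by (metis UnI1 UnI2 insert_commute doubleton_eq_iff)

lemma edge_sides: "{u, v} \<in> edges G \<Longrightarrow> u \<in> X \<longleftrightarrow> v \<notin> X"
  using bip disjoint by (metis disjoint_iff doubleton_eq_iff)

lemma edge_XY: "e \<in> edges G \<Longrightarrow> \<exists>x y. x \<in> X \<and> y \<in> Y \<and> e = {x, y}"
  using bip by blast

lemma ex_edge: "u \<in> X \<or> u \<in> Y \<Longrightarrow> \<exists>e\<in>edges G. u \<in> e"
  using no_iso verts by (auto simp: no_isolated_def)

lemma finite_edges: "finite (edges G)"
proof (rule finite_subset)
  show "edges G \<subseteq> Pow (verts G)" using bip verts by fastforce
qed (use finite_verts in simp)

lemma M_unique: "{u, v} \<in> M \<Longrightarrow> {u, v'} \<in> M \<Longrightarrow> v = v'"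
  using matching by (fastforce simp: matching_def doubleton_eq_iff)

lemma M_mate:
  assumes "u \<in> \<Union>M"
  obtains v where "{u, v} \<in> M"
proof -
  obtain e where e: "e \<in> M" "u \<in> e" using assms by blast
  then obtain x y where "e = {x, y}" using M_edges edge_XY by blast
  with e have "{u, x} \<in> M \<or> {u, y} \<in> M" by (auto simp: insert_commute)
  then show ?thesis using that by blast
qed

lemma heaviest_ge: "e \<in> edges G \<Longrightarrow> u \<in> e \<Longrightarrow> weight G e \<le> heaviest G u"
  unfolding heaviest_def using finite_edges by (intro Max_ge) auto

lemma edges_H: "edges H = unfold_edges G (edges G)"
  and verts_H: "(u, i) \<in> verts H \<longleftrightarrow> u \<in> verts G \<and> 1 \<le> i \<and> i \<le> heaviest G u"
  by (auto simp: unfolded_def)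

lemma N_matched: "matched_by N (u, i) \<longleftrightarrow> (\<exists>v. {u, v} \<in> M \<and> 1 \<le> i \<and> i \<le> weight G {u, v})"
proof
  assume "matched_by N (u, i)"
  then obtain e where "e \<in> N" "(u, i) \<in> e" by (auto simp: matched_by_def)
  then show "\<exists>v. {u, v} \<in> M \<and> 1 \<le> i \<and> i \<le> weight G {u, v}"
    by (elim unfold_edgesE) (fastforce simp: insert_commute)
next
  assume "\<exists>v. {u, v} \<in> M \<and> 1 \<le> i \<and> i \<le> weight G {u, v}"
  then obtain v where "{u, v} \<in> M" "1 \<le> i" "i \<le> weight G {u, v}" by blast
  then have "{(u, i), (v, weight G {u, v} + 1 - i)} \<in> N" by (simp add: unfold_edges_iff)
  then show "matched_by N (u, i)" unfolding matched_by_def by blast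
qed

sublocale bicoloured H N "\<lambda>(u, i). u \<in> X"
proof
  show "N \<subseteq> edges H" using M_edges by (auto simp: edges_H unfold_edges_def)
next
  fix e assume "e \<in> edges H"
  then obtain u i v j where e: "e = {(u, i), (v, j)}" "{u, v} \<in> edges G" "1 \<le> i" "1 \<le> j" "i + j = weight G {u, v} + 1"
    unfolding edges_H by (rule unfold_edgesE)
  then show "e \<subseteq> verts H"
    using edge_verts[OF e(2)] heaviest_ge[OF e(2), of u] heaviest_ge[OF e(2), of v]
    by (auto simp: verts_H)
next
  fix x y z assume "{x, y} \<in> N" "{x, z} \<in> N"
  then show "y = z"
    by (cases x; cases y; cases z) (auto simp: unfold_edges_iff dest: M_unique)
next
  fix x y assume "{x, y} \<in> edges H"
  then show "(case x of (u, i) \<Rightarrow> u \<in> X) \<noteq> (case y of (u, i) \<Rightarrow> u \<in> X)"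
    by (cases x; cases y) (auto simp: edges_H unfold_edges_iff dest: edge_sides)
qed

lemma rho_reach: "rho G M x = (if reach H N x then 0 else 1)"
  unfolding rho_def reach_iff_alternating ..

text \<open>Dual feasibility together with complementary slackness with respect to
  \<open>M\<close>.\<close>

definition potential :: "('a \<Rightarrow> nat) \<Rightarrow> bool" where
  "potential \<pi> \<longleftrightarrow>
    (\<forall>u v. {u, v} \<in> edges G \<longrightarrow> weight G {u, v} \<le> \<pi> u + \<pi> v) \<and>
    (\<forall>u v. {u, v} \<in> M \<longrightarrow> weight G {u, v} = \<pi> u + \<pi> v) \<and>
    (\<forall>u\<in>verts G. u \<notin> \<Union>M \<longrightarrow> \<pi> u = 0)"

lemma potential_unmatched:
  assumes \<pi>: "potential \<pi>" and "u \<in> verts G" "1 \<le> i" "\<not> matched_by N (u, i)"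
  shows "\<pi> u < i"
proof (cases "u \<in> \<Union>M")
  case True
  then obtain v where v: "{u, v} \<in> M" by (rule M_mate)
  then have "weight G {u, v} = \<pi> u + \<pi> v" using \<pi> by (auto simp: potential_def)
  then show ?thesis using assms(3,4) v unfolding N_matched by force
qed (use assms in \<open>auto simp: potential_def\<close>)

text \<open>Call a copy covered if its index is at most the potential of its node. An unmatched copy
  is not covered; a neighbour of an uncovered copy is covered, by feasibility; and the mate of a
  covered copy is uncovered, because matched edges are tight and so are covered at exactly one
  end.\<close>

lemma reach_potential:
  assumes \<pi>: "potential \<pi>"
  shows "reach H N x \<Longrightarrow> \<pi> (fst x) < snd x"
proof (induction rule: reach.induct)
  case (unmatched x)
  then show ?case using potential_unmatched[OF \<pi>] by (cases x) (auto simp: verts_H)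
next
  case (step x y z)
  obtain a i b j c k where xyz: "x = (a, i)" "y = (b, j)" "z = (c, k)" by (metis surj_pair)
  have "{a, b} \<in> edges G" "i + j = weight G {a, b} + 1" "{b, c} \<in> M" "j + k = weight G {b, c} + 1" "1 \<le> j" "1 \<le> k"
    using step.hyps by (auto simp: xyz unfold_edges_iff edges_H)
  moreover from this have "weight G {a, b} \<le> \<pi> a + \<pi> b" "weight G {b, c} = \<pi> b + \<pi> c"
    using \<pi> by (auto simp: potential_def)
  ultimately show ?case using step.IH by (simp add: xyz)
qed

section \<open>Edges as ordered pairs, and duality for the given graph\<close>

definition E :: "('a \<times> 'a) set" where
  "E = {(x, y). x \<in> X \<and> y \<in> Y \<and> {x, y} \<in> edges G}"

definition w :: "'a \<times> 'a \<Rightarrow> nat" where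
  "w = (\<lambda>(x, y). weight G {x, y})"

definition pairs :: "'a set set \<Rightarrow> ('a \<times> 'a) set" where
  "pairs F = {(x, y)\<in>E. {x, y} \<in> F}"

lemma finite_X: "finite X" and finite_Y: "finite Y"
  using finite_verts verts by auto

lemma finite_E: "finite E"
  by (rule finite_subset[of _ "X \<times> Y"]) (auto simp: E_def finite_X finite_Y)

lemma inj_E:
  assumes "A \<subseteq> E"
  shows "inj_on (\<lambda>(x, y). {x, y}) A"
proof (rule inj_onI, clarify)
  fix a b c d
  assume "(a, b) \<in> A" "(c, d) \<in> A" and eq: "{a, b} = {c, d}"
  then have "a \<in> X" "b \<in> Y" "c \<in> X" "d \<in> Y" using assms by (auto simp: E_def)
  then show "a = c \<and> b = d" using eq disjoint by (auto simp: doubleton_eq_iff)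
qed

lemma fst_E: "fst ` E = X" and snd_E: "snd ` E = Y"
proof -
  have "\<exists>y. (x, y) \<in> E" if x: "x \<in> X" for x
  proof -
    obtain e where "e \<in> edges G" "x \<in> e" using ex_edge x by blast
    moreover from this(1) obtain a b where "a \<in> X" "b \<in> Y" "e = {a, b}" using edge_XY by blast
    moreover from calculation x have "x = a" using disjoint by blast
    ultimately have "(x, b) \<in> E" by (simp add: E_def)
    then show ?thesis by blast
  qed
  then show "fst ` E = X" by (force simp: E_def)
  have "\<exists>x. (x, y) \<in> E" if y: "y \<in> Y" for y
  proof -
    obtain e where "e \<in> edges G" "y \<in> e" using ex_edge y by blast
    moreover from this(1) obtain a b where "a \<in> X" "b \<in> Y" "e = {a, b}" using edge_XY by blast
    moreover from calculation y have "y = b" using disjoint by blast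
    ultimately have "(a, y) \<in> E" by (simp add: E_def)
    then show ?thesis by blast
  qed
  then show "snd ` E = Y" by (force simp: E_def)
qed

lemma pairs_matching:
  assumes "matching G F"
  shows "pairs F \<subseteq> E" "pmatching (pairs F)" "sum w (pairs F) = sum (weight G) F"
proof -
  show sub: "pairs F \<subseteq> E" by (auto simp: pairs_def)
  have unique: "v = v'" if "{u, v} \<in> F" "{u, v'} \<in> F" for u v v'
    using assms that by (fastforce simp: matching_def doubleton_eq_iff)
  show "pmatching (pairs F)"
  proof (rule pmatchingI)
    show "x = x'" if "(x, y) \<in> pairs F" "(x', y) \<in> pairs F" for x x' y
      using that unique[of y x x'] by (simp add: pairs_def insert_commute)
  qed (auto simp: pairs_def dest: unique)
  have "F = (\<lambda>(x, y). {x, y}) ` pairs F"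
  proof
    show "F \<subseteq> (\<lambda>(x, y). {x, y}) ` pairs F"
    proof
      fix e assume e: "e \<in> F"
      then have "e \<in> edges G" using assms by (auto simp: matching_def)
      then obtain x y where "x \<in> X" "y \<in> Y" "e = {x, y}" using edge_XY by blast
      then have "(x, y) \<in> pairs F" using e \<open>e \<in> edges G\<close> by (simp add: pairs_def E_def)
      then show "e \<in> (\<lambda>(x, y). {x, y}) ` pairs F" using \<open>e = {x, y}\<close> by force
    qed
  qed (auto simp: pairs_def)
  then have "sum (weight G) F = sum (weight G) ((\<lambda>(x, y). {x, y}) ` pairs F)" by simp
  also have "\<dots> = sum w (pairs F)"
    using inj_E[OF sub] by (subst sum.reindex) (auto simp: w_def intro!: sum.cong)
  finally show "sum w (pairs F) = sum (weight G) F" ..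
qed

lemma matching_of_pairs:
  assumes "P \<subseteq> E" "pmatching P"
  shows "matching G ((\<lambda>(x, y). {x, y}) ` P)" "sum (weight G) ((\<lambda>(x, y). {x, y}) ` P) = sum w P"
proof -
  show "matching G ((\<lambda>(x, y). {x, y}) ` P)"
    unfolding matching_def
  proof (intro conjI ballI impI)
    show "(\<lambda>(x, y). {x, y}) ` P \<subseteq> edges G" using assms(1) by (auto simp: E_def)
    fix e f assume e: "e \<in> (\<lambda>(x, y). {x, y}) ` P" and f: "f \<in> (\<lambda>(x, y). {x, y}) ` P" and "e \<noteq> f"
    obtain x y x' y' where *: "(x, y) \<in> P" "e = {x, y}" "(x', y') \<in> P" "f = {x', y'}" using e f by auto
    then have "x \<in> X" "x' \<in> X" "y \<in> Y" "y' \<in> Y" using assms(1) by (auto simp: E_def)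
    moreover have "x \<noteq> x'" using pmatching_fst[OF assms(2), of x y y'] * \<open>e \<noteq> f\<close> by auto
    moreover have "y \<noteq> y'" using pmatching_snd[OF assms(2), of x y x'] * \<open>e \<noteq> f\<close> by auto
    ultimately show "e \<inter> f = {}" using * disjoint by auto
  qed
  show "sum (weight G) ((\<lambda>(x, y). {x, y}) ` P) = sum w P"
    using inj_E[OF assms(1)] by (subst sum.reindex) (auto simp: w_def intro!: sum.cong)
qed

lemma M_pairs: "pairs M \<subseteq> E" "pmatching (pairs M)" "sum w (pairs M) = mwm G"
  using pairs_matching[OF matching] sum_M by auto

lemma pairs_le: "P \<subseteq> E \<Longrightarrow> pmatching P \<Longrightarrow> sum w P \<le> mwm G"
  using matching_of_pairs mwm_ge[OF finite_edges] by metis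

text \<open>The weight \<open>mwm G\<close> of \<open>M\<close> is at most the part of the cover
  that lies on the nodes of \<open>M\<close>, and the whole cover is worth at most
  \<open>mwm G\<close>. So all slack vanishes, on the edges of \<open>M\<close> as well as at the
  unmatched nodes.\<close>

lemma potential_of_cover:
  assumes cov: "pcover E w c d" and opt: "sum c X + sum d Y \<le> mwm G"
  shows "potential (\<lambda>u. if u \<in> X then c u else d u)"
proof -
  let ?M = "pairs M"
  have fin: "finite ?M" using M_pairs finite_E finite_subset by blast
  have sub: "fst ` ?M \<subseteq> X" "snd ` ?M \<subseteq> Y" using M_pairs(1) by (auto simp: E_def)
  have le: "w p \<le> (case p of (x, y) \<Rightarrow> c x + d y)" if "p \<in> ?M" for p
    using cov that M_pairs(1) by (auto simp: pcover_def)
  have X: "sum c X = sum c (fst ` ?M) + sum c (X - fst ` ?M)"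
    using sub finite_X by (simp add: sum.subset_diff)
  have Y: "sum d Y = sum d (snd ` ?M) + sum d (Y - snd ` ?M)"
    using sub finite_Y by (simp add: sum.subset_diff)
  have "mwm G \<le> (\<Sum>(x, y)\<in>?M. c x + d y)" using le M_pairs(3) sum_mono by metis
  then have *: "(\<Sum>(x, y)\<in>?M. c x + d y) = mwm G" "sum c (X - fst ` ?M) = 0" "sum d (Y - snd ` ?M) = 0"
    using opt X Y pmatching_sum[OF M_pairs(2), of c d] by auto
  have tight: "weight G {x, y} = c x + d y" if "(x, y) \<in> ?M" for x y
    using sum_mono_inv[of w ?M "\<lambda>(x, y). c x + d y" "(x, y)"] le that fin * M_pairs(3)
    by (auto simp: w_def)
  have XY: "u \<in> X \<and> v \<in> Y \<or> u \<in> Y \<and> v \<in> X" if "{u, v} \<in> edges G" for u v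
    using edge_XY[OF that] by (auto simp: doubleton_eq_iff)
  show ?thesis
    unfolding potential_def
  proof (intro conjI allI impI ballI)
    fix u v assume uv: "{u, v} \<in> edges G"
    have "weight G {x, y} \<le> c x + d y" if "x \<in> X" "y \<in> Y" "{x, y} \<in> edges G" for x y
      using cov that by (auto simp: pcover_def E_def w_def)
    from this[of u v] this[of v u] show "weight G {u, v} \<le> (if u \<in> X then c u else d u) + (if v \<in> X then c v else d v)"
      using XY[OF uv] uv disjoint by (auto simp: insert_commute)
  next
    fix u v assume "{u, v} \<in> M"
    moreover from this have uv: "{u, v} \<in> edges G" using M_edges by blast
    ultimately show "weight G {u, v} = (if u \<in> X then c u else d u) + (if v \<in> X then c v else d v)"
      using XY[OF uv] disjoint tight[of u v] tight[of v u]
      by (auto simp: insert_commute pairs_def E_def)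
  next
    fix u assume u: "u \<in> verts G" "u \<notin> \<Union>M"
    then have "u \<notin> fst ` ?M" "u \<notin> snd ` ?M" by (auto simp: pairs_def)
    then show "(if u \<in> X then c u else d u) = 0"
      using * u verts finite_X finite_Y by auto
  qed
qed

text \<open>By \<open>reach_potential\<close> none of the copies of \<open>u\<close> with index at
  most \<pi> u is reached, so each contributes 1 to the sum. Tightness of the matched edge at
  \<open>u\<close> ensures that there are that many copies.\<close>

lemma potential_le_sum_rho:
  assumes \<pi>: "potential \<pi>" and u: "u \<in> verts G"
  shows "\<pi> u \<le> (\<Sum>i = 1..heaviest G u. rho G M (u, i))"
proof -
  have "\<pi> u \<le> heaviest G u"
  proof (cases "u \<in> \<Union>M")
    case True
    then obtain v where v: "{u, v} \<in> M" by (rule M_mate)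
    then have "weight G {u, v} = \<pi> u + \<pi> v" using \<pi> by (auto simp: potential_def)
    moreover have "weight G {u, v} \<le> heaviest G u" using heaviest_ge v M_edges by blast
    ultimately show ?thesis by simp
  qed (use assms in \<open>auto simp: potential_def\<close>)
  have "\<pi> u = (\<Sum>i = 1..\<pi> u. rho G M (u, i))"
    using reach_potential[OF \<pi>] by (subst sum.cong[OF refl, of _ _ "\<lambda>_. 1"]) (force simp: rho_reach)+
  also have "\<dots> \<le> (\<Sum>i = 1..heaviest G u. rho G M (u, i))"
    using \<open>\<pi> u \<le> heaviest G u\<close> by (intro sum_mono2) auto
  finally show ?thesis .
qed

lemma ex_potential: "\<exists>\<pi>. potential \<pi>"
proof -
  obtain c d where "pcover E w c d" "sum c X + sum d Y \<le> mwm G"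
    using egervary[OF finite_E pairs_le] by (auto simp: fst_E snd_E)
  then show ?thesis using potential_of_cover by blast
qed

lemma weight_delete [simp]: "weight (delete_vertex G u) = weight G"
  by (simp add: delete_vertex_def)

lemma finite_edges_delete: "finite (edges (delete_vertex G u))"
  using finite_edges by (simp add: delete_vertex_def)

lemma cavity_ge:
  assumes u: "u \<in> X"
  shows "mwm G \<le> mwm (delete_vertex G u) + (\<Sum>i = 1..heaviest G u. rho G M (u, i))"
proof -
  have cav: "sum w P \<le> mwm (delete_vertex G u)" if P: "P \<subseteq> E" "pmatching P" "u \<notin> fst ` P" for P
  proof -
    have "\<forall>e \<in> (\<lambda>(x, y). {x, y}) ` P. u \<notin> e"
      using P u disjoint by (force simp: E_def)
    then have "matching (delete_vertex G u) ((\<lambda>(x, y). {x, y}) ` P)"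
      using matching_of_pairs[OF P(1,2)] by (simp add: matching_delete_vertex)
    from mwm_ge[OF finite_edges_delete this] show ?thesis
      using matching_of_pairs(2)[OF P(1,2)] by simp
  qed
  show ?thesis
  \<comment> \<open>The distinction guards the truncated subtraction in the weight of the pendant
    edge; in the other case the claim is immediate.\<close>
  proof (cases "mwm (delete_vertex G u) \<le> mwm G")
    case True
    have "\<exists>c d. pcover E w c d \<and> sum c (fst ` E) + sum d (snd ` E) \<le> mwm G \<and> mwm G - mwm (delete_vertex G u) \<le> c u"
    proof (rule egervary_cavity[OF finite_E pairs_le])
      show "sum w P + (mwm G - mwm (delete_vertex G u)) \<le> mwm G"
        if "P \<subseteq> E" "pmatching P" "u \<notin> fst ` P" for P
        using cav[OF that] True by simp
    qed (use M_pairs fst_E u in auto)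
    then obtain c d where cd: "pcover E w c d" "sum c X + sum d Y \<le> mwm G" "mwm G - mwm (delete_vertex G u) \<le> c u"
      by (auto simp: fst_E snd_E)
    have "c u \<le> (\<Sum>i = 1..heaviest G u. rho G M (u, i))"
      using potential_le_sum_rho[OF potential_of_cover[OF cd(1,2)], of u] u verts by simp
    with cd(3) show ?thesis by simp
  qed simp
qed

section \<open>The potential found by the search\<close>

definition search_left :: "'a \<Rightarrow> nat" where
  "search_left x = (\<Sum>i = 1..heaviest G x. rho G M (x, i))"

text \<open>The copies of \<open>y\<close> that the search passes through, counted by their mates in
  \<open>X\<close>. The outer sum has at most one term, and none if \<open>y\<close> is unmatched,
  which gives the value 0 without a choice of the mate. \<open>rho\<close> itself would not do on
  this side, as it belongs to the search that starts from the unmatched copies in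
  \<open>Y\<close>.\<close>

definition search_right :: "'a \<Rightarrow> nat" where
  "search_right y = (\<Sum>x | {x, y} \<in> M. card {i\<in>{1..weight G {x, y}}. reach H N (x, i)})"

lemma search_right_eq:
  assumes "{x, y} \<in> M"
  shows "search_right y = card {i\<in>{1..weight G {x, y}}. reach H N (x, i)}"
proof -
  have "{x. {x, y} \<in> M} = {x}" using assms M_unique[of y] by (auto simp: insert_commute)
  then show ?thesis by (simp add: search_right_def)
qed

lemma search_left_eq: "search_left x = card {i\<in>{1..heaviest G x}. \<not> reach H N (x, i)}"
proof -
  have "search_left x = sum (\<lambda>_. 1) {i\<in>{1..heaviest G x}. \<not> reach H N (x, i)}"
    unfolding search_left_def by (rule sum.mono_neutral_cong_right) (auto simp: rho_reach)
  then show ?thesis by simp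
qed

lemma unmatched_copy_reach: "u \<in> verts G \<Longrightarrow> 1 \<le> i \<Longrightarrow> i \<le> heaviest G u \<Longrightarrow> \<not> matched_by N (u, i) \<Longrightarrow> reach H N (u, i)"
  by (auto intro!: reach.unmatched simp: verts_H)

text \<open>The copies in \<open>X\<close> that the search does not reach and those in \<open>Y\<close> that it reaches form a
  vertex cover of the unfolded graph, as in Koenig's theorem.\<close>

lemma search_pcover: "pcover E w search_left search_right"
  unfolding pcover_def
proof clarify
  fix x y assume xy: "(x, y) \<in> E"
  let ?W = "weight G {x, y}"
  let ?A = "{i\<in>{1..?W}. \<not> reach H N (x, i)}" and ?B = "{i\<in>{1..?W}. reach H N (x, i)}"
  have e: "{x, y} \<in> edges G" "x \<in> X" "y \<in> Y" using xy by (auto simp: E_def)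
  \<comment> \<open>The potential shows that there is no augmenting path: a neighbour of a reached
    copy is covered by \<pi>, hence matched, so that the search continues to its mate.\<close>
  obtain \<pi> where \<pi>: "potential \<pi>" using ex_potential by blast
  have mate: "\<exists>x'. {x', y} \<in> M \<and> ?W + 1 - i \<le> weight G {x', y} \<and> reach H N (x', weight G {x', y} + i - ?W)"
    if i: "i \<in> ?B" for i
  proof -
    have "\<pi> x < i" using reach_potential[OF \<pi>, of "(x, i)"] i by simp
    moreover have "?W \<le> \<pi> x + \<pi> y" using \<pi> e by (auto simp: potential_def)
    ultimately have "\<not> \<pi> y < ?W + 1 - i" using i by auto
    then have "matched_by N (y, ?W + 1 - i)"
      using potential_unmatched[OF \<pi>, of y "?W + 1 - i"] i e verts by force
    then obtain x' where x': "{y, x'} \<in> M" "?W + 1 - i \<le> weight G {y, x'}" by (auto simp: N_matched)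
    have "{(y, ?W + 1 - i), (x', weight G {y, x'} + i - ?W)} \<in> N"
      using x' i by (auto simp: unfold_edges_iff)
    moreover have "{(x, i), (y, ?W + 1 - i)} \<in> edges H"
      using e i by (auto simp: edges_H unfold_edges_iff)
    ultimately have "reach H N (x', weight G {y, x'} + i - ?W)" using i by (auto intro: reach.step)
    then show ?thesis using x' by (auto simp: insert_commute)
  qed
  have "card ?A \<le> search_left x"
    unfolding search_left_eq using heaviest_ge[OF e(1), of x] by (intro card_mono) auto
  moreover have "card ?B \<le> search_right y"
  proof (cases "?B = {}")
    case False
    then obtain i0 where "i0 \<in> ?B" by blast
    from mate[OF this] obtain x' where x': "{x', y} \<in> M" by blast
    have *: "?W + 1 - i \<le> weight G {x', y} \<and> reach H N (x', weight G {x', y} + i - ?W)" if i: "i \<in> ?B" for i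
    proof -
      obtain x'' where x'': "{x'', y} \<in> M" "?W + 1 - i \<le> weight G {x'', y}"
          "reach H N (x'', weight G {x'', y} + i - ?W)"
        using mate[OF i] by blast
      moreover from this(1) have "x'' = x'" using M_unique[of y x'' x'] x' by (simp add: insert_commute)
      ultimately show ?thesis by blast
    qed
    let ?C = "{k\<in>{1..weight G {x', y}}. reach H N (x', k)}"
    \<comment> \<open>Copy \<open>i\<close> of \<open>x\<close> is adjacent to copy
      \<open>?W + 1 - i\<close> of \<open>y\<close>, whose mate is copy
      \<open>weight G {x', y} + i - ?W\<close> of \<open>x'\<close>. On \<open>?B\<close> this
      subtraction is not truncated, so the map is injective.\<close>
    have "card ?B \<le> card ?C"
    proof (rule card_inj_on_le)
      show "inj_on (\<lambda>i. weight G {x', y} + i - ?W) ?B"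
      proof (rule inj_onI)
        fix i j assume ij: "i \<in> ?B" "j \<in> ?B" "weight G {x', y} + i - ?W = weight G {x', y} + j - ?W"
        then show "i = j" using *[OF ij(1)] *[OF ij(2)] by auto
      qed
      show "(\<lambda>i. weight G {x', y} + i - ?W) ` ?B \<subseteq> ?C"
      proof
        fix k assume "k \<in> (\<lambda>i. weight G {x', y} + i - ?W) ` ?B"
        then obtain i where i: "i \<in> ?B" "k = weight G {x', y} + i - ?W" by blast
        then show "k \<in> ?C" using *[OF i(1)] by auto
      qed
    qed simp
    then show ?thesis using search_right_eq[OF x'] by simp
  qed (simp only: card.empty)
  moreover have "?W = card ?A + card ?B"
  proof -
    have "card ?A + card ?B = card (?A \<union> ?B)" by (rule card_Un_disjoint[symmetric]) auto
    also have "?A \<union> ?B = {1..?W}" by auto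
    finally show ?thesis by simp
  qed
  ultimately show "w (x, y) \<le> search_left x + search_right y" by (simp add: w_def)
qed

text \<open>For a matched edge of weight \<open>?W\<close>, each of the first \<open>?W\<close>
  copies of \<open>x\<close> is counted once: on the left if it is not reached, on the right if it
  is. The copies of \<open>x\<close> beyond \<open>?W\<close> are unmatched, hence reached, and
  contribute nothing; neither do unmatched nodes.\<close>

lemma search_optimal: "sum search_left X + sum search_right Y = mwm G"
proof -
  let ?M = "pairs M"
  have sub: "fst ` ?M \<subseteq> X" "snd ` ?M \<subseteq> Y" using M_pairs(1) by (auto simp: E_def)
  have "sum search_left X = sum search_left (fst ` ?M)"
  proof (rule sum.mono_neutral_right)
    show "\<forall>x\<in>X - fst ` ?M. search_left x = 0"
    proof
      fix x assume x: "x \<in> X - fst ` ?M"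
      have "{x, v} \<notin> M" for v
      proof
        assume v: "{x, v} \<in> M"
        then obtain a b where "a \<in> X" "b \<in> Y" "{x, v} = {a, b}" using edge_XY M_edges by blast
        then have "(x, v) \<in> ?M" using x v M_edges disjoint by (auto simp: pairs_def E_def doubleton_eq_iff)
        with x show False by force
      qed
      then show "search_left x = 0"
        using unmatched_copy_reach[of x] x verts by (auto simp: search_left_eq N_matched)
    qed
  qed (use sub finite_X in auto)
  moreover have "sum search_right Y = sum search_right (snd ` ?M)"
  proof (rule sum.mono_neutral_right)
    show "\<forall>y\<in>Y - snd ` ?M. search_right y = 0"
    proof
      fix y assume y: "y \<in> Y - snd ` ?M"
      have "{x, y} \<notin> M" for x
      proof
        assume v: "{x, y} \<in> M"
        then obtain a b where "a \<in> X" "b \<in> Y" "{x, y} = {a, b}" using edge_XY M_edges by blast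
        then have "(x, y) \<in> ?M" using y v M_edges disjoint by (auto simp: pairs_def E_def doubleton_eq_iff)
        with y show False by force
      qed
      then show "search_right y = 0" by (simp add: search_right_def)
    qed
  qed (use sub finite_Y in auto)
  ultimately have "sum search_left X + sum search_right Y = (\<Sum>(x, y)\<in>?M. search_left x + search_right y)"
    using pmatching_sum[OF M_pairs(2)] by metis
  also have "\<dots> = sum w ?M"
  proof (rule sum.cong[OF refl], clarify)
    fix x y assume "(x, y) \<in> ?M"
    then have xy: "{x, y} \<in> M" "x \<in> X" by (auto simp: pairs_def E_def)
    let ?W = "weight G {x, y}"
    have W: "?W \<le> heaviest G x" using heaviest_ge xy M_edges by blast
    have "reach H N (x, i)" if i: "?W < i" "i \<le> heaviest G x" for i
    proof (rule unmatched_copy_reach)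
      show "\<not> matched_by N (x, i)"
      proof
        assume "matched_by N (x, i)"
        then obtain v where v: "{x, v} \<in> M" "i \<le> weight G {x, v}" by (auto simp: N_matched)
        with M_unique[OF xy(1) v(1)] i show False by simp
      qed
    qed (use i xy verts in auto)
    then have "i \<in> {1..heaviest G x} \<and> \<not> reach H N (x, i) \<longleftrightarrow> i \<in> {1..?W} \<and> \<not> reach H N (x, i)" for i
      using W by (cases "?W < i") auto
    then have "{i\<in>{1..heaviest G x}. \<not> reach H N (x, i)} = {i\<in>{1..?W}. \<not> reach H N (x, i)}"
      by (simp only:)
    then have "search_left x + search_right y = card ({i\<in>{1..?W}. \<not> reach H N (x, i)} \<union> {i\<in>{1..?W}. reach H N (x, i)})"
      unfolding search_left_eq search_right_eq[OF xy(1)] by (subst card_Un_disjoint) auto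
    also have "{i\<in>{1..?W}. \<not> reach H N (x, i)} \<union> {i\<in>{1..?W}. reach H N (x, i)} = {1..?W}" by auto
    finally show "search_left x + search_right y = w (x, y)" by (simp add: w_def)
  qed
  also have "\<dots> = mwm G" by (rule M_pairs)
  finally show ?thesis .
qed

lemma cavity_le:
  assumes u: "u \<in> X"
  shows "mwm (delete_vertex G u) + (\<Sum>i = 1..heaviest G u. rho G M (u, i)) \<le> mwm G"
proof -
  obtain F where F: "matching (delete_vertex G u) F" "sum (weight G) F = mwm (delete_vertex G u)"
    using mwm_attained[OF finite_edges_delete, of u] by (auto simp: delete_vertex_def)
  then have m: "matching G F" and nu: "\<forall>e\<in>F. u \<notin> e" by (auto simp: matching_delete_vertex)
  note P = pairs_matching[OF m]
  have "fst ` pairs F \<subseteq> X - {u}" "snd ` pairs F \<subseteq> Y"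
    using nu by (auto simp: pairs_def E_def)
  then have "sum search_left (fst ` pairs F) + sum search_right (snd ` pairs F)
      \<le> sum search_left (X - {u}) + sum search_right Y"
    using finite_X finite_Y by (intro add_mono sum_mono2) auto
  then have "sum w (pairs F) \<le> sum search_left (X - {u}) + sum search_right Y"
    using weak_duality[OF finite_E P(1,2) search_pcover] by simp
  moreover have "sum search_left X = search_left u + sum search_left (X - {u})"
    using finite_X u by (simp add: sum.remove)
  ultimately show ?thesis using search_optimal P(3) F(2) by (simp add: search_left_def)
qed

end

lemma (in bipartite_matching) cavity:
  assumes "u \<in> verts G"
  shows "mwm (delete_vertex G u) + (\<Sum>i = 1..heaviest G u. rho G M (u, i)) = mwm G"
proof -
  interpret swapped: bipartite_matching G M Y X by (rule swap)
  show ?thesis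
  proof (cases "u \<in> X")
    case True
    then show ?thesis using cavity_le cavity_ge by (intro antisym) auto
  next
    case False
    then have "u \<in> Y" using assms verts by blast
    then show ?thesis using swapped.cavity_le swapped.cavity_ge by (intro antisym) auto
  qed
qed


section \<open>Reasoning about programs\<close>

text \<open>Total correctness with an upper bound on the time, so that branches of different cost
  can be treated alike.\<close>

definition runs :: "com \<Rightarrow> state \<Rightarrow> nat \<Rightarrow> (state \<Rightarrow> bool) \<Rightarrow> bool" where
  "runs c s b Q \<longleftrightarrow> (\<exists>t s'. exec c s t s' \<and> t \<le> b \<and> Q s')"

fun mod_regs :: "com \<Rightarrow> reg set" where
  "mod_regs SKIP = {}"
| "mod_regs (Assign r e) = {r}"
| "mod_regs (Store a e f) = {}"
| "mod_regs (Seq c d) = mod_regs c \<union> mod_regs d"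
| "mod_regs (Cond b c d) = mod_regs c \<union> mod_regs d"
| "mod_regs (While b c) = mod_regs c"

fun mod_arrs :: "com \<Rightarrow> arr set" where
  "mod_arrs SKIP = {}"
| "mod_arrs (Assign r e) = {}"
| "mod_arrs (Store a e f) = {a}"
| "mod_arrs (Seq c d) = mod_arrs c \<union> mod_arrs d"
| "mod_arrs (Cond b c d) = mod_arrs c \<union> mod_arrs d"
| "mod_arrs (While b c) = mod_arrs c"

lemma mod_regs_For [simp]: "mod_regs (For r e c) = insert r (mod_regs c)"
  and mod_arrs_For [simp]: "mod_arrs (For r e c) = mod_arrs c"
  by (auto simp: For_def)

lemma regs_set_reg [simp]: "regs (set_reg r k s) = (regs s)(r := k)"
  and arrs_set_reg [simp]: "arrs (set_reg r k s) = arrs s"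
  and regs_set_arr [simp]: "regs (set_arr a i k s) = regs s"
  and arrs_set_arr [simp]: "arrs (set_arr a i k s) = (arrs s)(a := (arrs s a)(i := k))"
  by (auto simp: set_reg_def set_arr_def)

text \<open>The frame condition that the rules below pass along. It is read off from the text of a
  program, so that loop invariants have to speak only about the memory that the loop
  changes.\<close>

definition same :: "reg set \<Rightarrow> arr set \<Rightarrow> state \<Rightarrow> state \<Rightarrow> bool" where
  "same R A s s' \<longleftrightarrow> (\<forall>r. r \<notin> R \<longrightarrow> regs s' r = regs s r) \<and> (\<forall>a. a \<notin> A \<longrightarrow> arrs s' a = arrs s a)"

lemma same_refl [simp]: "same R A s s"
  by (simp add: same_def)

lemma same_trans: "same R A s s' \<Longrightarrow> same R A s' s'' \<Longrightarrow> same R A s s''"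
  by (simp add: same_def)

lemma same_mono: "same R A s s' \<Longrightarrow> R \<subseteq> R' \<Longrightarrow> A \<subseteq> A' \<Longrightarrow> same R' A' s s'"
  by (auto simp: same_def)

lemma same_regs: "same R A s s' \<Longrightarrow> r \<notin> R \<Longrightarrow> regs s' r = regs s r"
  by (simp add: same_def)

lemma exec_same: "exec c s t s' \<Longrightarrow> same (mod_regs c) (mod_arrs c) s s'"
  by (induction rule: exec.induct) (auto simp: same_def)

lemma runs_same:
  assumes "runs c s b Q"
  shows "runs c s b (\<lambda>s'. Q s' \<and> same (mod_regs c) (mod_arrs c) s s')"
  using assms exec_same unfolding runs_def by blast

lemma runs_mono:
  assumes "runs c s b Q" "b \<le> b'" "\<And>s'. Q s' \<Longrightarrow> same (mod_regs c) (mod_arrs c) s s' \<Longrightarrow> Q' s'"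
  shows "runs c s b' Q'"
  using runs_same[OF assms(1)] assms(2,3) unfolding runs_def by (meson le_trans)

lemma runs_Seq:
  assumes "runs c s b1 Q" "\<And>s'. Q s' \<Longrightarrow> same (mod_regs c) (mod_arrs c) s s' \<Longrightarrow> runs d s' b2 Q'" "b1 + b2 \<le> b"
  shows "runs (Seq c d) s b Q'"
proof -
  obtain t s' where 1: "exec c s t s'" "t \<le> b1" "Q s'" using assms(1) by (auto simp: runs_def)
  then have "runs d s' b2 Q'" using assms(2)[OF 1(3) exec_same[OF 1(1)]] by simp
  then obtain t' s'' where 2: "exec d s' t' s''" "t' \<le> b2" "Q' s''" by (auto simp: runs_def)
  have "exec (Seq c d) s (t + t') s''" by (rule exec.Seq[OF 1(1) 2(1)])
  then show ?thesis using 1 2 assms(3) unfolding runs_def by (intro exI[of _ "t + t'"] exI[of _ s'']) simp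
qed

fun loop_free :: "com \<Rightarrow> bool" where
  "loop_free SKIP \<longleftrightarrow> True"
| "loop_free (Assign r e) \<longleftrightarrow> True"
| "loop_free (Store a e f) \<longleftrightarrow> True"
| "loop_free (Seq c d) \<longleftrightarrow> loop_free c \<and> loop_free d"
| "loop_free (Cond b c d) \<longleftrightarrow> loop_free c \<and> loop_free d"
| "loop_free (While b c) \<longleftrightarrow> False"

text \<open>Lets simplification execute code without loops symbolically. The value for
  \<open>While\<close> is a default; \<open>exec_result\<close> is restricted to loop-free
  programs.\<close>

fun result :: "com \<Rightarrow> state \<Rightarrow> state" where
  "result SKIP s = s"
| "result (Assign r e) s = set_reg r (aval e s) s"
| "result (Store a e f) s = set_arr a (aval e s) (aval f s) s"
| "result (Seq c d) s = result d (result c s)"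
| "result (Cond b c d) s = (if bval b s then result c s else result d s)"
| "result (While b c) s = s"

fun max_cost :: "com \<Rightarrow> nat" where
  "max_cost SKIP = 1"
| "max_cost (Assign r e) = acost e + 1"
| "max_cost (Store a e f) = acost e + acost f + 1"
| "max_cost (Seq c d) = max_cost c + max_cost d"
| "max_cost (Cond b c d) = bcost b + max (max_cost c) (max_cost d) + 1"
| "max_cost (While b c) = 0"

lemma exec_result: "loop_free c \<Longrightarrow> \<exists>t\<le>max_cost c. exec c s t (result c s)"
proof (induction c arbitrary: s)
  case SKIP
  show ?case using exec.Skip by (intro exI[of _ 1]) simp
next
  case (Assign r e)
  show ?case using exec.Assign[of r e s] by (intro exI[of _ "acost e + 1"]) simp
next
  case (Store a e f)
  show ?case using exec.Store[of a e f s] by (intro exI[of _ "acost e + acost f + 1"]) simp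
next
  case (Seq c d)
  obtain t where t: "t \<le> max_cost c" "exec c s t (result c s)" using Seq by force
  obtain t' where t': "t' \<le> max_cost d" "exec d (result c s) t' (result d (result c s))" using Seq by force
  show ?case using exec.Seq[OF t(2) t'(2)] t t' by (intro exI[of _ "t + t'"]) simp
next
  case (Cond b c d)
  obtain t where t: "t \<le> max_cost c" "exec c s t (result c s)" using Cond by force
  obtain t' where t': "t' \<le> max_cost d" "exec d s t' (result d s)" using Cond by force
  show ?case
  proof (cases "bval b s")
    case True
    show ?thesis using exec.CondTrue[where d = d, OF True t(2)] t True
      by (intro exI[of _ "bcost b + t + 1"]) simp
  next
    case False
    show ?thesis using exec.CondFalse[where c = c, OF False t'(2)] t' False
      by (intro exI[of _ "bcost b + t' + 1"]) simp
  qed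
qed simp

lemma runs_result: "loop_free c \<Longrightarrow> max_cost c \<le> b \<Longrightarrow> Q (result c s) \<Longrightarrow> runs c s b Q"
  using exec_result[of c s] unfolding runs_def by (meson le_trans)

text \<open>The number \<open>p\<close> in \<open>I p s\<close> is a potential that pays for the remaining iterations.\<close>

lemma runs_While:
  assumes "I p s"
    and step: "\<And>p s'. I p s' \<Longrightarrow> same (mod_regs c) (mod_arrs c) s s' \<Longrightarrow> bval b s' \<Longrightarrow>
      \<exists>t. runs c s' t (\<lambda>s''. \<exists>p'. I p' s'' \<and> t + bcost b + 1 + p' \<le> p)"
    and final: "\<And>p s'. I p s' \<Longrightarrow> same (mod_regs c) (mod_arrs c) s s' \<Longrightarrow> \<not> bval b s' \<Longrightarrow> Q s'"
    and "p + bcost b + 1 \<le> B"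
  shows "runs (While b c) s B Q"
proof -
  have "runs (While b c) s' (p + bcost b + 1) Q"
    if "I p s'" "same (mod_regs c) (mod_arrs c) s s'" for p s'
    using that
  proof (induction p arbitrary: s' rule: less_induct)
    case (less p)
    show ?case
    proof (cases "bval b s'")
      case False
      then show ?thesis using final[OF less.prems False] exec.WhileFalse[OF False, of c]
        unfolding runs_def by (intro exI[of _ "bcost b + 1"] exI[of _ s']) simp
    next
      case True
      obtain t where "runs c s' t (\<lambda>s''. \<exists>p'. I p' s'' \<and> t + bcost b + 1 + p' \<le> p)"
        using step[OF less.prems True] by blast
      then obtain t1 s1 p' where 1: "exec c s' t1 s1" "t1 \<le> t" "I p' s1" "t + bcost b + 1 + p' \<le> p"
        by (auto simp: runs_def)
      have "same (mod_regs c) (mod_arrs c) s s1"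
        using same_trans[OF less.prems(2) exec_same[OF 1(1)]] .
      then have "runs (While b c) s1 (p' + bcost b + 1) Q" using less.IH[of p' s1] 1 by simp
      then obtain t2 s2 where 2: "exec (While b c) s1 t2 s2" "t2 \<le> p' + bcost b + 1" "Q s2"
        by (auto simp: runs_def)
      show ?thesis using exec.WhileTrue[OF True 1(1) 2(1)] 1 2
        unfolding runs_def by (intro exI[of _ "bcost b + t1 + t2 + 1"] exI[of _ s2]) simp
    qed
  qed
  from this[OF assms(1)] assms(4) show ?thesis by (auto elim: runs_mono)
qed

text \<open>The bound \<open>e\<close> is evaluated anew in every round, so it must have the value
  \<open>n\<close> in all states that the loop can produce. A round costs \<open>acost e + 3\<close>
  for the test and 4 for the increment besides the body; the remaining \<open>acost e + 5\<close>
  pay for the initialization and the last test.\<close>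

lemma runs_For:
  assumes init: "I 0 (set_reg r 0 s)"
    and r: "r \<notin> mod_regs c"
    and bound: "\<And>s'. same (mod_regs (For r e c)) (mod_arrs c) s s' \<Longrightarrow> aval e s' = n"
    and step: "\<And>k s'. k < n \<Longrightarrow> I k s' \<Longrightarrow> regs s' r = k \<Longrightarrow>
      same (mod_regs (For r e c)) (mod_arrs c) s s' \<Longrightarrow> runs c s' (B k) (\<lambda>s''. I (Suc k) (set_reg r (Suc k) s''))"
    and final: "\<And>s'. I n s' \<Longrightarrow> same (mod_regs (For r e c)) (mod_arrs c) s s' \<Longrightarrow> Q s'"
    and cost: "(\<Sum>k<n. B k) + n * (acost e + 7) + acost e + 5 \<le> b"
  shows "runs (For r e c) s b Q"
proof -
  \<comment> \<open>The cost of the rounds from \<open>k\<close> on, used as the potential of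
    \<open>runs_While\<close>.\<close>
  define p where "p k = (\<Sum>i\<in>{k..<n}. B i + acost e + 7)" for k
  let ?R = "mod_regs (For r e c)"
  show ?thesis
    unfolding For_def
  proof (rule runs_Seq[where Q = "\<lambda>s'. s' = set_reg r 0 s"])
    show "runs (r ::= Lit 0) s 2 (\<lambda>s'. s' = set_reg r 0 s)" by (rule runs_result) auto
    show "2 + (p 0 + acost e + 3) \<le> b"
      using cost by (simp add: p_def sum.distrib atLeast0LessThan distrib_left)
    fix s' assume s': "s' = set_reg r 0 s"
    have sim: "same ?R (mod_arrs c) s s'" by (simp add: s' same_def)
    show "runs (WHILE Reg r \<prec> e DO (c ;; r ::= Reg r \<boxplus> Lit 1)) s' (p 0 + acost e + 3) Q"
    proof (rule runs_While[where I = "\<lambda>q s'. same ?R (mod_arrs c) s s' \<and> regs s' r \<le> n \<and> I (regs s' r) s' \<and> q = p (regs s' r)"])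
      show "same ?R (mod_arrs c) s s' \<and> regs s' r \<le> n \<and> I (regs s' r) s' \<and> p 0 = p (regs s' r)"
        using sim init by (simp add: s')
    next
      fix q s1
      assume I: "same ?R (mod_arrs c) s s1 \<and> regs s1 r \<le> n \<and> I (regs s1 r) s1 \<and> q = p (regs s1 r)"
        and "bval (Reg r \<prec> e) s1"
      then have k: "regs s1 r < n" using bound[of s1] by simp
      let ?k = "regs s1 r"
      have "runs (c ;; r ::= Reg r \<boxplus> Lit 1) s1 (B ?k + 4)
          (\<lambda>s2. \<exists>q'. (same ?R (mod_arrs c) s s2 \<and> regs s2 r \<le> n \<and> I (regs s2 r) s2 \<and> q' = p (regs s2 r)) \<and>
            B ?k + 4 + bcost (Reg r \<prec> e) + 1 + q' \<le> q)"
      proof (rule runs_Seq)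
        show "runs c s1 (B ?k) (\<lambda>s2. I (Suc ?k) (set_reg r (Suc ?k) s2))" using I k by (intro step) auto
        fix s2 assume 2: "I (Suc ?k) (set_reg r (Suc ?k) s2)" "same (mod_regs c) (mod_arrs c) s1 s2"
        have r2: "regs s2 r = ?k" using 2(2) r by (rule same_regs)
        have "same ?R (mod_arrs c) s s2"
          using I by (intro same_trans[OF _ same_mono[OF 2(2)]]) auto
        then have "same ?R (mod_arrs c) s (set_reg r (Suc ?k) s2)" by (simp add: same_def)
        moreover have "p ?k = B ?k + acost e + 7 + p (Suc ?k)"
          unfolding p_def using k by (simp add: sum.atLeast_Suc_lessThan)
        ultimately show "runs (r ::= Reg r \<boxplus> Lit 1) s2 4
           (\<lambda>s2. \<exists>q'. (same ?R (mod_arrs c) s s2 \<and> regs s2 r \<le> n \<and> I (regs s2 r) s2 \<and> q' = p (regs s2 r)) \<and>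
            B ?k + 4 + bcost (Reg r \<prec> e) + 1 + q' \<le> q)"
          using 2 r2 k I by (intro runs_result) auto
      qed simp
      then show "\<exists>t. runs (c ;; r ::= Reg r \<boxplus> Lit 1) s1 t
          (\<lambda>s2. \<exists>q'. (same ?R (mod_arrs c) s s2 \<and> regs s2 r \<le> n \<and> I (regs s2 r) s2 \<and> q' = p (regs s2 r)) \<and>
            t + bcost (Reg r \<prec> e) + 1 + q' \<le> q)" by blast
    next
      fix q s1
      assume I: "same ?R (mod_arrs c) s s1 \<and> regs s1 r \<le> n \<and> I (regs s1 r) s1 \<and> q = p (regs s1 r)"
        and "\<not> bval (Reg r \<prec> e) s1"
      then have "regs s1 r = n" using bound[of s1] by simp
      then show "Q s1" using I final by simp
    qed simp
  qed
qed


section \<open>Constructing the unfolded graph\<close>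

fun chain :: "(nat \<Rightarrow> nat) \<Rightarrow> nat \<Rightarrow> nat list \<Rightarrow> bool" where
  "chain nx h [] \<longleftrightarrow> h = 0"
| "chain nx h (x # xs) \<longleftrightarrow> h = Suc x \<and> chain nx (nx x) xs"

lemma chain_upd: "chain nx h xs \<Longrightarrow> j \<notin> set xs \<Longrightarrow> chain (nx(j := v)) h xs"
  by (induction xs arbitrary: h) auto

text \<open>\<open>HL\<close> lists the half-edges as pairs of source and target.\<close>

definition adjacency :: "nat \<Rightarrow> (nat \<times> nat) list \<Rightarrow> state \<Rightarrow> bool" where
  "adjacency NC HL s \<longleftrightarrow> regs s NumHalves = length HL \<and>
    (\<forall>h < length HL. arrs s Target h = snd (HL ! h)) \<and>
    (\<forall>x < NC. \<exists>hs. chain (arrs s Next) (arrs s First x) hs \<and> distinct hs \<and>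
       set hs = {h. h < length HL \<and> fst (HL ! h) = x})"

lemma adjacency_cong:
  "adjacency NC HL s \<Longrightarrow> regs s' NumHalves = regs s NumHalves \<Longrightarrow> arrs s' Target = arrs s Target \<Longrightarrow>
    arrs s' Next = arrs s Next \<Longrightarrow> arrs s' First = arrs s First \<Longrightarrow> adjacency NC HL s'"
  by (simp add: adjacency_def)

lemma add_half_edge_adjacency:
  assumes adj: "adjacency NC HL s" and xy: "regs s x = u" "regs s y = v" "x \<noteq> NumHalves" "y \<noteq> NumHalves"
  shows "adjacency NC (HL @ [(u, v)]) (result (add_half_edge x y) s)"
proof -
  let ?l = "length HL" and ?s' = "result (add_half_edge x y) s"
  have l: "regs s NumHalves = ?l" using adj by (simp add: adjacency_def)
  have next_: "arrs ?s' Next = (arrs s Next)(?l := arrs s First u)"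
    and first: "arrs ?s' First = (arrs s First)(u := Suc ?l)"
    and target: "arrs ?s' Target = (arrs s Target)(?l := v)"
    and halves: "regs ?s' NumHalves = Suc ?l"
    using xy l by (auto simp: add_half_edge_def)
  have "\<exists>hs. chain (arrs ?s' Next) (arrs ?s' First z) hs \<and> distinct hs \<and>
       set hs = {h. h < length (HL @ [(u, v)]) \<and> fst ((HL @ [(u, v)]) ! h) = z}" if z: "z < NC" for z
  proof -
    obtain hs where hs: "chain (arrs s Next) (arrs s First z) hs" "distinct hs"
        "set hs = {h. h < ?l \<and> fst (HL ! h) = z}"
      using adj z unfolding adjacency_def by blast
    then have chain: "chain (arrs ?s' Next) (arrs s First z) hs" unfolding next_ by (intro chain_upd) auto
    have sources: "{h. h < length (HL @ [(u, v)]) \<and> fst ((HL @ [(u, v)]) ! h) = z} =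
        (if z = u then insert ?l (set hs) else set hs)"
      unfolding hs(3) by (auto simp: nth_append less_Suc_eq)
    have notin: "?l \<notin> set hs" unfolding hs(3) by simp
    show ?thesis
    proof (cases "z = u")
      case True
      then have "chain (arrs ?s' Next) (arrs ?s' First z) (?l # hs)"
        using chain unfolding first by (simp add: next_)
      then show ?thesis
        unfolding sources using hs(2) notin True by (intro exI[of _ "?l # hs"]) simp
    next
      case False
      then show ?thesis
        unfolding sources using hs(2) chain by (intro exI[of _ hs]) (simp add: first)
    qed
  qed
  moreover have "arrs ?s' Target h = snd ((HL @ [(u, v)]) ! h)" if "h < length (HL @ [(u, v)])" for h
    using that adj by (auto simp: target adjacency_def nth_append less_Suc_eq)
  ultimately show ?thesis using halves by (simp add: adjacency_def)
qed

lemma add_half_edge_frame: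
  "a \<notin> {Target, Next, First} \<Longrightarrow> arrs (result (add_half_edge x y) s) a = arrs s a"
  "r \<noteq> NumHalves \<Longrightarrow> regs (result (add_half_edge x y) s) r = regs s r"
  by (auto simp: add_half_edge_def)

text \<open>The input reduced to numbers. Together, \<open>al_ge\<close> and
  \<open>al_attained\<close> say that \<open>al j\<close> is the greatest weight at node
  \<open>j\<close>; the latter also expresses that no node is isolated. That \<open>M\<close> is a
  matching becomes \<open>im_disjoint\<close>.\<close>

locale ram_input =
  fixes n m :: nat and a b wt im al :: "nat \<Rightarrow> nat"
  assumes ends: "k < m \<Longrightarrow> a k < n \<and> b k < n"
    and al_ge: "k < m \<Longrightarrow> wt k \<le> al (a k) \<and> wt k \<le> al (b k)"
    and al_attained: "j < n \<Longrightarrow> \<exists>k<m. (a k = j \<or> b k = j) \<and> al j = wt k"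
    and no_loop: "k < m \<Longrightarrow> a k \<noteq> b k"
    and im_disjoint: "k < m \<Longrightarrow> k' < m \<Longrightarrow> im k = 1 \<Longrightarrow> im k' = 1 \<Longrightarrow> k \<noteq> k' \<Longrightarrow>
      {a k, b k} \<inter> {a k', b k'} = {}"
begin

definition off :: "nat \<Rightarrow> nat" where
  "off j = sum al {..<j}"

abbreviation NC :: nat where
  "NC \<equiv> off n"

lemma off_Suc: "off (Suc j) = off j + al j"
  by (simp add: off_def)

lemma off_mono: "j \<le> j' \<Longrightarrow> off j \<le> off j'"
  unfolding off_def by (intro sum_mono2) auto

lemma off_less: "j < n \<Longrightarrow> i < al j \<Longrightarrow> off j + i < NC"
  using off_mono[of "Suc j" n] by (simp add: off_Suc)

lemma off_inj:
  assumes "off j + i = off j' + i'" "i < al j" "i' < al j'"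
  shows "j = j' \<and> i = i'"
proof -
  have "\<not> j < j'" using off_mono[of "Suc j" j'] assms by (auto simp: off_Suc)
  moreover have "\<not> j' < j" using off_mono[of "Suc j'" j] assms by (auto simp: off_Suc)
  ultimately show ?thesis using assms by auto
qed

lemma off_cover: "x < off k \<Longrightarrow> \<exists>j i. j < k \<and> i < al j \<and> x = off j + i"
proof (induction k)
  case (Suc k)
  show ?case
  proof (cases "x < off k")
    case True
    then show ?thesis using Suc.IH by (meson less_SucI)
  next
    case False
    then have "x - off k < al k" "x = off k + (x - off k)" using Suc.prems by (auto simp: off_Suc)
    then show ?thesis by blast
  qed
qed (simp add: off_def)

section \<open>Counting and numbering the copies\<close>

definition inp :: "state \<Rightarrow> bool" where
  "inp s \<longleftrightarrow> regs s NumNodes = n \<and> regs s NumEdges = m \<and>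
    arrs s EndA = a \<and> arrs s EndB = b \<and> arrs s Wt = wt \<and> arrs s InM = im"

definition numbered :: "state \<Rightarrow> bool" where
  "numbered s \<longleftrightarrow> inp s \<and> regs s NumCopies = NC \<and>
    (\<forall>j<n. arrs s Alpha j = al j \<and> arrs s Offset j = off j)"

lemma inp_same:
  "inp s \<Longrightarrow> same R A s s' \<Longrightarrow> {NumNodes, NumEdges} \<inter> R = {} \<Longrightarrow> {EndA, EndB, Wt, InM} \<inter> A = {} \<Longrightarrow> inp s'"
  by (simp add: inp_def same_def)

lemma numbered_same:
  "numbered s \<Longrightarrow> same R A s s' \<Longrightarrow> {NumNodes, NumEdges, NumCopies} \<inter> R = {} \<Longrightarrow>
    {EndA, EndB, Wt, InM, Alpha, Offset} \<inter> A = {} \<Longrightarrow> numbered s'"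
  by (simp add: numbered_def inp_def same_def)

lemma runs_count_copies:
  assumes "inp s"
  shows "runs count_copies s (12 * n + 40 * m + 20) (\<lambda>s'. \<forall>j<n. arrs s' Alpha j = al j)"
  unfolding count_copies_def
proof (rule runs_Seq)
  show "runs (FOR NodeIdx BELOW Reg NumNodes DO Alpha\<lblot>Reg NodeIdx\<rblot> ::= Lit 0) s (12 * n + 6)
      (\<lambda>s'. \<forall>j<n. arrs s' Alpha j = 0)"
    by (rule runs_For[where I = "\<lambda>k s'. \<forall>j<k. arrs s' Alpha j = 0" and n = n and B = "\<lambda>_. 3"])
      (use assms in \<open>auto simp: same_def inp_def less_Suc_eq intro!: runs_result\<close>)
next
  fix s1 assume zero: "\<forall>j<n. arrs s1 Alpha j = 0"
    and "same (mod_regs (FOR NodeIdx BELOW Reg NumNodes DO Alpha\<lblot>Reg NodeIdx\<rblot> ::= Lit 0))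
      (mod_arrs (FOR NodeIdx BELOW Reg NumNodes DO Alpha\<lblot>Reg NodeIdx\<rblot> ::= Lit 0)) s s1"
  then have inp: "inp s1" using assms by (elim inp_same) auto
  let ?body = "IF Alpha\<lbrakk>EndA\<lbrakk>Reg EdgeIdx\<rbrakk>\<rbrakk> \<prec> Wt\<lbrakk>Reg EdgeIdx\<rbrakk>
         THEN Alpha\<lblot>EndA\<lbrakk>Reg EdgeIdx\<rbrakk>\<rblot> ::= Wt\<lbrakk>Reg EdgeIdx\<rbrakk> ELSE SKIP ;;
       IF Alpha\<lbrakk>EndB\<lbrakk>Reg EdgeIdx\<rbrakk>\<rbrakk> \<prec> Wt\<lbrakk>Reg EdgeIdx\<rbrakk>
         THEN Alpha\<lblot>EndB\<lbrakk>Reg EdgeIdx\<rbrakk>\<rblot> ::= Wt\<lbrakk>Reg EdgeIdx\<rbrakk> ELSE SKIP"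
  \<comment> \<open>Every entry is 0 or the weight of an inspected edge at its node, and no
    inspected edge exceeds it. After all edges this determines the maximum, with 0 no exception
    because each node has an edge.\<close>
  let ?I = "\<lambda>K s'. (\<forall>j<n. arrs s' Alpha j = 0 \<or> (\<exists>k<K. (a k = j \<or> b k = j) \<and> arrs s' Alpha j = wt k)) \<and>
        (\<forall>k<K. wt k \<le> arrs s' Alpha (a k) \<and> wt k \<le> arrs s' Alpha (b k))"
  show "runs (FOR EdgeIdx BELOW Reg NumEdges DO ?body) s1 (40 * m + 10) (\<lambda>s'. \<forall>j<n. arrs s' Alpha j = al j)"
  proof (rule runs_For[where I = ?I and n = m and B = "\<lambda>_. 30"])
    show "?I 0 (set_reg EdgeIdx 0 s1)" using zero by simp
  next
    fix k s2
    assume k: "k < m" and I: "?I k s2" and r: "regs s2 EdgeIdx = k"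
      and sim: "same (mod_regs (FOR EdgeIdx BELOW Reg NumEdges DO ?body)) (mod_arrs ?body) s1 s2"
    have inp2: "inp s2" using inp sim by (rule inp_same) auto
    have res: "arrs (result ?body s2) Alpha = (\<lambda>j. if j = a k \<or> j = b k then max (arrs s2 Alpha j) (wt k) else arrs s2 Alpha j)"
      using inp2 r by (auto simp: inp_def fun_eq_iff)
    show "runs ?body s2 30 (\<lambda>s''. ?I (Suc k) (set_reg EdgeIdx (Suc k) s''))"
    proof (rule runs_result)
      have "arrs (result ?body s2) Alpha j = 0 \<or> (\<exists>k'<Suc k. (a k' = j \<or> b k' = j) \<and> arrs (result ?body s2) Alpha j = wt k')"
        if "j < n" for j
      proof (cases "arrs (result ?body s2) Alpha j = arrs s2 Alpha j")
        case True
        then show ?thesis using I that by (metis less_SucI)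
      next
        case False
        then have "(a k = j \<or> b k = j) \<and> arrs (result ?body s2) Alpha j = wt k"
          unfolding res by (auto split: if_splits simp: max_def)
        then show ?thesis by blast
      qed
      moreover have "wt k' \<le> arrs (result ?body s2) Alpha (a k') \<and> wt k' \<le> arrs (result ?body s2) Alpha (b k')"
        if "k' < Suc k" for k'
        using I that unfolding res by (auto simp: less_Suc_eq intro: max.coboundedI1)
      ultimately show "?I (Suc k) (set_reg EdgeIdx (Suc k) (result ?body s2))"
        unfolding arrs_set_reg by blast
    qed simp_all
  next
    fix s2 assume I: "?I m s2"
    show "\<forall>j<n. arrs s2 Alpha j = al j"
    proof (intro allI impI)
      fix j assume j: "j < n"
      obtain k where k: "k < m" "a k = j \<or> b k = j" "al j = wt k" using al_attained[OF j] by blast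
      then have "al j \<le> arrs s2 Alpha j" using I by metis
      moreover have "arrs s2 Alpha j \<le> al j" using I j al_ge by (metis le0)
      ultimately show "arrs s2 Alpha j = al j" by simp
    qed
  qed (use inp in \<open>auto simp: same_def inp_def\<close>)
qed simp

lemma runs_number_copies:
  assumes "inp s" "\<forall>j<n. arrs s Alpha j = al j"
  shows "runs number_copies s (16 * n + 8) numbered"
  unfolding number_copies_def
proof (rule runs_Seq)
  show "runs (NumCopies ::= Lit 0) s 2 (\<lambda>s'. regs s' NumCopies = 0)" by (rule runs_result) auto
next
  let ?body = "Offset\<lblot>Reg NodeIdx\<rblot> ::= Reg NumCopies ;; NumCopies ::= Reg NumCopies \<boxplus> Alpha\<lbrakk>Reg NodeIdx\<rbrakk>"
  fix s1 assume zero: "regs s1 NumCopies = 0"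
    and sim: "same (mod_regs (NumCopies ::= Lit 0)) (mod_arrs (NumCopies ::= Lit 0)) s s1"
  have inp: "inp s1" using assms(1) sim by (rule inp_same) auto
  have al: "\<forall>j<n. arrs s1 Alpha j = al j" using assms sim by (simp add: same_def)
  show "runs (FOR NodeIdx BELOW Reg NumNodes DO ?body) s1 (16 * n + 6) numbered"
  proof (rule runs_For[where I = "\<lambda>k s'. regs s' NumCopies = off k \<and> (\<forall>j<k. arrs s' Offset j = off j)"
        and n = n and B = "\<lambda>_. 8"])
    fix s2 assume "regs s2 NumCopies = off n \<and> (\<forall>j<n. arrs s2 Offset j = off j)"
      and "same (mod_regs (FOR NodeIdx BELOW Reg NumNodes DO ?body)) (mod_arrs ?body) s1 s2"
    moreover from this have "inp s2" using inp by (elim inp_same) auto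
    ultimately show "numbered s2" using al by (simp add: numbered_def same_def)
  qed (use zero inp al in \<open>auto simp: same_def inp_def less_Suc_eq off_Suc off_def intro!: runs_result\<close>)
qed simp

section \<open>The edges of the unfolded graph by number\<close>

definition PA :: "nat \<times> nat \<Rightarrow> nat" where
  "PA p = off (a (fst p)) + snd p"

text \<open>The pair \<open>(k, c)\<close> stands for the edge between copy \<open>c + 1\<close> of
  \<open>a k\<close> and copy \<open>wt k - c\<close> of \<open>b k\<close>. Array positions count
  copies from 0, hence the further 1 subtracted here.\<close>

definition PB :: "nat \<times> nat \<Rightarrow> nat" where
  "PB p = off (b (fst p)) + (wt (fst p) - snd p - 1)"

definition valid :: "nat \<times> nat \<Rightarrow> bool" where
  "valid p \<longleftrightarrow> fst p < m \<and> snd p < wt (fst p)"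

definition halves :: "(nat \<times> nat) list \<Rightarrow> (nat \<times> nat) list" where
  "halves L = concat (map (\<lambda>p. [(PA p, PB p), (PB p, PA p)]) L)"

definition mated :: "nat \<times> nat \<Rightarrow> nat \<Rightarrow> nat \<Rightarrow> bool" where
  "mated p x y \<longleftrightarrow> valid p \<and> im (fst p) = 1 \<and> (x = PA p \<and> y = PB p \<or> x = PB p \<and> y = PA p)"

lemma PA_less: "valid p \<Longrightarrow> PA p < NC" and PB_less: "valid p \<Longrightarrow> PB p < NC"
  using ends[of "fst p"] al_ge[of "fst p"] off_less[of "a (fst p)" "snd p"]
    off_less[of "b (fst p)" "wt (fst p) - snd p - 1"]
  unfolding PA_def PB_def valid_def by auto

lemma PA_inj: "valid p \<Longrightarrow> valid q \<Longrightarrow> PA p = PA q \<Longrightarrow> a (fst p) = a (fst q) \<and> snd p = snd q"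
  using al_ge[of "fst p"] al_ge[of "fst q"] unfolding PA_def valid_def
  by (intro off_inj) auto

lemma PB_inj: "valid p \<Longrightarrow> valid q \<Longrightarrow> PB p = PB q \<Longrightarrow>
    b (fst p) = b (fst q) \<and> wt (fst p) - snd p - 1 = wt (fst q) - snd q - 1"
  using al_ge[of "fst p"] al_ge[of "fst q"] unfolding PB_def valid_def
  by (intro off_inj) auto

lemma PA_PB: "valid p \<Longrightarrow> valid q \<Longrightarrow> PA p = PB q \<Longrightarrow> a (fst p) = b (fst q)"
  using al_ge[of "fst p"] al_ge[of "fst q"] off_inj[of "a (fst p)" "snd p" "b (fst q)" "wt (fst q) - snd q - 1"]
  unfolding PA_def PB_def valid_def by auto

text \<open>Sharing a copy means sharing a node of the original graph. Distinct matched edges share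
  none, and the two ends of one edge differ, so both pairs name the same end of the same edge.
  Consequently no write to \<open>Mate\<close> changes an entry made before.\<close>

lemma mated_unique:
  assumes p: "mated p x y" and q: "mated q x z"
  shows "y = z"
proof -
  have v: "valid p" "valid q" "im (fst p) = 1" "im (fst q) = 1" using p q by (auto simp: mated_def)
  have m: "fst p < m" "fst q < m" using v by (auto simp: valid_def)
  have eq: "fst p = fst q" if "{a (fst p), b (fst p)} \<inter> {a (fst q), b (fst q)} \<noteq> {}"
    using im_disjoint[OF m v(3,4)] that by blast
  consider "x = PA p" "y = PB p" "x = PA q" "z = PB q" | "x = PA p" "y = PB p" "x = PB q" "z = PA q"
    | "x = PB p" "y = PA p" "x = PA q" "z = PB q" | "x = PB p" "y = PA p" "x = PB q" "z = PA q"
    using p q unfolding mated_def by blast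
  then show ?thesis
  proof cases
    case 1
    then have "p = q" using PA_inj[OF v(1,2)] eq by (simp add: prod_eq_iff)
    with 1 show ?thesis by simp
  next
    case 2
    then have "a (fst p) = b (fst q)" using PA_PB[OF v(1,2)] by simp
    then show ?thesis using eq no_loop[OF m(2)] by auto
  next
    case 3
    then have "a (fst q) = b (fst p)" using PA_PB[OF v(2,1)] by simp
    then show ?thesis using eq no_loop[OF m(1)] by auto
  next
    case 4
    then have "fst p = fst q" "wt (fst p) - snd p - 1 = wt (fst q) - snd q - 1"
      using PB_inj[OF v(1,2)] eq by auto
    then have "p = q" using v(1,2) by (auto simp: prod_eq_iff valid_def)
    with 4 show ?thesis by simp
  qed
qed

lemma mated_neq: "mated p x y \<Longrightarrow> x \<noteq> y"
  using PA_PB[of p p] no_loop[of "fst p"] by (auto simp: mated_def valid_def)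

definition mates :: "(nat \<times> nat) list \<Rightarrow> state \<Rightarrow> bool" where
  "mates L s \<longleftrightarrow> (\<forall>p\<in>set L. \<forall>x y. mated p x y \<longrightarrow> arrs s Mate x = Suc y) \<and>
    (\<forall>x<NC. arrs s Mate x = 0 \<or> (\<exists>p\<in>set L. mated p x (arrs s Mate x - 1)))"

definition built :: "(nat \<times> nat) list \<Rightarrow> state \<Rightarrow> bool" where
  "built L s \<longleftrightarrow> adjacency NC (halves L) s \<and> mates L s"

definition edge_body :: com where
  "edge_body =
         CopyA ::= Offset\<lbrakk>EndA\<lbrakk>Reg EdgeIdx\<rbrakk>\<rbrakk> \<boxplus> Reg CopyIdx ;;
         CopyB ::= Offset\<lbrakk>EndB\<lbrakk>Reg EdgeIdx\<rbrakk>\<rbrakk> \<boxplus> (Wt\<lbrakk>Reg EdgeIdx\<rbrakk> \<boxminus> Reg CopyIdx \<boxminus> Lit 1) ;;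
         add_half_edge CopyA CopyB ;;
         add_half_edge CopyB CopyA ;;
         IF InM\<lbrakk>Reg EdgeIdx\<rbrakk> \<doteq> Lit 1 THEN (
           Mate\<lblot>Reg CopyA\<rblot> ::= Reg CopyB \<boxplus> Lit 1 ;;
           Mate\<lblot>Reg CopyB\<rblot> ::= Reg CopyA \<boxplus> Lit 1)
         ELSE SKIP"

lemma built_step:
  assumes L: "built L s" and num: "numbered s" and p: "valid p"
    and r: "regs s EdgeIdx = fst p" "regs s CopyIdx = snd p"
  shows "built (L @ [p]) (result edge_body s)"
proof -
  define s1 where "s1 = set_reg CopyB (PB p) (set_reg CopyA (PA p) s)"
  define s2 where "s2 = result (add_half_edge CopyA CopyB) s1"
  define s3 where "s3 = result (add_half_edge CopyB CopyA) s2"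
  define mt where "mt = (if im (fst p) = 1
      then (arrs s Mate)(PA p := Suc (PB p), PB p := Suc (PA p)) else arrs s Mate)"
  have off: "arrs s Offset (a (fst p)) = off (a (fst p))" "arrs s Offset (b (fst p)) = off (b (fst p))"
    using num p ends by (auto simp: numbered_def valid_def)
  have inp: "arrs s EndA = a" "arrs s EndB = b" "arrs s Wt = wt" "arrs s InM = im"
    using num by (auto simp: numbered_def inp_def)
  have s4: "result edge_body s = (if im (fst p) = 1
      then set_arr Mate (PB p) (Suc (PA p)) (set_arr Mate (PA p) (Suc (PB p)) s3) else s3)"
    by (simp add: edge_body_def s3_def s2_def s1_def PA_def PB_def add_half_edge_frame inp r off)
  have adj1: "adjacency NC (halves L) s1"
    using L by (auto simp: built_def s1_def intro: adjacency_cong)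
  have adj2: "adjacency NC (halves L @ [(PA p, PB p)]) s2"
    unfolding s2_def by (rule add_half_edge_adjacency[OF adj1]) (auto simp: s1_def)
  have adj3: "adjacency NC ((halves L @ [(PA p, PB p)]) @ [(PB p, PA p)]) s3"
    unfolding s3_def by (rule add_half_edge_adjacency[OF adj2]) (auto simp: s1_def s2_def add_half_edge_frame)
  then have adj: "adjacency NC (halves (L @ [p])) (result edge_body s)"
    by (auto simp: s4 halves_def intro: adjacency_cong)
  have mate: "arrs (result edge_body s) Mate = mt"
    by (simp add: s4 mt_def s3_def s2_def s1_def add_half_edge_frame)
  have mt_p: "mt x = Suc y" if "mated p x y" for x y
    using that mated_neq[OF that] by (auto simp: mt_def mated_def)
  have mt_other: "mt x = arrs s Mate x \<or> mated p x (mt x - 1)" for x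
    using p by (auto simp: mt_def mated_def)
  \<comment> \<open>If the entry is written again, \<open>mated_unique\<close> shows that it
    receives its old value.\<close>
  have mt_old: "mt x = Suc y" if q: "q \<in> set L" "mated q x y" for q x y
  proof -
    have old: "arrs s Mate x = Suc y" using L q by (auto simp: built_def mates_def)
    from mt_other[of x] show ?thesis
    proof
      assume mp: "mated p x (mt x - 1)"
      then have "mt x = Suc (mt x - 1)" by (rule mt_p)
      with mated_unique[OF mp q(2)] show ?thesis by simp
    qed (simp add: old)
  qed
  have "mates (L @ [p]) (result edge_body s)"
    unfolding mates_def mate
  proof (intro conjI ballI allI impI)
    fix q x y assume "q \<in> set (L @ [p])" "mated q x y"
    then show "mt x = Suc y" using mt_old[of q x y] mt_p[of x y] by auto
  next
    fix x assume x: "x < NC"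
    from mt_other[of x] show "mt x = 0 \<or> (\<exists>q\<in>set (L @ [p]). mated q x (mt x - 1))"
    proof
      assume "mt x = arrs s Mate x"
      then show ?thesis using L x by (auto simp: built_def mates_def)
    qed auto
  qed
  with adj show ?thesis by (simp add: built_def)
qed

text \<open>The edges in the order in which the two nested loops create them.\<close>

definition slots :: "nat \<Rightarrow> (nat \<times> nat) list" where
  "slots K = concat (map (\<lambda>k. map (Pair k) [0..<wt k]) [0..<K])"

lemma slots_Suc: "slots (Suc K) = slots K @ map (Pair K) [0..<wt K]"
  by (simp add: slots_def)

lemma set_slots: "set (slots m) = {p. valid p}"
  by (auto simp: slots_def valid_def)

lemma length_slots: "length (slots K) = sum wt {..<K}"
  by (induction K) (auto simp: slots_Suc slots_def)

lemma distinct_slots: "distinct (slots K)"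
proof (induction K)
  case (Suc K)
  have "set (slots K) \<inter> set (map (Pair K) [0..<wt K]) = {}" by (auto simp: slots_def)
  with Suc show ?case by (auto simp: slots_Suc distinct_map inj_on_def)
qed (simp add: slots_def)

lemma max_cost_add_half_edge: "max_cost (add_half_edge x y) = 14" "loop_free (add_half_edge x y)"
    "mod_regs (add_half_edge x y) = {NumHalves}" "mod_arrs (add_half_edge x y) = {Target, Next, First}"
  by (auto simp: add_half_edge_def)

lemma edge_body_simps: "max_cost edge_body = 60" "loop_free edge_body"
    "mod_regs edge_body = {CopyA, CopyB, NumHalves}" "mod_arrs edge_body = {Target, Next, First, Mate}"
  by (auto simp: edge_body_def max_cost_add_half_edge)

text \<open>By \<open>runs_For\<close>, a round of the inner loop costs 60 for
  \<open>edge_body\<close> and 9 for the loop, together 69. Each round of the outer loop adds 7 for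
  starting and leaving the inner loop and 8 of its own, together 15.\<close>

lemma runs_edges:
  assumes num: "numbered s" and "built [] s"
  shows "runs (FOR EdgeIdx BELOW Reg NumEdges DO FOR CopyIdx BELOW Wt\<lbrakk>Reg EdgeIdx\<rbrakk> DO edge_body) s
      (69 * sum wt {..<m} + 15 * m + 6) (\<lambda>s'. numbered s' \<and> built (slots m) s')"
proof (rule runs_For[where I = "\<lambda>K s'. built (slots K) s'" and n = m and B = "\<lambda>k. 69 * wt k + 7"])
  show "built (slots 0) (set_reg EdgeIdx 0 s)"
    using assms(2) by (auto simp: built_def slots_def mates_def intro: adjacency_cong)
next
  let ?inner = "FOR CopyIdx BELOW Wt\<lbrakk>Reg EdgeIdx\<rbrakk> DO edge_body"
  fix k s1
  assume k: "k < m" "regs s1 EdgeIdx = k" and bu: "built (slots k) s1"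
    and sim: "same (mod_regs (FOR EdgeIdx BELOW Reg NumEdges DO ?inner)) (mod_arrs ?inner) s s1"
  have num1: "numbered s1" using num sim by (rule numbered_same) (auto simp: edge_body_simps)
  have built_set_reg: "built L (set_reg r c s')" if "built L s'" "r \<noteq> NumHalves" for L r c s'
    using that by (auto simp: built_def mates_def intro: adjacency_cong)
  show "runs ?inner s1 (69 * wt k + 7) (\<lambda>s'. built (slots (Suc k)) (set_reg EdgeIdx (Suc k) s'))"
  proof (rule runs_For[where I = "\<lambda>c s'. built (slots k @ map (Pair k) [0..<c]) s'" and n = "wt k" and B = "\<lambda>_. 60"])
    show "built (slots k @ map (Pair k) [0..<0]) (set_reg CopyIdx 0 s1)"
      using bu by (simp add: built_set_reg)
  next
    fix c s2
    assume c: "c < wt k" "built (slots k @ map (Pair k) [0..<c]) s2" "regs s2 CopyIdx = c"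
      and sim2: "same (mod_regs ?inner) (mod_arrs edge_body) s1 s2"
    have num2: "numbered s2" using num1 sim2 by (rule numbered_same) (auto simp: edge_body_simps)
    have "regs s2 EdgeIdx = k" using k sim2 by (auto simp: same_def edge_body_simps)
    then have "built ((slots k @ map (Pair k) [0..<c]) @ [(k, c)]) (result edge_body s2)"
      using c k by (intro built_step[OF c(2) num2]) (auto simp: valid_def)
    then show "runs edge_body s2 60 (\<lambda>s'. built (slots k @ map (Pair k) [0..<Suc c]) (set_reg CopyIdx (Suc c) s'))"
      by (intro runs_result) (auto simp: edge_body_simps intro: built_set_reg)
  next
    fix s2 assume "built (slots k @ map (Pair k) [0..<wt k]) s2"
    then show "built (slots (Suc k)) (set_reg EdgeIdx (Suc k) s2)"
      by (simp add: slots_Suc built_set_reg)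
  next
    fix s2 assume "same (mod_regs ?inner) (mod_arrs edge_body) s1 s2"
    then show "aval (Wt\<lbrakk>Reg EdgeIdx\<rbrakk>) s2 = wt k"
      using num1 k by (auto simp: same_def edge_body_simps numbered_def inp_def)
  qed (auto simp: edge_body_simps)
next
  fix s1 assume "built (slots m) s1"
    "same (mod_regs (FOR EdgeIdx BELOW Reg NumEdges DO FOR CopyIdx BELOW Wt\<lbrakk>Reg EdgeIdx\<rbrakk> DO edge_body))
      (mod_arrs (FOR CopyIdx BELOW Wt\<lbrakk>Reg EdgeIdx\<rbrakk> DO edge_body)) s s1"
  then show "numbered s1 \<and> built (slots m) s1"
    using num by (auto elim!: numbered_same simp: edge_body_simps)
qed (use num in \<open>auto simp: same_def edge_body_simps numbered_def inp_def sum.distrib sum_distrib_left\<close>)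

lemma runs_construct:
  assumes "inp s"
  shows "runs construct_unfolded s (69 * sum wt {..<m} + 14 * NC + 55 * m + 28 * n + 60)
    (\<lambda>s'. numbered s' \<and> built (slots m) s')"
  unfolding construct_unfolded_def edge_body_def[symmetric]
proof (rule runs_Seq[OF runs_count_copies[OF assms],
      where ?b2.0 = "16 * n + 8 + (14 * NC + 6 + (2 + (69 * sum wt {..<m} + 15 * m + 6)))"], goal_cases)
  case (1 s1)
  have "inp s1" using assms 1(2) by (rule inp_same) (auto simp: count_copies_def)
  show ?case
  proof (rule runs_Seq[OF runs_number_copies[OF \<open>inp s1\<close> 1(1)],
        where ?b2.0 = "14 * NC + 6 + (2 + (69 * sum wt {..<m} + 15 * m + 6))"], goal_cases)
    case (1 s2)
    let ?loop = "FOR CopyIdx BELOW Reg NumCopies DO (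
       First\<lblot>Reg CopyIdx\<rblot> ::= Lit 0 ;; Mate\<lblot>Reg CopyIdx\<rblot> ::= Lit 0)"
    have loop: "runs ?loop s2 (14 * NC + 6) (\<lambda>s'. \<forall>x<NC. arrs s' First x = 0 \<and> arrs s' Mate x = 0)"
      by (rule runs_For[where I = "\<lambda>k s'. \<forall>x<k. arrs s' First x = 0 \<and> arrs s' Mate x = 0" and n = NC and B = "\<lambda>_. 6"])
        (use 1 in \<open>auto simp: same_def numbered_def less_Suc_eq intro!: runs_result\<close>)
    show ?case
    proof (rule runs_Seq[OF loop, where ?b2.0 = "2 + (69 * sum wt {..<m} + 15 * m + 6)"], goal_cases)
      case (1 s3)
      have num3: "numbered s3" using \<open>numbered s2\<close> 1(2) by (rule numbered_same) auto
      have halves: "runs (NumHalves ::= Lit 0) s3 2 (\<lambda>s'. regs s' NumHalves = 0)"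
        by (rule runs_result) auto
      show ?case
      proof (rule runs_Seq[OF halves, where ?b2.0 = "69 * sum wt {..<m} + 15 * m + 6"], goal_cases)
        case (1 s4)
        have num4: "numbered s4" using num3 1(2) by (rule numbered_same) auto
        have "built [] s4" using 1 \<open>\<forall>x<NC. arrs s3 First x = 0 \<and> arrs s3 Mate x = 0\<close>
          by (auto simp: built_def adjacency_def mates_def halves_def same_def)
        then show ?case by (rule runs_edges[OF num4])
      qed (rule order_refl)
    qed (rule order_refl)
  qed (rule order_refl)
qed simp

end


section \<open>The breadth-first search\<close>

text \<open>The relation \<open>reach\<close> in terms of copy numbers and of the array
  \<open>Mate\<close> with its shifted entries.\<close>

inductive found :: "nat \<Rightarrow> (nat \<Rightarrow> nat) \<Rightarrow> (nat \<times> nat) list \<Rightarrow> nat \<Rightarrow> bool" for NC mt HL where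
  start: "x < NC \<Longrightarrow> mt x = 0 \<Longrightarrow> found NC mt HL x"
| step: "found NC mt HL x \<Longrightarrow> (x, y) \<in> set HL \<Longrightarrow> mt y = Suc z \<Longrightarrow> found NC mt HL z"

definition visit :: com where
  "visit =
         (Partner ::= Mate\<lbrakk>Target\<lbrakk>Reg Half \<boxminus> Lit 1\<rbrakk>\<rbrakk> ;;
         IF Lit 0 \<prec> Reg Partner THEN
           IF Rho\<lbrakk>Reg Partner \<boxminus> Lit 1\<rbrakk> \<doteq> Lit 1 THEN (
             Rho\<lblot>Reg Partner \<boxminus> Lit 1\<rblot> ::= Lit 0 ;;
             Queue\<lblot>Reg QTail\<rblot> ::= Reg Partner \<boxminus> Lit 1 ;;
             QTail ::= Reg QTail \<boxplus> Lit 1)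
           ELSE SKIP
         ELSE SKIP ;;
         Half ::= Next\<lbrakk>Reg Half \<boxminus> Lit 1\<rbrakk>)"

definition expand :: com where
  "expand =
       (Cur ::= Queue\<lbrakk>Reg QHead\<rbrakk> ;;
       QHead ::= Reg QHead \<boxplus> Lit 1 ;;
       Half ::= First\<lbrakk>Reg Cur\<rbrakk> ;;
       WHILE Lit 0 \<prec> Reg Half DO visit)"

lemma visit_simps: "max_cost visit = 36" "loop_free visit"
    "mod_regs visit = {Partner, QTail, Half}" "mod_arrs visit = {Rho, Queue}"
  by (auto simp: visit_def)

lemma expand_mod: "mod_regs expand = {Cur, QHead, Half, Partner, QTail}" "mod_arrs expand = {Rho, Queue}"
  by (auto simp: expand_def visit_simps)

locale bfs =
  fixes NC :: nat and HL :: "(nat \<times> nat) list" and nx fs mt :: "nat \<Rightarrow> nat"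
    and hs :: "nat \<Rightarrow> nat list"
  assumes chain: "x < NC \<Longrightarrow> chain nx (fs x) (hs x)"
    and hs: "x < NC \<Longrightarrow> distinct (hs x) \<and> set (hs x) = {h. h < length HL \<and> fst (HL ! h) = x}"
    and HL_less: "(x, y) \<in> set HL \<Longrightarrow> x < NC \<and> y < NC"
    and mt_le: "x < NC \<Longrightarrow> mt x \<le> NC"
begin

definition graph :: "state \<Rightarrow> bool" where
  "graph s \<longleftrightarrow> regs s NumCopies = NC \<and> (\<forall>h<length HL. arrs s Target h = snd (HL ! h)) \<and>
    arrs s Next = nx \<and> arrs s First = fs \<and> arrs s Mate = mt"

lemma graph_same:
  "graph s \<Longrightarrow> same R A s s' \<Longrightarrow> NumCopies \<notin> R \<Longrightarrow> {Target, Next, First, Mate} \<inter> A = {} \<Longrightarrow> graph s'"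
  by (simp add: graph_def same_def)

text \<open>\<open>q\<close> retains the nodes already taken out; only \<open>QHead\<close> moves.
  Thus membership in \<open>q\<close> coincides with \<open>Rho\<close> being 0, and distinctness
  says that no node is entered twice.\<close>

definition queued :: "nat list \<Rightarrow> state \<Rightarrow> bool" where
  "queued q s \<longleftrightarrow> regs s QTail = length q \<and> (\<forall>i<length q. arrs s Queue i = q ! i) \<and> distinct q \<and>
    (\<forall>x. x \<in> set q \<longleftrightarrow> x < NC \<and> arrs s Rho x = 0) \<and> (\<forall>x<NC. arrs s Rho x \<le> 1) \<and>
    (\<forall>x\<in>set q. found NC mt HL x) \<and> (\<forall>x<NC. mt x = 0 \<longrightarrow> x \<in> set q)"

lemma queued_cong:
  "queued q s \<Longrightarrow> regs s' QTail = regs s QTail \<Longrightarrow> arrs s' Queue = arrs s Queue \<Longrightarrow>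
    arrs s' Rho = arrs s Rho \<Longrightarrow> queued q s'"
  by (auto simp: queued_def)

definition closed :: "nat \<Rightarrow> nat set \<Rightarrow> bool" where
  "closed x Q \<longleftrightarrow> (\<forall>y z. (x, y) \<in> set HL \<longrightarrow> mt y = Suc z \<longrightarrow> z \<in> Q)"

lemma closed_mono: "closed x Q \<Longrightarrow> Q \<subseteq> Q' \<Longrightarrow> closed x Q'"
  by (auto simp: closed_def)

lemma visit_step:
  assumes q: "queued q s" and g: "graph s" and half: "regs s Half = Suc h"
    and h: "h < length HL" "fst (HL ! h) \<in> set q"
  shows "\<exists>r. queued (q @ r) (result visit s) \<and> regs (result visit s) Half = nx h \<and>
    (\<forall>z. mt (snd (HL ! h)) = Suc z \<longrightarrow> z \<in> set (q @ r))"
proof -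
  define y where "y = snd (HL ! h)"
  have y: "(fst (HL ! h), y) \<in> set HL" unfolding y_def using h(1) by simp
  have tgt: "arrs s Target h = y" using g h(1) by (simp add: graph_def y_def)
  have gs: "arrs s Next = nx" "arrs s Mate = mt" using g by (auto simp: graph_def)
  show ?thesis
  proof (cases "mt y")
    case 0
    then have "result visit s = set_reg Half (nx h) (set_reg Partner 0 s)"
      by (simp add: visit_def half tgt gs)
    then show ?thesis using q 0 by (intro exI[of _ "[]"]) (auto simp: queued_def y_def[symmetric])
  next
    case (Suc z)
    have z: "z < NC" using mt_le[of y] HL_less[OF y] Suc by simp
    show ?thesis
    proof (cases "arrs s Rho z = 1")
      case False
      then have "result visit s = set_reg Half (nx h) (set_reg Partner (Suc z) s)"
        by (simp add: visit_def half tgt gs Suc)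
      moreover have "arrs s Rho z = 0" using False q z by (force simp: queued_def le_Suc_eq)
      ultimately show ?thesis
        using q Suc z by (intro exI[of _ "[]"]) (auto simp: queued_def y_def[symmetric])
    next
      case True
      let ?s' = "result visit s"
      have res: "?s' = set_reg Half (nx h) (set_reg QTail (Suc (length q)) (set_arr Queue (length q) z
          (set_arr Rho z 0 (set_reg Partner (Suc z) s))))"
        using True q by (simp add: visit_def half tgt gs Suc queued_def)
      have "found NC mt HL z" using q h(2) y Suc by (auto simp: queued_def intro: found.step)
      moreover have "z \<notin> set q" using q True by (auto simp: queued_def)
      ultimately have "queued (q @ [z]) ?s'"
        using q z unfolding res by (auto simp: queued_def nth_append less_Suc_eq)
      moreover have "regs ?s' Half = nx h" unfolding res by simp
      ultimately show ?thesis using Suc by (intro exI[of _ "[z]"]) (simp add: y_def[symmetric])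
    qed
  qed
qed

lemma runs_expand:
  assumes q: "queued q s" and g: "graph s" and head: "regs s QHead < length q"
  shows "runs expand s (14 + 40 * length (hs (q ! regs s QHead)))
    (\<lambda>s'. \<exists>r. queued (q @ r) s' \<and> regs s' QHead = Suc (regs s QHead) \<and> closed (q ! regs s QHead) (set (q @ r)))"
proof -
  define x where "x = q ! regs s QHead"
  define s1 where "s1 = set_reg Half (fs x) (set_reg QHead (Suc (regs s QHead)) (set_reg Cur x s))"
  have xq: "x \<in> set q" using head by (simp add: x_def)
  have x: "x < NC" using xq q by (simp add: queued_def)
  have s1: "result (Cur ::= Queue\<lbrakk>Reg QHead\<rbrakk> ;; QHead ::= Reg QHead \<boxplus> Lit 1 ;; Half ::= First\<lbrakk>Reg Cur\<rbrakk>) s = s1"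
    using q g head by (simp add: s1_def x_def queued_def graph_def)
  have g1: "graph s1" using g by (simp add: graph_def s1_def)
  \<comment> \<open>\<open>visit\<close> costs at most 36 and the test 4, so every half-edge of
    \<open>x\<close> pays 40; the last test accounts for the remaining 4. In the invariant,
    \<open>don\<close> lists the half-edges inspected so far and \<open>rest\<close> those still
    ahead.\<close>
  have while: "runs (WHILE Lit 0 \<prec> Reg Half DO visit) s1 (40 * length (hs x) + 4)
      (\<lambda>s'. \<exists>r. queued (q @ r) s' \<and> regs s' QHead = Suc (regs s QHead) \<and> closed x (set (q @ r)))"
  proof (rule runs_While[where p = "40 * length (hs x)" and
        I = "\<lambda>p s'. \<exists>r rest don. queued (q @ r) s' \<and> chain nx (regs s' Half) rest \<and> hs x = don @ rest \<and>
          (\<forall>h\<in>set don. \<forall>z. mt (snd (HL ! h)) = Suc z \<longrightarrow> z \<in> set (q @ r)) \<and> p = 40 * length rest"])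
    show "\<exists>r rest don. queued (q @ r) s1 \<and> chain nx (regs s1 Half) rest \<and> hs x = don @ rest \<and>
          (\<forall>h\<in>set don. \<forall>z. mt (snd (HL ! h)) = Suc z \<longrightarrow> z \<in> set (q @ r)) \<and> 40 * length (hs x) = 40 * length rest"
    proof (rule exI[of _ "[]"], rule exI[of _ "hs x"], rule exI[of _ "[]"])
      have "queued (q @ []) s1" using q by (auto simp: s1_def intro: queued_cong)
      then show "queued (q @ []) s1 \<and> chain nx (regs s1 Half) (hs x) \<and> hs x = [] @ hs x \<and>
          (\<forall>h\<in>set []. \<forall>z. mt (snd (HL ! h)) = Suc z \<longrightarrow> z \<in> set (q @ [])) \<and> 40 * length (hs x) = 40 * length (hs x)"
        using chain[OF x] by (simp add: s1_def)
    qed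
  next
    fix p s2
    assume "\<exists>r rest don. queued (q @ r) s2 \<and> chain nx (regs s2 Half) rest \<and> hs x = don @ rest \<and>
          (\<forall>h\<in>set don. \<forall>z. mt (snd (HL ! h)) = Suc z \<longrightarrow> z \<in> set (q @ r)) \<and> p = 40 * length rest"
    then obtain r rest don where I: "queued (q @ r) s2" "chain nx (regs s2 Half) rest" "hs x = don @ rest"
        "\<forall>h\<in>set don. \<forall>z. mt (snd (HL ! h)) = Suc z \<longrightarrow> z \<in> set (q @ r)" "p = 40 * length rest" by blast
    assume sim: "same (mod_regs visit) (mod_arrs visit) s1 s2" and "bval (Lit 0 \<prec> Reg Half) s2"
    then obtain h rest' where rest: "rest = h # rest'" "regs s2 Half = Suc h" "chain nx (nx h) rest'"
      using I(2) by (cases rest) auto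
    have "h \<in> set (hs x)" using I(3) rest by simp
    then have h: "h < length HL" "fst (HL ! h) = x" using hs[OF x] by auto
    have g2: "graph s2" using g1 sim by (rule graph_same) (auto simp: visit_simps)
    have "fst (HL ! h) \<in> set (q @ r)" using h xq by simp
    from visit_step[OF I(1) g2 rest(2) h(1) this]
    obtain r' where r': "queued (q @ r @ r') (result visit s2)" "regs (result visit s2) Half = nx h"
        "\<forall>z. mt (snd (HL ! h)) = Suc z \<longrightarrow> z \<in> set (q @ r @ r')" by auto
    have "runs visit s2 36 (\<lambda>s''. \<exists>p'. (\<exists>r rest don. queued (q @ r) s'' \<and> chain nx (regs s'' Half) rest \<and> hs x = don @ rest \<and>
          (\<forall>h\<in>set don. \<forall>z. mt (snd (HL ! h)) = Suc z \<longrightarrow> z \<in> set (q @ r)) \<and> p' = 40 * length rest) \<and>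
          36 + bcost (Lit 0 \<prec> Reg Half) + 1 + p' \<le> p)"
    proof (rule runs_result)
      show "\<exists>p'. (\<exists>r rest don. queued (q @ r) (result visit s2) \<and> chain nx (regs (result visit s2) Half) rest \<and> hs x = don @ rest \<and>
          (\<forall>h\<in>set don. \<forall>z. mt (snd (HL ! h)) = Suc z \<longrightarrow> z \<in> set (q @ r)) \<and> p' = 40 * length rest) \<and>
          36 + bcost (Lit 0 \<prec> Reg Half) + 1 + p' \<le> p"
        using I r' rest
        by (intro exI[of _ "40 * length rest'"] conjI exI[of _ "r @ r'"] exI[of _ rest'] exI[of _ "don @ [h]"]) auto
    qed (auto simp: visit_simps)
    then show "\<exists>t. runs visit s2 t (\<lambda>s''. \<exists>p'. (\<exists>r rest don. queued (q @ r) s'' \<and> chain nx (regs s'' Half) rest \<and> hs x = don @ rest \<and>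
          (\<forall>h\<in>set don. \<forall>z. mt (snd (HL ! h)) = Suc z \<longrightarrow> z \<in> set (q @ r)) \<and> p' = 40 * length rest) \<and>
          t + bcost (Lit 0 \<prec> Reg Half) + 1 + p' \<le> p)" by blast
  next
    fix p s2
    assume "\<exists>r rest don. queued (q @ r) s2 \<and> chain nx (regs s2 Half) rest \<and> hs x = don @ rest \<and>
          (\<forall>h\<in>set don. \<forall>z. mt (snd (HL ! h)) = Suc z \<longrightarrow> z \<in> set (q @ r)) \<and> p = 40 * length rest"
    then obtain r rest don where I: "queued (q @ r) s2" "chain nx (regs s2 Half) rest" "hs x = don @ rest"
        "\<forall>h\<in>set don. \<forall>z. mt (snd (HL ! h)) = Suc z \<longrightarrow> z \<in> set (q @ r)" by blast
    assume sim: "same (mod_regs visit) (mod_arrs visit) s1 s2" and "\<not> bval (Lit 0 \<prec> Reg Half) s2"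
    then have "rest = []" using I(2) by (cases rest) auto
    then have don: "set don = {h. h < length HL \<and> fst (HL ! h) = x}" using I(3) hs[OF x] by simp
    have "closed x (set (q @ r))"
      unfolding closed_def
    proof (intro allI impI)
      fix y z assume "(x, y) \<in> set HL" and z: "mt y = Suc z"
      then obtain h where "h < length HL" "HL ! h = (x, y)" by (auto simp: in_set_conv_nth)
      then have "h \<in> set don" "snd (HL ! h) = y" using don by auto
      then show "z \<in> set (q @ r)" using I(4) z by blast
    qed
    moreover have "regs s2 QHead = Suc (regs s QHead)" using sim by (simp add: same_def visit_simps s1_def)
    ultimately show "\<exists>r. queued (q @ r) s2 \<and> regs s2 QHead = Suc (regs s QHead) \<and> closed x (set (q @ r))"
      using I(1) by blast
  qed simp
  show ?thesis
    unfolding x_def[symmetric] expand_def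
  proof (rule runs_Seq[where Q = "\<lambda>s'. s' = set_reg Cur x s" and ?b1.0 = 3 and ?b2.0 = "7 + (40 * length (hs x) + 4)"])
    show "runs (Cur ::= Queue\<lbrakk>Reg QHead\<rbrakk>) s 3 (\<lambda>s'. s' = set_reg Cur x s)"
      using q head by (intro runs_result) (auto simp: queued_def x_def)
    fix s' assume s': "s' = set_reg Cur x s"
    show "runs (QHead ::= Reg QHead \<boxplus> Lit 1 ;; Half ::= First\<lbrakk>Reg Cur\<rbrakk> ;; WHILE Lit 0 \<prec> Reg Half DO visit) s'
      (7 + (40 * length (hs x) + 4))
      (\<lambda>s'. \<exists>r. queued (q @ r) s' \<and> regs s' QHead = Suc (regs s QHead) \<and> closed x (set (q @ r)))"
    proof (rule runs_Seq[where Q = "\<lambda>s2. s2 = set_reg QHead (Suc (regs s QHead)) s'" and ?b1.0 = 4 and ?b2.0 = "3 + (40 * length (hs x) + 4)"])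
      show "runs (QHead ::= Reg QHead \<boxplus> Lit 1) s' 4 (\<lambda>s2. s2 = set_reg QHead (Suc (regs s QHead)) s')"
        by (intro runs_result) (auto simp: s')
      fix s2 assume s2: "s2 = set_reg QHead (Suc (regs s QHead)) s'"
      show "runs (Half ::= First\<lbrakk>Reg Cur\<rbrakk> ;; WHILE Lit 0 \<prec> Reg Half DO visit) s2 (3 + (40 * length (hs x) + 4))
        (\<lambda>s'. \<exists>r. queued (q @ r) s' \<and> regs s' QHead = Suc (regs s QHead) \<and> closed x (set (q @ r)))"
      proof (rule runs_Seq[where Q = "\<lambda>s3. s3 = s1" and ?b1.0 = 3])
        show "runs (Half ::= First\<lbrakk>Reg Cur\<rbrakk>) s2 3 (\<lambda>s3. s3 = s1)"
          using g by (intro runs_result) (auto simp: s1_def s2 s' graph_def)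
      qed (use while in auto)
    qed simp
  qed simp
qed

lemma found_queued:
  assumes "queued q s" "\<forall>x\<in>set q. closed x (set q)" "found NC mt HL x"
  shows "x \<in> set q"
  using assms(3)
proof induction
  case (start x)
  then show ?case using assms(1) by (auto simp: queued_def)
next
  case (step x y z)
  then show ?case using assms(2) by (auto simp: closed_def)
qed

text \<open>Each half-edge is in the list of its source and in no other, so all expansions together
  inspect it only once. This makes the search linear.\<close>

lemma sum_length_hs: "(\<Sum>x<NC. length (hs x)) = length HL"
proof -
  have "(\<Sum>x<NC. length (hs x)) = (\<Sum>x<NC. \<Sum>h | h \<in> {..<length HL} \<and> fst (HL ! h) = x. 1)"
  proof (rule sum.cong[OF refl])
    fix x assume "x \<in> {..<NC}"
    then have "distinct (hs x)" and "set (hs x) = {h. h < length HL \<and> fst (HL ! h) = x}"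
      using hs by auto
    then show "length (hs x) = (\<Sum>h | h \<in> {..<length HL} \<and> fst (HL ! h) = x. 1)"
      using distinct_card[of "hs x"] by simp
  qed
  also have "\<dots> = (\<Sum>h<length HL. 1)"
  proof (rule sum.group)
    show "(\<lambda>h. fst (HL ! h)) ` {..<length HL} \<subseteq> {..<NC}"
    proof clarify
      fix h assume "h < length HL"
      then have "(fst (HL ! h), snd (HL ! h)) \<in> set HL" by simp
      then show "fst (HL ! h) < NC" using HL_less by blast
    qed
  qed auto
  finally show ?thesis by simp
qed

text \<open>Amortized count: the potential charges 18, namely 14 within \<open>expand\<close> and 4
  for the test, plus 40 per half-edge to every copy not yet taken from the queue. As the queue is
  distinct, a copy is taken at most once; copies that never enter it only leave the bound
  generous.\<close>

lemma runs_search: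
  assumes q: "queued q s" and g: "graph s" and head: "regs s QHead = 0"
  shows "runs (WHILE Reg QHead \<prec> Reg QTail DO expand) s (18 * NC + 40 * length HL + 4)
    (\<lambda>s'. \<forall>x<NC. arrs s' Rho x = (if found NC mt HL x then 0 else 1))"
proof (rule runs_While[where
      I = "\<lambda>p s'. \<exists>q. queued q s' \<and> regs s' QHead \<le> length q \<and> (\<forall>x\<in>set (take (regs s' QHead) q). closed x (set q)) \<and>
        p = (\<Sum>x\<in>{..<NC} - set (take (regs s' QHead) q). 18 + 40 * length (hs x))"])
  show "\<exists>q. queued q s \<and> regs s QHead \<le> length q \<and> (\<forall>x\<in>set (take (regs s QHead) q). closed x (set q)) \<and>
        (\<Sum>x<NC. 18 + 40 * length (hs x)) = (\<Sum>x\<in>{..<NC} - set (take (regs s QHead) q). 18 + 40 * length (hs x))"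
    using q head by (intro exI[of _ q]) simp
next
  fix p s1
  assume "\<exists>q. queued q s1 \<and> regs s1 QHead \<le> length q \<and> (\<forall>x\<in>set (take (regs s1 QHead) q). closed x (set q)) \<and>
        p = (\<Sum>x\<in>{..<NC} - set (take (regs s1 QHead) q). 18 + 40 * length (hs x))"
  then obtain q where I: "queued q s1" "\<forall>x\<in>set (take (regs s1 QHead) q). closed x (set q)"
      "p = (\<Sum>x\<in>{..<NC} - set (take (regs s1 QHead) q). 18 + 40 * length (hs x))" by blast
  assume sim: "same (mod_regs expand) (mod_arrs expand) s s1" and "bval (Reg QHead \<prec> Reg QTail) s1"
  then have less: "regs s1 QHead < length q" using I(1) by (simp add: queued_def)
  have g1: "graph s1" using g sim by (rule graph_same) (auto simp: expand_mod)
  let ?i = "regs s1 QHead"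
  let ?x = "q ! ?i"
  have "?x \<in> set q" using less by simp
  then have x: "?x < NC" using I(1) by (simp add: queued_def)
  have "distinct q" using I(1) by (simp add: queued_def)
  then have fresh: "?x \<notin> set (take ?i q)"
    using less by (auto simp: in_set_conv_nth nth_eq_iff_index_eq)
  have take: "set (take (Suc ?i) q) = insert ?x (set (take ?i q))"
    using less by (simp add: take_Suc_conv_app_nth)
  have p: "p = 18 + 40 * length (hs ?x) + (\<Sum>x\<in>{..<NC} - set (take (Suc ?i) q). 18 + 40 * length (hs x))"
  proof -
    define S where "S = {..<NC} - set (take (Suc ?i) q)"
    have "{..<NC} - set (take ?i q) = insert ?x S" "?x \<notin> S" "finite S"
      using x fresh unfolding S_def take by auto
    then show ?thesis unfolding I(3) S_def[symmetric] by simp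
  qed
  have "runs expand s1 (14 + 40 * length (hs ?x)) (\<lambda>s''. \<exists>p'. (\<exists>q. queued q s'' \<and> regs s'' QHead \<le> length q \<and>
        (\<forall>x\<in>set (take (regs s'' QHead) q). closed x (set q)) \<and>
        p' = (\<Sum>x\<in>{..<NC} - set (take (regs s'' QHead) q). 18 + 40 * length (hs x))) \<and>
        14 + 40 * length (hs ?x) + bcost (Reg QHead \<prec> Reg QTail) + 1 + p' \<le> p)"
  proof (rule runs_mono[OF runs_expand[OF I(1) g1 less] order_refl])
    fix s2 assume "\<exists>r. queued (q @ r) s2 \<and> regs s2 QHead = Suc ?i \<and> closed ?x (set (q @ r))"
    then obtain r where r: "queued (q @ r) s2" "regs s2 QHead = Suc ?i" "closed ?x (set (q @ r))" by blast
    \<comment> \<open>New nodes are appended behind the processed prefix, and \<open>closed\<close>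
      is monotone in the queue, so the processed nodes remain closed.\<close>
    have t: "take (Suc ?i) (q @ r) = take (Suc ?i) q" using less by simp
    have "\<forall>x\<in>set (take (Suc ?i) (q @ r)). closed x (set (q @ r))"
      unfolding t take using I(2) r(3) closed_mono[of _ "set q" "set (q @ r)"] by auto
    then show "\<exists>p'. (\<exists>q. queued q s2 \<and> regs s2 QHead \<le> length q \<and>
        (\<forall>x\<in>set (take (regs s2 QHead) q). closed x (set q)) \<and>
        p' = (\<Sum>x\<in>{..<NC} - set (take (regs s2 QHead) q). 18 + 40 * length (hs x))) \<and>
        14 + 40 * length (hs ?x) + bcost (Reg QHead \<prec> Reg QTail) + 1 + p' \<le> p"
      using r(1,2) less p t
      by (intro exI[of _ "\<Sum>x\<in>{..<NC} - set (take (Suc ?i) q). 18 + 40 * length (hs x)"] conjI exI[of _ "q @ r"])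
        (simp_all del: take_append)
  qed
  then show "\<exists>t. runs expand s1 t (\<lambda>s''. \<exists>p'. (\<exists>q. queued q s'' \<and> regs s'' QHead \<le> length q \<and>
        (\<forall>x\<in>set (take (regs s'' QHead) q). closed x (set q)) \<and>
        p' = (\<Sum>x\<in>{..<NC} - set (take (regs s'' QHead) q). 18 + 40 * length (hs x))) \<and>
        t + bcost (Reg QHead \<prec> Reg QTail) + 1 + p' \<le> p)" by blast
next
  fix p s1
  assume "\<exists>q. queued q s1 \<and> regs s1 QHead \<le> length q \<and> (\<forall>x\<in>set (take (regs s1 QHead) q). closed x (set q)) \<and>
        p = (\<Sum>x\<in>{..<NC} - set (take (regs s1 QHead) q). 18 + 40 * length (hs x))"
  then obtain q where I: "queued q s1" "\<forall>x\<in>set (take (regs s1 QHead) q). closed x (set q)" by blast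
  assume "\<not> bval (Reg QHead \<prec> Reg QTail) s1"
  then have "take (regs s1 QHead) q = q" using I(1) by (simp add: queued_def)
  then have "\<forall>x\<in>set q. closed x (set q)" using I(2) by simp
  note found = found_queued[OF I(1) this]
  show "\<forall>x<NC. arrs s1 Rho x = (if found NC mt HL x then 0 else 1)"
  proof (intro allI impI)
    fix x assume x: "x < NC"
    have "x \<in> set q \<longleftrightarrow> arrs s1 Rho x = 0" "arrs s1 Rho x \<le> 1" "x \<in> set q \<longrightarrow> found NC mt HL x"
      using I(1) x unfolding queued_def by blast+
    then show "arrs s1 Rho x = (if found NC mt HL x then 0 else 1)" using found[of x] by auto
  qed
next
  show "(\<Sum>x<NC. 18 + 40 * length (hs x)) + bcost (Reg QHead \<prec> Reg QTail) + 1 \<le> 18 * NC + 40 * length HL + 4"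
    by (simp add: sum.distrib sum_distrib_left[symmetric] sum_length_hs)
qed

lemma runs_determine_rho:
  assumes g: "graph s"
  shows "runs determine_rho s (41 * NC + 40 * length HL + 14)
    (\<lambda>s'. \<forall>x<NC. arrs s' Rho x = (if found NC mt HL x then 0 else 1))"
  unfolding determine_rho_def visit_def[symmetric] expand_def[symmetric]
proof (rule runs_Seq[where Q = "\<lambda>s'. regs s' QHead = 0" and ?b1.0 = 2])
  show "runs (QHead ::= Lit 0) s 2 (\<lambda>s'. regs s' QHead = 0)" by (rule runs_result) auto
next
  let ?body = "IF Mate\<lbrakk>Reg CopyIdx\<rbrakk> \<doteq> Lit 0 THEN (
         Rho\<lblot>Reg CopyIdx\<rblot> ::= Lit 0 ;;
         Queue\<lblot>Reg QTail\<rblot> ::= Reg CopyIdx ;;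
         QTail ::= Reg QTail \<boxplus> Lit 1)
       ELSE Rho\<lblot>Reg CopyIdx\<rblot> ::= Lit 1"
  let ?loop = "FOR CopyIdx BELOW Reg NumCopies DO ?body"
  fix s1 assume head1: "regs s1 QHead = 0" and sim: "same (mod_regs (QHead ::= Lit 0)) (mod_arrs (QHead ::= Lit 0)) s s1"
  have g1: "graph s1" using g sim by (rule graph_same) auto
  show "runs (QTail ::= Lit 0 ;; ?loop ;; WHILE Reg QHead \<prec> Reg QTail DO expand) s1
      (2 + (23 * NC + 6 + (18 * NC + 40 * length HL + 4)))
      (\<lambda>s'. \<forall>x<NC. arrs s' Rho x = (if found NC mt HL x then 0 else 1))"
  proof (rule runs_Seq[where Q = "\<lambda>s'. regs s' QTail = 0"])
    show "runs (QTail ::= Lit 0) s1 2 (\<lambda>s'. regs s' QTail = 0)" by (rule runs_result) auto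
  next
    fix s2 assume tail2: "regs s2 QTail = 0" and sim: "same (mod_regs (QTail ::= Lit 0)) (mod_arrs (QTail ::= Lit 0)) s1 s2"
    have g2: "graph s2" using g1 sim by (rule graph_same) auto
    have head2: "regs s2 QHead = 0" using head1 sim by (simp add: same_def)
    define free where "free k = filter (\<lambda>x. mt x = 0) [0..<k]" for k
    show "runs (?loop ;; WHILE Reg QHead \<prec> Reg QTail DO expand) s2
        (23 * NC + 6 + (18 * NC + 40 * length HL + 4))
        (\<lambda>s'. \<forall>x<NC. arrs s' Rho x = (if found NC mt HL x then 0 else 1))"
    proof (rule runs_Seq[where Q = "queued (free NC)"])
      show "runs ?loop s2 (23 * NC + 6) (queued (free NC))"
      proof (rule runs_For[where n = NC and B = "\<lambda>_. 15" and
            I = "\<lambda>k s'. regs s' QTail = length (free k) \<and> (\<forall>i<length (free k). arrs s' Queue i = free k ! i) \<and>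
              (\<forall>x<k. arrs s' Rho x = (if mt x = 0 then 0 else 1))"])
        fix s3 assume "same (mod_regs ?loop) (mod_arrs ?body) s2 s3"
        then show "aval (Reg NumCopies) s3 = NC" using g2 by (simp add: same_def graph_def)
      next
        fix k s3
        assume I: "regs s3 QTail = length (free k) \<and> (\<forall>i<length (free k). arrs s3 Queue i = free k ! i) \<and>
              (\<forall>x<k. arrs s3 Rho x = (if mt x = 0 then 0 else 1))" and k: "regs s3 CopyIdx = k"
          and sim: "same (mod_regs ?loop) (mod_arrs ?body) s2 s3"
        have "arrs s3 Mate = mt" using sim g2 by (simp add: same_def graph_def)
        then show "runs ?body s3 15 (\<lambda>s'. (regs (set_reg CopyIdx (Suc k) s') QTail = length (free (Suc k)) \<and>
              (\<forall>i<length (free (Suc k)). arrs (set_reg CopyIdx (Suc k) s') Queue i = free (Suc k) ! i) \<and>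
              (\<forall>x<Suc k. arrs (set_reg CopyIdx (Suc k) s') Rho x = (if mt x = 0 then 0 else 1))))"
          using I k by (intro runs_result) (auto simp: free_def less_Suc_eq nth_append)
      next
        fix s3 :: state
        assume I: "regs s3 QTail = length (free NC) \<and> (\<forall>i<length (free NC). arrs s3 Queue i = free NC ! i) \<and>
              (\<forall>x<NC. arrs s3 Rho x = (if mt x = 0 then 0 else 1))"
        have set_free: "set (free NC) = {x. x < NC \<and> mt x = 0}" "distinct (free NC)"
          by (auto simp: free_def)
        show "queued (free NC) s3" using I set_free(2) unfolding queued_def set_free(1)
          by (auto intro: found.start split: if_splits)
      qed (use tail2 in \<open>auto simp: free_def\<close>)
    next
      fix s3 assume q: "queued (free NC) s3" and sim: "same (mod_regs ?loop) (mod_arrs ?loop) s2 s3"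
      have "graph s3" using g2 sim by (rule graph_same) auto
      moreover have "regs s3 QHead = 0" using head2 sim by (simp add: same_def)
      ultimately show "runs (WHILE Reg QHead \<prec> Reg QTail DO expand) s3 (18 * NC + 40 * length HL + 4)
          (\<lambda>s'. \<forall>x<NC. arrs s' Rho x = (if found NC mt HL x then 0 else 1))"
        using q by (intro runs_search)
    qed simp
  qed simp
qed simp

end

section \<open>Output and correctness\<close>

context ram_input
begin

lemma runs_output_cavities:
  assumes num: "numbered s"
  shows "runs output_cavities s (17 * NC + 22 * n + 18 * m + 14)
    (\<lambda>s'. \<forall>j<n. arrs s' Cavity j = (\<Sum>k<m. if im k = 1 then wt k else 0) - (\<Sum>i<al j. arrs s Rho (off j + i)))"
  unfolding output_cavities_def
proof (rule runs_Seq[where Q = "\<lambda>s'. regs s' Total = 0" and ?b1.0 = 2])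
  show "runs (Total ::= Lit 0) s 2 (\<lambda>s'. regs s' Total = 0)" by (rule runs_result) auto
next
  let ?tot = "\<lambda>K. \<Sum>k<K. if im k = 1 then wt k else 0"
  let ?body = "IF InM\<lbrakk>Reg EdgeIdx\<rbrakk> \<doteq> Lit 1 THEN Total ::= Reg Total \<boxplus> Wt\<lbrakk>Reg EdgeIdx\<rbrakk> ELSE SKIP"
  let ?loop = "FOR EdgeIdx BELOW Reg NumEdges DO ?body"
  let ?inner = "FOR CopyIdx BELOW Alpha\<lbrakk>Reg NodeIdx\<rbrakk> DO Loss ::= Reg Loss \<boxplus> Rho\<lbrakk>Offset\<lbrakk>Reg NodeIdx\<rbrakk> \<boxplus> Reg CopyIdx\<rbrakk>"
  let ?node = "Loss ::= Lit 0 ;; ?inner ;; Cavity\<lblot>Reg NodeIdx\<rblot> ::= Reg Total \<boxminus> Reg Loss"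
  let ?loss = "\<lambda>j c. \<Sum>i<c. arrs s Rho (off j + i)"
  fix s1 assume tot1: "regs s1 Total = 0" and sim: "same (mod_regs (Total ::= Lit 0)) (mod_arrs (Total ::= Lit 0)) s s1"
  have num1: "numbered s1" using num sim by (rule numbered_same) auto
  have rho1: "arrs s1 Rho = arrs s Rho" using sim by (simp add: same_def)
  show "runs (?loop ;; FOR NodeIdx BELOW Reg NumNodes DO ?node) s1 (18 * m + 6 + (17 * NC + 22 * n + 6))
      (\<lambda>s'. \<forall>j<n. arrs s' Cavity j = ?tot m - ?loss j (al j))"
  proof (rule runs_Seq[where Q = "\<lambda>s'. regs s' Total = ?tot m"])
    show "runs ?loop s1 (18 * m + 6) (\<lambda>s'. regs s' Total = ?tot m)"
      by (rule runs_For[where I = "\<lambda>k s'. regs s' Total = ?tot k" and n = m and B = "\<lambda>_. 10"])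
        (use tot1 num1 in \<open>auto simp: same_def numbered_def inp_def intro!: runs_result\<close>)
  next
    fix s2 assume tot2: "regs s2 Total = ?tot m" and sim: "same (mod_regs ?loop) (mod_arrs ?loop) s1 s2"
    have num2: "numbered s2" using num1 sim by (rule numbered_same) auto
    have rho2: "arrs s2 Rho = arrs s Rho" using sim rho1 by (simp add: same_def)
    show "runs (FOR NodeIdx BELOW Reg NumNodes DO ?node) s2 (17 * NC + 22 * n + 6)
        (\<lambda>s'. \<forall>j<n. arrs s' Cavity j = ?tot m - ?loss j (al j))"
    proof (rule runs_For[where I = "\<lambda>J s'. \<forall>j<J. arrs s' Cavity j = ?tot m - ?loss j (al j)"
          and n = n and B = "\<lambda>j. 17 * al j + 14"])
      fix j s3
      assume j: "j < n" "regs s3 NodeIdx = j" and I: "\<forall>j'<j. arrs s3 Cavity j' = ?tot m - ?loss j' (al j')"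
        and sim: "same (mod_regs (FOR NodeIdx BELOW Reg NumNodes DO ?node)) (mod_arrs ?node) s2 s3"
      have num3: "numbered s3" using num2 sim by (rule numbered_same) auto
      have rho3: "arrs s3 Rho = arrs s Rho" and tot3: "regs s3 Total = ?tot m"
        using sim rho2 tot2 by (simp_all add: same_def)
      show "runs ?node s3 (17 * al j + 14)
          (\<lambda>s'. \<forall>j'<Suc j. arrs (set_reg NodeIdx (Suc j) s') Cavity j' = ?tot m - ?loss j' (al j'))"
      proof (rule runs_Seq[where Q = "\<lambda>s'. regs s' Loss = 0" and ?b1.0 = 2 and ?b2.0 = "17 * al j + 7 + 5"])
        show "runs (Loss ::= Lit 0) s3 2 (\<lambda>s'. regs s' Loss = 0)" by (rule runs_result) auto
      next
        fix s4 assume loss4: "regs s4 Loss = 0" and sim4: "same (mod_regs (Loss ::= Lit 0)) (mod_arrs (Loss ::= Lit 0)) s3 s4"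
        have num4: "numbered s4" using num3 sim4 by (rule numbered_same) auto
        have facts4: "arrs s4 Rho = arrs s Rho" "regs s4 Total = ?tot m" "regs s4 NodeIdx = j" "arrs s4 Cavity = arrs s3 Cavity"
            "arrs s4 Alpha j = al j" "arrs s4 Offset j = off j"
          using sim4 rho3 tot3 j num4 by (auto simp: same_def numbered_def)
        show "runs (?inner ;; Cavity\<lblot>Reg NodeIdx\<rblot> ::= Reg Total \<boxminus> Reg Loss) s4 (17 * al j + 7 + 5)
          (\<lambda>s'. \<forall>j'<Suc j. arrs (set_reg NodeIdx (Suc j) s') Cavity j' = ?tot m - ?loss j' (al j'))"
        proof (rule runs_Seq[where Q = "\<lambda>s'. regs s' Loss = ?loss j (al j)"])
          show "runs ?inner s4 (17 * al j + 7) (\<lambda>s'. regs s' Loss = ?loss j (al j))"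
            by (rule runs_For[where I = "\<lambda>c s'. regs s' Loss = ?loss j c" and n = "al j" and B = "\<lambda>_. 8"])
              (use loss4 facts4 in \<open>auto simp: same_def intro!: runs_result\<close>)
        next
          fix s5 assume "regs s5 Loss = ?loss j (al j)" "same (mod_regs ?inner) (mod_arrs ?inner) s4 s5"
          then show "runs (Cavity\<lblot>Reg NodeIdx\<rblot> ::= Reg Total \<boxminus> Reg Loss) s5 5
            (\<lambda>s'. \<forall>j'<Suc j. arrs (set_reg NodeIdx (Suc j) s') Cavity j' = ?tot m - ?loss j' (al j'))"
            using facts4 I by (intro runs_result) (auto simp: same_def less_Suc_eq)
        qed simp
      qed simp
    next
      show "(\<Sum>j<n. 17 * al j + 14) + n * (acost (Reg NumNodes) + 7) + acost (Reg NumNodes) + 5 \<le> 17 * NC + 22 * n + 6"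
        by (simp add: sum.distrib off_def sum_distrib_left)
    qed (use num2 in \<open>auto simp: same_def numbered_def inp_def\<close>)
  qed simp
qed simp

end


section \<open>The size of the unfolded graph\<close>

context ram_input
begin

text \<open>The copies of a node are charged to a heaviest edge at it. An edge is charged by no more
  than its two ends, each time with its own weight.\<close>

lemma NC_le: "NC \<le> 2 * sum wt {..<m}"
proof -
  let ?f = "\<lambda>j k. (if a k = j then wt k else 0) + (if b k = j then wt k else 0)"
  have "al j \<le> (\<Sum>k<m. ?f j k)" if j: "j < n" for j
  proof -
    obtain k where k: "k < m" "a k = j \<or> b k = j" "al j = wt k" using al_attained[OF j] by blast
    then have "al j \<le> ?f j k" by auto
    also have "\<dots> \<le> (\<Sum>k<m. ?f j k)" using k(1) by (intro member_le_sum) auto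
    finally show ?thesis .
  qed
  then have "NC \<le> (\<Sum>j<n. \<Sum>k<m. ?f j k)" unfolding off_def by (intro sum_mono) simp
  also have "\<dots> = (\<Sum>k<m. \<Sum>j<n. ?f j k)" by (rule sum.swap)
  also have "\<dots> = (\<Sum>k<m. wt k + wt k)"
    using ends by (intro sum.cong) (auto simp: sum.distrib)
  finally show ?thesis by (simp add: sum.distrib)
qed

text \<open>Every node has an edge of positive weight and therefore at least one copy; this bounds
  the number of nodes by the total weight.\<close>

lemma n_le:
  assumes "\<And>k. k < m \<Longrightarrow> 0 < wt k"
  shows "n \<le> NC"
proof -
  have "(\<Sum>j<n. 1) \<le> NC"
    unfolding off_def using assms al_attained by (intro sum_mono) (force simp: Suc_le_eq)
  then show ?thesis by simp
qed

lemma length_halves: "length (halves L) = 2 * length L"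
  by (induction L) (auto simp: halves_def)

lemma nth_halves:
  "p < length L \<Longrightarrow> halves L ! (2 * p) = (PA (L ! p), PB (L ! p)) \<and>
    halves L ! (2 * p + 1) = (PB (L ! p), PA (L ! p))"
proof (induction L arbitrary: p)
  case (Cons x L)
  have [simp]: "halves (x # L) = (PA x, PB x) # (PB x, PA x) # halves L" by (simp add: halves_def)
  show ?case using Cons by (cases p) auto
qed simp

lemma set_halves: "(x, y) \<in> set (halves L) \<longleftrightarrow> (\<exists>p\<in>set L. x = PA p \<and> y = PB p \<or> x = PB p \<and> y = PA p)"
  by (auto simp: halves_def)

lemma halves_less: "(x, y) \<in> set (halves (slots m)) \<Longrightarrow> x < NC \<and> y < NC"
  by (auto simp: set_halves set_slots PA_less PB_less)

end

section \<open>Correspondence between the memory and the unfolded graph\<close>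

locale cavity_input = bipartite_matching G M X Y
  for G :: "'a wgraph" and M X Y +
  fixes nd :: "nat \<Rightarrow> 'a" and s :: state
  assumes input: "input s nd G M"
begin

abbreviation n where "n \<equiv> regs s NumNodes"
abbreviation m where "m \<equiv> regs s NumEdges"
abbreviation a where "a \<equiv> arrs s EndA"
abbreviation b where "b \<equiv> arrs s EndB"
abbreviation wt where "wt \<equiv> arrs s Wt"
abbreviation im where "im \<equiv> arrs s InM"
abbreviation al where "al j \<equiv> heaviest G (nd j)"

definition edge :: "nat \<Rightarrow> 'a set" where
  "edge k = {nd (a k), nd (b k)}"

lemma bij_nd: "bij_betw nd {..<n} (verts G)" and bij_edge: "bij_betw edge {..<m} (edges G)"
  using input by (auto simp: input_def edge_def[abs_def])

lemma edge_data:
  assumes "k < m"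
  shows "a k < n" "b k < n" "wt k = weight G (edge k)" "im k = (if edge k \<in> M then 1 else 0)"
    "edge k \<in> edges G"
  using input assms bij_betwE[OF bij_edge] by (auto simp: input_def edge_def)

lemma nd_eq: "j < n \<Longrightarrow> j' < n \<Longrightarrow> nd j = nd j' \<longleftrightarrow> j = j'"
  using bij_nd by (auto simp: bij_betw_def inj_on_def)

lemma edge_eq: "k < m \<Longrightarrow> k' < m \<Longrightarrow> edge k = edge k' \<longleftrightarrow> k = k'"
  using bij_edge by (auto simp: bij_betw_def inj_on_def)

lemma edge_ex: "e \<in> edges G \<Longrightarrow> \<exists>k<m. e = edge k"
  using bij_edge by (auto simp: bij_betw_def)

lemma nd_verts: "j < n \<Longrightarrow> nd j \<in> verts G"
  using bij_nd by (auto simp: bij_betw_def)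

lemma wt_pos: "k < m \<Longrightarrow> 0 < wt k"
  using edge_data[of k] pos by (auto simp: positive_weights_def)

lemma edge_ends_neq: "k < m \<Longrightarrow> nd (a k) \<noteq> nd (b k)"
  using edge_sides[of "nd (a k)" "nd (b k)"] edge_data(5)[of k] by (auto simp: edge_def)

sublocale ram_input n m a b wt im "\<lambda>j. al j"
proof
  fix k assume k: "k < m"
  show "a k < n \<and> b k < n" using edge_data[OF k] by blast
  show "wt k \<le> al (a k) \<and> wt k \<le> al (b k)"
    using heaviest_ge[OF edge_data(5)[OF k]] edge_data(3)[OF k] by (auto simp: edge_def)
  show "a k \<noteq> b k" using edge_ends_neq[OF k] by auto
  fix k' assume k': "k' < m" and im: "im k = 1" "im k' = 1" and "k \<noteq> k'"
  then have "edge k \<noteq> edge k'" using edge_eq k by blast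
  moreover have "edge k \<in> M" "edge k' \<in> M" using im edge_data(4) k k' by (metis zero_neq_one)+
  ultimately have "edge k \<inter> edge k' = {}" using matching by (auto simp: matching_def)
  then show "{a k, b k} \<inter> {a k', b k'} = {}" by (auto simp: edge_def)
next
  fix j assume j: "j < n"
  let ?S = "{weight G e | e. e \<in> edges G \<and> nd j \<in> e}"
  have "?S = weight G ` {e \<in> edges G. nd j \<in> e}" by blast
  then have "finite ?S" using finite_edges by simp
  moreover have "?S \<noteq> {}" using ex_edge[of "nd j"] nd_verts[OF j] verts by blast
  ultimately have "al j \<in> ?S" unfolding heaviest_def by (rule Max_in)
  then obtain e where e: "e \<in> edges G" "nd j \<in> e" "al j = weight G e" by blast
  then obtain k where k: "k < m" "e = edge k" using edge_ex by blast
  then have "a k = j \<or> b k = j" using e(2) nd_eq j edge_data[OF k(1)] by (auto simp: edge_def)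
  then show "\<exists>k<m. (a k = j \<or> b k = j) \<and> al j = wt k" using e(3) k edge_data(3) by auto
qed

text \<open>Decodes a number into node and copy. Below \<open>NC\<close> the chosen pair exists by
  \<open>off_cover\<close> and is unique by \<open>off_inj\<close>.\<close>

definition cp :: "nat \<Rightarrow> 'a \<times> nat" where
  "cp x = (case SOME (j, i). j < n \<and> i < al j \<and> x = off j + i of (j, i) \<Rightarrow> (nd j, i + 1))"

lemma cp_off:
  assumes "j < n" "i < al j"
  shows "cp (off j + i) = (nd j, i + 1)"
proof -
  have "(SOME (j', i'). j' < n \<and> i' < al j' \<and> off j + i = off j' + i') = (j, i)"
  proof (rule some_equality)
    fix p assume p: "case p of (j', i') \<Rightarrow> j' < n \<and> i' < al j' \<and> off j + i = off j' + i'"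
    obtain j' i' where p': "p = (j', i')" by (cases p)
    then show "p = (j, i)" using p off_inj[of j i j' i'] assms(2) by simp
  qed (use assms in simp)
  then show ?thesis by (simp add: cp_def)
qed

lemma bij_cp: "bij_betw cp {..<NC} (verts H)"
  unfolding bij_betw_def
proof
  show "inj_on cp {..<NC}"
  proof (rule inj_onI)
    fix x y assume "x \<in> {..<NC}" "y \<in> {..<NC}" and eq: "cp x = cp y"
    then obtain j i j' i' where "j < n" "i < al j" "x = off j + i" "j' < n" "i' < al j'" "y = off j' + i'"
      using off_cover[of x n] off_cover[of y n] by auto
    then show "x = y" using eq nd_eq by (simp add: cp_off)
  qed
  show "cp ` {..<NC} = verts H"
  proof (intro equalityI subsetI)
    fix v assume "v \<in> cp ` {..<NC}"
    then obtain x where x: "x < NC" "v = cp x" by auto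
    then obtain j i where "j < n" "i < al j" "x = off j + i" using off_cover[of x n] by blast
    then show "v \<in> verts H" using x nd_verts by (simp add: cp_off verts_H)
  next
    fix v assume "v \<in> verts H"
    then obtain u i where v: "v = (u, i)" "u \<in> verts G" "1 \<le> i" "i \<le> heaviest G u"
      by (cases v) (auto simp: verts_H)
    then obtain j where j: "j < n" "u = nd j" using bij_nd by (auto simp: bij_betw_def)
    then have "cp (off j + (i - 1)) = v" "off j + (i - 1) < NC"
      using v off_less[of j "i - 1"] cp_off[of j "i - 1"] by auto
    then show "v \<in> cp ` {..<NC}" by force
  qed
qed

lemma cp_eq: "x < NC \<Longrightarrow> y < NC \<Longrightarrow> cp x = cp y \<longleftrightarrow> x = y"
  using bij_cp by (auto simp: bij_betw_def inj_on_def)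

lemma cp_ex: "v \<in> verts H \<Longrightarrow> \<exists>x<NC. v = cp x"
  using bij_cp by (auto simp: bij_betw_def)

lemma cp_verts: "x < NC \<Longrightarrow> cp x \<in> verts H"
  using bij_cp by (auto simp: bij_betw_def)

definition slot_edge :: "nat \<times> nat \<Rightarrow> ('a \<times> nat) set" where
  "slot_edge p = {cp (PA p), cp (PB p)}"

lemma cp_PA: "valid p \<Longrightarrow> cp (PA p) = (nd (a (fst p)), snd p + 1)"
  using ends[of "fst p"] al_ge[of "fst p"] cp_off[of "a (fst p)" "snd p"]
  by (auto simp: PA_def valid_def)

lemma cp_PB: "valid p \<Longrightarrow> cp (PB p) = (nd (b (fst p)), wt (fst p) - snd p)"
  using ends[of "fst p"] al_ge[of "fst p"] cp_off[of "b (fst p)" "wt (fst p) - snd p - 1"]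
  by (auto simp: PB_def valid_def)

text \<open>The set \<open>F\<close> is left open in order to cover both the edges of the unfolded
  graph, with \<open>F = edges G\<close>, and the unfolded matching, with
  \<open>F = M\<close>.\<close>

lemma slot_edge_unfold:
  assumes "valid p"
  shows "slot_edge p \<in> unfold_edges G F \<longleftrightarrow> edge (fst p) \<in> F"
proof -
  have "fst p < m" "snd p < wt (fst p)" using assms by (auto simp: valid_def)
  then show ?thesis
    using edge_data(3)[of "fst p"]
    by (auto simp: slot_edge_def cp_PA[OF assms] cp_PB[OF assms] unfold_edges_iff edge_def)
qed

lemma slot_edge_inj: "inj_on slot_edge {p. valid p}"
proof (rule inj_onI)
  fix p q assume "p \<in> {p. valid p}" "q \<in> {p. valid p}" and eq: "slot_edge p = slot_edge q"
  then have v: "valid p" "valid q" by auto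
  then have m: "fst p < m" "fst q < m" by (auto simp: valid_def)
  \<comment> \<open>Forgetting the copy indices recovers the edge of \<open>G\<close>; as its ends
    differ, the index of the copy is then determined as well.\<close>
  have image: "edge (fst r) = fst ` slot_edge r" if "valid r" for r
    by (simp add: slot_edge_def cp_PA[OF that] cp_PB[OF that] edge_def)
  have k: "fst p = fst q" using image v eq edge_eq[OF m] by simp
  show "p = q"
    using eq edge_ends_neq[OF m(1)] k
    by (auto simp: slot_edge_def cp_PA cp_PB v doubleton_eq_iff prod_eq_iff)
qed

lemma slot_edge_ex:
  assumes "e \<in> edges H"
  shows "\<exists>p. valid p \<and> e = slot_edge p"
proof -
  obtain u i v j where e: "e = {(u, i), (v, j)}" "{u, v} \<in> edges G" "1 \<le> i" "1 \<le> j" "i + j = weight G {u, v} + 1"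
    using assms unfolding edges_H by (rule unfold_edgesE)
  obtain k where k: "k < m" "{u, v} = edge k" using edge_ex e(2) by blast
  have W: "i + j = wt k + 1" using e(5) k edge_data(3) by simp
  have "u = nd (a k) \<and> v = nd (b k) \<or> u = nd (b k) \<and> v = nd (a k)"
    using k(2) by (auto simp: edge_def doubleton_eq_iff)
  then show ?thesis
  proof
    assume "u = nd (a k) \<and> v = nd (b k)"
    moreover have "valid (k, i - 1)" using k W e by (simp add: valid_def)
    ultimately have "e = slot_edge (k, i - 1)" using e W by (auto simp: slot_edge_def cp_PA cp_PB)
    then show ?thesis using \<open>valid (k, i - 1)\<close> by blast
  next
    assume "u = nd (b k) \<and> v = nd (a k)"
    moreover have "valid (k, j - 1)" using k W e by (simp add: valid_def)
    ultimately have "e = slot_edge (k, j - 1)" using e W by (auto simp: slot_edge_def cp_PA cp_PB)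
    then show ?thesis using \<open>valid (k, j - 1)\<close> by blast
  qed
qed

lemma bij_slot_edge: "bij_betw slot_edge {p. valid p} (edges H)"
  unfolding bij_betw_def
proof (intro conjI slot_edge_inj equalityI subsetI)
  fix e assume "e \<in> slot_edge ` {p. valid p}"
  then obtain p where p: "valid p" "e = slot_edge p" by blast
  then show "e \<in> edges H" using slot_edge_unfold[OF p(1)] edge_data(5)[of "fst p"] by (auto simp: edges_H valid_def)
qed (use slot_edge_ex in blast)

lemma card_edges_H: "card (edges H) = length (slots m)"
proof -
  have "card (edges H) = card (set (slots m))"
    using bij_betw_same_card[OF bij_slot_edge] set_slots by simp
  then show ?thesis using distinct_slots distinct_card by metis
qed

lemma sum_wt: "sum wt {..<m} = total_weight G"
proof -
  have "total_weight G = (\<Sum>k<m. weight G (edge k))"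
    unfolding total_weight_def using sum.reindex_bij_betw[OF bij_edge] by metis
  then show ?thesis using edge_data(3) by simp
qed

lemma sum_matched: "(\<Sum>k<m. if im k = 1 then wt k else 0) = mwm G"
proof -
  have "(\<Sum>k<m. if im k = 1 then wt k else 0) = (\<Sum>k<m. if edge k \<in> M then weight G (edge k) else 0)"
    using edge_data by (intro sum.cong) auto
  also have "\<dots> = (\<Sum>e\<in>edges G. if e \<in> M then weight G e else 0)"
    by (rule sum.reindex_bij_betw[OF bij_edge])
  also have "\<dots> = sum (weight G) (edges G \<inter> M)" using finite_edges by (simp add: sum.inter_restrict)
  also have "edges G \<inter> M = M" using M_edges by blast
  finally show ?thesis using sum_M by simp
qed

lemma doubleton_cp:
  assumes "x < NC" "y < NC" "valid p" "{cp x, cp y} = slot_edge p"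
  shows "x = PA p \<and> y = PB p \<or> x = PB p \<and> y = PA p"
  using assms(4) PA_less[OF assms(3)] PB_less[OF assms(3)] assms(1,2)
  by (auto simp: slot_edge_def doubleton_eq_iff cp_eq)

lemma edges_H_cp:
  assumes "x < NC" "y < NC"
  shows "{cp x, cp y} \<in> edges H \<longleftrightarrow> (x, y) \<in> set (halves (slots m))"
proof
  assume "{cp x, cp y} \<in> edges H"
  then obtain p where p: "valid p" "{cp x, cp y} = slot_edge p" using slot_edge_ex by blast
  then show "(x, y) \<in> set (halves (slots m))"
    using doubleton_cp[OF assms p] unfolding set_halves set_slots by blast
next
  assume "(x, y) \<in> set (halves (slots m))"
  then obtain p where p: "valid p" "x = PA p \<and> y = PB p \<or> x = PB p \<and> y = PA p"
    by (auto simp: set_halves set_slots)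
  then have "{cp x, cp y} = slot_edge p" by (auto simp: slot_edge_def insert_commute)
  then show "{cp x, cp y} \<in> edges H" using bij_slot_edge p(1) by (auto simp: bij_betw_def)
qed

lemma mated_N: "mated p x y \<Longrightarrow> {cp x, cp y} \<in> N"
proof -
  assume p: "mated p x y"
  then have "{cp x, cp y} = slot_edge p" by (auto simp: mated_def slot_edge_def insert_commute)
  moreover have "edge (fst p) \<in> M" using p edge_data(4)[of "fst p"] by (auto simp: mated_def valid_def split: if_splits)
  ultimately show "{cp x, cp y} \<in> N" using p slot_edge_unfold by (simp add: mated_def)
qed

lemma N_mated:
  assumes "e \<in> N"
  shows "\<exists>p. mated p (PA p) (PB p) \<and> e = slot_edge p"
proof -
  have "e \<in> edges H" using assms N_edges by blast
  then obtain p where p: "valid p" "e = slot_edge p" using slot_edge_ex by blast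
  then have "edge (fst p) \<in> M" using assms slot_edge_unfold by simp
  then have "mated p (PA p) (PB p)" using p edge_data(4)[of "fst p"] by (auto simp: mated_def valid_def)
  then show ?thesis using p by blast
qed

lemma mates_mated: "mates (slots m) s' \<Longrightarrow> mated p x y \<Longrightarrow> arrs s' Mate x = Suc y"
  unfolding mates_def set_slots mated_def by blast

lemma mates_ex:
  assumes "mates (slots m) s'" "x < NC" "arrs s' Mate x = Suc y"
  shows "\<exists>p. mated p x y"
proof -
  have "arrs s' Mate x = 0 \<or> (\<exists>p\<in>set (slots m). mated p x (arrs s' Mate x - 1))"
    using assms(1,2) unfolding mates_def by blast
  then show ?thesis using assms(3) by auto
qed

lemma N_cp:
  assumes mates: "mates (slots m) s'" and "x < NC" "y < NC"
  shows "{cp x, cp y} \<in> N \<longleftrightarrow> arrs s' Mate x = Suc y"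
proof
  assume "{cp x, cp y} \<in> N"
  then obtain p where p: "mated p (PA p) (PB p)" "{cp x, cp y} = slot_edge p" using N_mated by blast
  then have "valid p" by (simp add: mated_def)
  then have "mated p x y" using doubleton_cp[OF assms(2,3)] p by (auto simp: mated_def)
  then show "arrs s' Mate x = Suc y" by (rule mates_mated[OF mates])
next
  assume "arrs s' Mate x = Suc y"
  then obtain p where "mated p x y" using mates_ex[OF mates assms(2)] by blast
  then show "{cp x, cp y} \<in> N" by (rule mated_N)
qed

lemma mate_less:
  assumes "mates (slots m) s'" "x < NC"
  shows "arrs s' Mate x \<le> NC"
proof (cases "arrs s' Mate x")
  case (Suc y)
  then obtain p where "mated p x y" using mates_ex[OF assms] by blast
  then have "y < NC" by (auto simp: mated_def PA_less PB_less)
  then show ?thesis using Suc by simp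
qed simp

lemma edge_H_other:
  assumes "e \<in> edges H" "v \<in> e"
  shows "\<exists>y<NC. e = {v, cp y}"
proof -
  obtain p where "valid p" "e = slot_edge p" using slot_edge_ex assms by blast
  then show ?thesis using assms(2) PA_less[of p] PB_less[of p] by (auto simp: slot_edge_def insert_commute)
qed

lemma unmatched_cp:
  assumes "mates (slots m) s'" "x < NC"
  shows "matched_by N (cp x) \<longleftrightarrow> arrs s' Mate x \<noteq> 0"
proof
  assume "matched_by N (cp x)"
  then obtain e where "e \<in> N" "cp x \<in> e" by (auto simp: matched_by_def)
  moreover from this obtain y where "y < NC" "e = {cp x, cp y}" using edge_H_other N_edges by blast
  ultimately show "arrs s' Mate x \<noteq> 0" using N_cp[OF assms] by simp
next
  assume "arrs s' Mate x \<noteq> 0"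
  then obtain y where y: "arrs s' Mate x = Suc y" using not0_implies_Suc by blast
  then have "y < NC" using mate_less[OF assms] by simp
  then have "{cp x, cp y} \<in> N" using N_cp[OF assms] y by simp
  then show "matched_by N (cp x)" by (auto simp: matched_by_def)
qed

text \<open>\<open>cp\<close> translates the rules of one induction into those of the other. In the
  direction from \<open>reach\<close>, its surjectivity provides the numbers of the intermediate
  nodes.\<close>

lemma found_reach:
  assumes mates: "mates (slots m) s'" and x: "x < NC"
  shows "found NC (arrs s' Mate) (halves (slots m)) x \<longleftrightarrow> reach H N (cp x)"
proof
  assume "found NC (arrs s' Mate) (halves (slots m)) x"
  then have "x < NC \<and> reach H N (cp x)"
  proof induction
    case (start x)
    then show ?case using unmatched_cp[OF mates] cp_verts by (auto intro: reach.unmatched)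
  next
    case (step x y z)
    then have y: "y < NC" using halves_less by blast
    then have z: "z < NC" using mate_less[OF mates y] step by simp
    have "{cp x, cp y} \<in> edges H" using step y edges_H_cp by blast
    moreover have "{cp y, cp z} \<in> N" using N_cp[OF mates y z] step by simp
    ultimately show ?case using step z by (auto intro: reach.step)
  qed
  then show "reach H N (cp x)" by simp
next
  have "reach H N v \<Longrightarrow> \<forall>x<NC. v = cp x \<longrightarrow> found NC (arrs s' Mate) (halves (slots m)) x" for v
  proof (induction rule: reach.induct)
    case (unmatched v)
    then show ?case using unmatched_cp[OF mates] by (auto intro: found.start)
  next
    case (step u v z)
    show ?case
    proof (intro allI impI)
      fix x assume x: "x < NC" "z = cp x"
      have "u \<in> verts H" "v \<in> verts H" using edges_verts[OF step.hyps(2)] by auto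
      then obtain x' y where x': "x' < NC" "u = cp x'" and y: "y < NC" "v = cp y" using cp_ex by meson
      have "found NC (arrs s' Mate) (halves (slots m)) x'" using step.IH x' by blast
      moreover have "(x', y) \<in> set (halves (slots m))" using step.hyps x' y edges_H_cp by blast
      moreover have "arrs s' Mate y = Suc x" using N_cp[OF mates y(1) x(1)] step.hyps x y by simp
      ultimately show "found NC (arrs s' Mate) (halves (slots m)) x" by (rule found.step)
    qed
  qed
  then show "found NC (arrs s' Mate) (halves (slots m)) x" if "reach H N (cp x)" using that x by blast
qed

lemma N_eq:
  assumes mates: "mates (slots m) s'"
  shows "N = {{cp x, cp (arrs s' Mate x - 1)} | x. x < NC \<and> arrs s' Mate x > 0}"
proof (intro equalityI subsetI)
  fix e assume "e \<in> N"
  then obtain p where p: "mated p (PA p) (PB p)" "e = slot_edge p" using N_mated by blast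
  then have "PA p < NC" "arrs s' Mate (PA p) = Suc (PB p)"
    using mates_mated[OF mates p(1)] p(1) by (auto simp: mated_def PA_less)
  then show "e \<in> {{cp x, cp (arrs s' Mate x - 1)} | x. x < NC \<and> arrs s' Mate x > 0}"
    using p by (auto simp: slot_edge_def intro!: exI[of _ "PA p"])
next
  fix e assume "e \<in> {{cp x, cp (arrs s' Mate x - 1)} | x. x < NC \<and> arrs s' Mate x > 0}"
  then obtain x where x: "x < NC" "arrs s' Mate x > 0" "e = {cp x, cp (arrs s' Mate x - 1)}" by blast
  then obtain p where "mated p x (arrs s' Mate x - 1)"
    using mates_ex[OF mates x(1), of "arrs s' Mate x - 1"] by auto
  then show "e \<in> N" using x(3) mated_N by simp
qed

lemma built_holds_unfolded:
  assumes num: "numbered s'" and built: "built (slots m) s'" and nodes: "regs s' NumNodes = n"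
  shows "holds_unfolded s' nd cp G M"
  unfolding holds_unfolded_def
proof (intro conjI allI impI)
  let ?L = "slots m"
  have mates: "mates ?L s'" and halves: "regs s' NumHalves = 2 * length ?L"
    and target: "\<And>h. h < 2 * length ?L \<Longrightarrow> arrs s' Target h = snd (halves ?L ! h)"
    using built by (auto simp: built_def adjacency_def length_halves)
  have NC: "regs s' NumCopies = NC" using num by (simp add: numbered_def)
  show "bij_betw cp {..<regs s' NumCopies} (verts H)" using bij_cp NC by simp
  show "regs s' NumHalves = 2 * card (edges H)" using halves card_edges_H by simp
  show "arrs s' Alpha j = heaviest G (nd j)" if "j < regs s' NumNodes" for j
    using num that nodes by (simp add: numbered_def)
  show "arrs s' Offset j + i < regs s' NumCopies" "cp (arrs s' Offset j + i) = (nd j, i + 1)"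
    if "j < regs s' NumNodes" "i < arrs s' Alpha j" for j i
    using num that nodes NC off_less cp_off by (auto simp: numbered_def)
  show "arrs s' Target h < regs s' NumCopies" if "h < regs s' NumHalves" for h
  proof -
    have "(fst (halves ?L ! h), snd (halves ?L ! h)) \<in> set (halves ?L)"
      using that halves by (simp add: length_halves)
    from halves_less[OF this] show ?thesis using that halves target[of h] NC by simp
  qed
  show "bij_betw (\<lambda>p. {cp (arrs s' Target (2 * p)), cp (arrs s' Target (2 * p + 1))})
       {..<card (edges H)} (edges H)"
  proof -
    have "bij_betw (\<lambda>p. ?L ! p) {..<length ?L} {p. valid p}"
      using distinct_slots by (intro bij_betw_nth) (auto simp: set_slots)
    then have "bij_betw (slot_edge \<circ> (\<lambda>p. ?L ! p)) {..<length ?L} (edges H)"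
      using bij_slot_edge by (rule bij_betw_trans)
    moreover have "(slot_edge \<circ> (\<lambda>p. ?L ! p)) p = {cp (arrs s' Target (2 * p)), cp (arrs s' Target (2 * p + 1))}"
      if "p \<in> {..<length ?L}" for p
    proof -
      have "arrs s' Target (2 * p) = PB (?L ! p)" "arrs s' Target (2 * p + 1) = PA (?L ! p)"
        using that target[of "2 * p"] target[of "2 * p + 1"] nth_halves[of p ?L] by auto
      then show ?thesis by (simp add: slot_edge_def insert_commute)
    qed
    ultimately show ?thesis
      unfolding card_edges_H by (rule bij_betw_cong[THEN iffD1, rotated])
  qed
  show "arrs s' Mate x \<le> regs s' NumCopies" if "x < regs s' NumCopies" for x
    using mate_less[OF mates] that NC by simp
  show "N = {{cp x, cp (arrs s' Mate x - 1)} | x. x < regs s' NumCopies \<and> arrs s' Mate x > 0}"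
    using N_eq[OF mates] NC by simp
qed

section \<open>Result and running time of the whole procedure\<close>

lemma runs_rho:
  assumes num: "numbered s'" and built: "built (slots m) s'"
  shows "runs determine_rho s' (41 * NC + 80 * total_weight G + 14)
    (\<lambda>s''. \<forall>x<NC. arrs s'' Rho x = rho G M (cp x))"
proof -
  let ?HL = "halves (slots m)"
  have adj: "adjacency NC ?HL s'" and mates: "mates (slots m) s'" using built by (auto simp: built_def)
  let ?P = "\<lambda>x hs. x < NC \<longrightarrow> chain (arrs s' Next) (arrs s' First x) hs \<and> distinct hs \<and>
      set hs = {h. h < length ?HL \<and> fst (?HL ! h) = x}"
  have "\<forall>x. \<exists>hs. ?P x hs" using adj unfolding adjacency_def by blast
  then have "\<exists>hs. \<forall>x. ?P x (hs x)" by (rule choice)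
  then obtain hs where hs: "\<forall>x. ?P x (hs x)" by blast
  interpret bfs NC ?HL "arrs s' Next" "arrs s' First" "arrs s' Mate" hs
  proof
    show "x < NC \<and> y < NC" if "(x, y) \<in> set ?HL" for x y
      using that by (rule halves_less)
  qed (use hs mate_less[OF mates] in auto)
  have "graph s'" using adj num by (simp add: graph_def adjacency_def numbered_def)
  then show ?thesis
  proof (rule runs_mono[OF runs_determine_rho])
    show "41 * NC + 40 * length ?HL + 14 \<le> 41 * NC + 80 * total_weight G + 14"
      by (simp add: length_halves length_slots sum_wt)
    show "\<forall>x<NC. arrs s'' Rho x = rho G M (cp x)"
      if "\<forall>x<NC. arrs s'' Rho x = (if found NC (arrs s' Mate) ?HL x then 0 else 1)" for s''
      using that found_reach[OF mates] rho_reach by simp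
  qed
qed

lemma built_same:
  "built L s1 \<Longrightarrow> same R A s1 s2 \<Longrightarrow> NumHalves \<notin> R \<Longrightarrow> {Target, Next, First, Mate} \<inter> A = {} \<Longrightarrow> built L s2"
  by (simp add: built_def mates_def same_def adjacency_def)

lemma determine_rho_mod:
  "mod_regs determine_rho = {QHead, QTail, CopyIdx, Cur, Half, Partner}"
  "mod_arrs determine_rho = {Rho, Queue}"
  by (auto simp: determine_rho_def)

lemma output_cavities_mod:
  "mod_regs output_cavities = {Total, EdgeIdx, NodeIdx, Loss, CopyIdx}"
  "mod_arrs output_cavities = {Cavity}"
  by (auto simp: output_cavities_def)

text \<open>With \<open>W\<close> the total weight, the three phases add up to
  \<open>149 * W + 72 * NC + 50 * n + 73 * m + 88\<close>. Inserting \<open>NC \<le> 2 * W\<close>,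
  \<open>n \<le> 2 * W\<close> and \<open>m \<le> W\<close> gives 466 = 149 + 144 + 100 +
  73.\<close>

lemma runs_compute_all_cavity:
  "runs compute_all_cavity s (466 * total_weight G + 88) (\<lambda>s'.
     holds_unfolded s' nd cp G M \<and> (\<forall>x < regs s' NumCopies. arrs s' Rho x = rho G M (cp x)) \<and>
     (\<forall>j<n. arrs s' Cavity j = mwm G - (\<Sum>i = 1..heaviest G (nd j). rho G M (nd j, i))))"
proof -
  let ?W = "total_weight G"
  have "inp s" by (simp add: inp_def)
  have bounds: "NC \<le> 2 * ?W" "n \<le> 2 * ?W" "m \<le> ?W"
  proof -
    show "NC \<le> 2 * ?W" using NC_le sum_wt by simp
    then show "n \<le> 2 * ?W" using n_le[OF wt_pos] by simp
    have "(\<Sum>k<m. 1) \<le> sum wt {..<m}" using wt_pos by (intro sum_mono) (simp add: Suc_le_eq)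
    then show "m \<le> ?W" using sum_wt by simp
  qed
  show ?thesis
    unfolding compute_all_cavity_def
  proof (rule runs_Seq[OF runs_construct[OF \<open>inp s\<close>],
        where ?b2.0 = "41 * NC + 80 * ?W + 14 + (17 * NC + 22 * n + 18 * m + 14)"], goal_cases)
    case (1 s1)
    then have num1: "numbered s1" and built1: "built (slots m) s1" by auto
    show ?case
    proof (rule runs_Seq[OF runs_rho[OF num1 built1], where ?b2.0 = "17 * NC + 22 * n + 18 * m + 14"], goal_cases)
      case (1 s2)
      have num2: "numbered s2" using num1 1(2) by (rule numbered_same) (auto simp: determine_rho_mod)
      have built2: "built (slots m) s2" using built1 1(2) by (rule built_same) (auto simp: determine_rho_mod)
      show ?case
      proof (rule runs_mono[OF runs_output_cavities[OF num2] order_refl], intro conjI)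
        fix s3
        assume cav: "\<forall>j<n. arrs s3 Cavity j = (\<Sum>k<m. if im k = 1 then wt k else 0) - (\<Sum>i<al j. arrs s2 Rho (off j + i))"
          and sim: "same (mod_regs output_cavities) (mod_arrs output_cavities) s2 s3"
        have num3: "numbered s3" using num2 sim by (rule numbered_same) (auto simp: output_cavities_mod)
        have built3: "built (slots m) s3" using built2 sim by (rule built_same) (auto simp: output_cavities_mod)
        have regs3: "regs s3 NumNodes = n" "regs s3 NumCopies = NC"
          using num3 by (auto simp: numbered_def inp_def)
        show "holds_unfolded s3 nd cp G M" using num3 built3 regs3(1) by (rule built_holds_unfolded)
        show "\<forall>x<regs s3 NumCopies. arrs s3 Rho x = rho G M (cp x)"
          using 1(1) sim by (simp add: regs3 same_def output_cavities_mod)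
        have "(\<Sum>i<al j. arrs s2 Rho (off j + i)) = (\<Sum>i = 1..al j. rho G M (nd j, i))" if j: "j < n" for j
        proof -
          have "(\<Sum>i<al j. arrs s2 Rho (off j + i)) = (\<Sum>i<al j. rho G M (nd j, Suc i))"
            using 1(1) j off_less[OF j] cp_off[OF j] by (intro sum.cong) auto
          then show ?thesis by (simp add: sum.atLeast1_atMost_eq)
        qed
        then show "\<forall>j<n. arrs s3 Cavity j = mwm G - (\<Sum>i = 1..al j. rho G M (nd j, i))"
          using cav sum_matched by simp
      qed
    qed (rule order_refl)
  next
    case 2
    show ?case using bounds by (simp add: sum_wt)
  qed
qed

end

theorem theorem4p4:
  "\<exists>T :: nat \<Rightarrow> real. T \<in> O(\<lambda>W. real W) \<and>
     (\<forall>(G :: 'a wgraph) M nd s.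
        bipartite G \<and> positive_weights G \<and> no_isolated G \<and> max_weight_matching G M \<and>
        input s nd G M \<longrightarrow>
        (\<exists>t s'. exec compute_all_cavity s t s' \<and>
           real t \<le> T (total_weight G) \<and>
           (\<exists>cp. holds_unfolded s' nd cp G M \<and>
              (\<forall>x < regs s' NumCopies. arrs s' Rho x = rho G M (cp x))) \<and>
           (\<forall>j < regs s NumNodes.
              int (arrs s' Cavity j) =
                int (mwm G) - (\<Sum>i = 1..heaviest G (nd j). int (rho G M (nd j, i))) \<and>
              arrs s' Cavity j = mwm (delete_vertex G (nd j)))))"
proof (intro exI[of _ "\<lambda>W. real (466 * W + 88)"] conjI allI impI)
  \<comment> \<open>From \<open>W = 1\<close> on, the constant 88 is at most \<open>88 * W\<close>,
    hence the factor 554 = 466 + 88.\<close>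
  show "(\<lambda>W. real (466 * W + 88)) \<in> O(\<lambda>W. real W)"
    by (rule bigoI[where c = 554], rule eventually_mono[OF eventually_ge_at_top[of 1]]) simp
next
  fix G :: "'a wgraph" and M nd s
  assume *: "bipartite G \<and> positive_weights G \<and> no_isolated G \<and> max_weight_matching G M \<and> input s nd G M"
  then obtain X Y where "verts G = X \<union> Y" "X \<inter> Y = {}" "\<forall>e\<in>edges G. \<exists>x\<in>X. \<exists>y\<in>Y. e = {x, y}" "finite (verts G)"
    by (auto simp: bipartite_def)
  then interpret cavity_input G M X Y nd s using * by unfold_locales auto
  obtain t s' where t: "exec compute_all_cavity s t s'" "t \<le> 466 * total_weight G + 88"
    and s': "holds_unfolded s' nd cp G M" "\<forall>x < regs s' NumCopies. arrs s' Rho x = rho G M (cp x)"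
      "\<forall>j<n. arrs s' Cavity j = mwm G - (\<Sum>i = 1..heaviest G (nd j). rho G M (nd j, i))"
    using runs_compute_all_cavity unfolding runs_def by blast
  \<comment> \<open>By \<open>cavity\<close> the sum does not exceed \<open>mwm G\<close>, so the
    truncated subtraction of the machine agrees with the one over the integers.\<close>
  have "int (arrs s' Cavity j) = int (mwm G) - (\<Sum>i = 1..heaviest G (nd j). int (rho G M (nd j, i))) \<and>
      arrs s' Cavity j = mwm (delete_vertex G (nd j))" if "j < n" for j
    using s'(3) that cavity[OF nd_verts[OF that]] by (simp flip: of_nat_sum)
  then show "\<exists>t s'. exec compute_all_cavity s t s' \<and>
           real t \<le> real (466 * total_weight G + 88) \<and>
           (\<exists>cp. holds_unfolded s' nd cp G M \<and>
              (\<forall>x < regs s' NumCopies. arrs s' Rho x = rho G M (cp x))) \<and>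
           (\<forall>j < regs s NumNodes.
              int (arrs s' Cavity j) =
                int (mwm G) - (\<Sum>i = 1..heaviest G (nd j). int (rho G M (nd j, i))) \<and>
              arrs s' Cavity j = mwm (delete_vertex G (nd j)))"
    using t s' by (metis of_nat_le_iff)
qed

end
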